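(* For each triple $(x_1,x_2,x_3)$ in the list $(1,2,0),(5,4,0),(2,3,1),(0,5,1),(3,4,2),(4,5,3)$ (type A) and $(5,0,1),(1,0,5),(0,1,2),(2,1,0),(1,2,3),(3,2,1),(2,3,4),(4,3,2),(3,4,5),(5,4,3),(4,5,0),(0,5,4)$ (type B), let $\rho_{(x_1,x_2,x_3)}:\Gamma\to\mathrm{GL}_3(\mathbb{C})$ be the representation with $\rho(T)=\mathrm{diag}(\lambda_1,\lambda_2,\lambda_3)$, $\lambda_j=e^{2\pi i x_j/6}$, and $\rho(S)=\begin{pmatrix}-\sigma&1&1\\0&\sigma&0\\0&0&\sigma\end{pmatrix}$ with $\sigma=\lambda_2^3$ for type A, respectively $\rho(S)=\begin{pmatrix}\sigma&-2\sigma&1\\0&-\sigma&1\\0&0&\sigma\end{pmatrix}$ with $\sigma=\lambda_1^3$ for type B; here $\rho_0$ is the subrepresentation spanned by the first two standard basis vectors (reducible but indecomposable) and the quotient is the character $\chi^{2x_3}$. (i) If $(x_1,x_2,x_3)\notin\{(5,4,0),(5,0,1),(4,5,0)\}$, then $\rho_{(x_1,x_2,x_3)}$ is $M$-split and its generating weights are $(2x_1,2x_2,2x_3)$. (ii) $\rho_{(5,0,1)}$ is $M$-split and its generating weights are $(2,4,6)$. (iii) $\rho_{(5,4,0)}$ and $\rho_{(4,5,0)}$ are not $M$-split and their generating weights are $(4,6,8)$.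
   Context: $\Gamma=\mathrm{PSL}_2(\mathbb{Z})$, $S,T$ the images of $\begin{pmatrix}0&-1\\1&0\end{pmatrix}$, $\begin{pmatrix}1&1\\0&1\end{pmatrix}$; representations of $\Gamma$ are viewed as representations of $\mathrm{SL}_2(\mathbb{Z})$ trivial on $-I$. $\chi^m$ is the character with $\chi^m(T)=e^{2\pi im/12}$. For a finite-dimensional representation $\rho$ on $V$, let $L$ be the unique endomorphism with $e^{2\pi iL}=\rho(T)$ whose eigenvalues have real parts in $[0,1)$; a holomorphic vector-valued modular form of weight $k$ for $\rho$ is a holomorphic $F:\mathbb{H}\to V$ with $F(\gamma\tau)=(c\tau+d)^k\rho(\gamma)F(\tau)$ for all $\gamma\in\mathrm{SL}_2(\mathbb{Z})$ and $e^{-2\pi i\tau L}F(\tau)$ holomorphic at $q=e^{2\pi i\tau}=0$. $M(\rho)=\bigoplus_kM_k(\rho)$ is free of rank $\dim\rho$ over $R=\mathbb{C}[E_4,E_6]$, and the generating weights are the weights of a homogeneous $R$-basis. For an exact sequence $0\to\rho_0\to\rho\to\rho_1\to0$, $\rho$ is $M$-split if the induced map $M(\rho)\to M(\rho_1)$ is surjective. *)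

theory Defs
  imports "HOL-Complex_Analysis.Complex_Analysis" "HOL-Library.Multiset"
begin

section \<open>Representations of the modular group\<close>

definition SL2Z :: "(int^2^2) set" where
  "SL2Z = {A. det A = 1}"

definition S_mat :: "int^2^2" where
  "S_mat = vector [vector [0, -1], vector [1, 0]]"

definition T_mat :: "int^2^2" where
  "T_mat = vector [vector [1, 1], vector [0, 1]]"

text \<open>A representation is a total function on integer matrices of which only the values on
  \<^const>\<open>SL2Z\<close> matter.\<close>

definition SL2Z_rep :: "(int^2^2 \<Rightarrow> complex^'n^'n) \<Rightarrow> bool" where
  "SL2Z_rep \<rho> \<longleftrightarrow>
     \<rho> (mat 1) = mat 1 \<and> (\<forall>A\<in>SL2Z. \<forall>B\<in>SL2Z. \<rho> (A ** B) = \<rho> A ** \<rho> B)"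

definition PSL2Z_rep :: "(int^2^2 \<Rightarrow> complex^'n^'n) \<Rightarrow> bool" where
  "PSL2Z_rep \<rho> \<longleftrightarrow> SL2Z_rep \<rho> \<and> \<rho> (- mat 1) = mat 1"

text \<open>The abelianisation of \<^const>\<open>SL2Z\<close> is generated by the image of \<^const>\<open>T_mat\<close>, so
  this determines \<open>\<psi>\<close> on \<^const>\<open>SL2Z\<close>: it is the character \<open>\<chi>\<^sup>m\<close>.\<close>

definition is_chi :: "int \<Rightarrow> (int^2^2 \<Rightarrow> complex^1^1) \<Rightarrow> bool" where
  "is_chi m \<psi> \<longleftrightarrow>
     SL2Z_rep \<psi> \<and> \<psi> T_mat = mat (exp (2 * of_real pi * \<i> * of_int m / 12))"

definition invariant_subspace :: "(int^2^2 \<Rightarrow> complex^'n^'n) \<Rightarrow> (complex^'n) set \<Rightarrow> bool" where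
  "invariant_subspace \<rho> W \<longleftrightarrow> vec.subspace W \<and> (\<forall>\<gamma>\<in>SL2Z. \<forall>v\<in>W. \<rho> \<gamma> *v v \<in> W)"

definition reducible_rep :: "(int^2^2 \<Rightarrow> complex^'n^'n) \<Rightarrow> bool" where
  "reducible_rep \<rho> \<longleftrightarrow> (\<exists>W. invariant_subspace \<rho> W \<and> W \<noteq> {0} \<and> W \<noteq> UNIV)"

definition indecomposable_rep :: "(int^2^2 \<Rightarrow> complex^'n^'n) \<Rightarrow> bool" where
  "indecomposable_rep \<rho> \<longleftrightarrow>
     \<not> (\<exists>U W. invariant_subspace \<rho> U \<and> invariant_subspace \<rho> W \<and> U \<noteq> {0} \<and> W \<noteq> {0} \<and>
            U \<inter> W = {0} \<and> (\<forall>v. \<exists>u\<in>U. \<exists>w\<in>W. v = u + w))"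

text \<open>\<open>0 \<rightarrow> \<rho>0 \<rightarrow> \<rho> \<rightarrow> \<rho>1 \<rightarrow> 0\<close> is exact, the maps being given by the matrices \<open>J\<close> and \<open>P\<close>.\<close>

definition exact_sequence ::
  "(int^2^2 \<Rightarrow> complex^'m^'m) \<Rightarrow> complex^'m^'n \<Rightarrow> (int^2^2 \<Rightarrow> complex^'n^'n) \<Rightarrow>
   complex^'n^'l \<Rightarrow> (int^2^2 \<Rightarrow> complex^'l^'l) \<Rightarrow> bool" where
  "exact_sequence \<rho>0 J \<rho> P \<rho>1 \<longleftrightarrow>
     SL2Z_rep \<rho>0 \<and> SL2Z_rep \<rho> \<and> SL2Z_rep \<rho>1 \<and>
     (\<forall>\<gamma>\<in>SL2Z. J ** \<rho>0 \<gamma> = \<rho> \<gamma> ** J) \<and> (\<forall>\<gamma>\<in>SL2Z. P ** \<rho> \<gamma> = \<rho>1 \<gamma> ** P) \<and>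
     inj ((*v) J) \<and> range ((*v) J) = {v. P *v v = 0} \<and> surj ((*v) P)"


section \<open>The exponent matrix\<close>

definition matrix_exp :: "complex^'n^'n \<Rightarrow> complex^'n^'n" where
  "matrix_exp A = (\<Sum>k. (1 / fact k) *\<^sub>R (((**) A ^^ k) (mat 1)))"

definition eigenvalue_of :: "complex^'n^'n \<Rightarrow> complex \<Rightarrow> bool" where
  "eigenvalue_of A c \<longleftrightarrow> (\<exists>v. v \<noteq> 0 \<and> A *v v = c *s v)"

definition exponent_matrix :: "(int^2^2 \<Rightarrow> complex^'n^'n) \<Rightarrow> complex^'n^'n" where
  "exponent_matrix \<rho> =
     (THE L. matrix_exp (mat (2 * of_real pi * \<i>) ** L) = \<rho> T_mat \<and>
             (\<forall>c. eigenvalue_of L c \<longrightarrow> 0 \<le> Re c \<and> Re c < 1))"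


section \<open>Vector-valued modular forms\<close>

definition upper_half_plane :: "complex set" where
  "upper_half_plane = {\<tau>. Im \<tau> > 0}"

definition moebius :: "int^2^2 \<Rightarrow> complex \<Rightarrow> complex" where
  "moebius \<gamma> \<tau> =
     (of_int (\<gamma>$1$1) * \<tau> + of_int (\<gamma>$1$2)) / (of_int (\<gamma>$2$1) * \<tau> + of_int (\<gamma>$2$2))"

text \<open>A function on the upper half plane is encoded as a function on \<open>\<complex>\<close> vanishing elsewhere.
  A function of \<open>q\<close> on the punctured unit disc is holomorphic at \<open>q = 0\<close> iff it is the restriction
  of a function holomorphic on the full disc.\<close>

definition modular_forms ::
  "int \<Rightarrow> (int^2^2 \<Rightarrow> complex^'n^'n) \<Rightarrow> (complex \<Rightarrow> complex^'n) set" where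
  "modular_forms k \<rho> = {F.
     (\<forall>\<tau>. \<tau> \<notin> upper_half_plane \<longrightarrow> F \<tau> = 0) \<and>
     (\<forall>i. (\<lambda>\<tau>. F \<tau> $ i) holomorphic_on upper_half_plane) \<and>
     (\<forall>\<gamma>\<in>SL2Z. \<forall>\<tau>\<in>upper_half_plane.
        F (moebius \<gamma> \<tau>) = (of_int (\<gamma>$2$1) * \<tau> + of_int (\<gamma>$2$2)) powi k *s (\<rho> \<gamma> *v F \<tau>)) \<and>
     (\<exists>G. (\<forall>i. (\<lambda>q. G q $ i) holomorphic_on ball 0 1) \<and>
        (\<forall>\<tau>\<in>upper_half_plane.
           matrix_exp (mat (- 2 * of_real pi * \<i> * \<tau>) ** exponent_matrix \<rho>) *v F \<tau> =
           G (exp (2 * of_real pi * \<i> * \<tau>))))}"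

text \<open>The direct sum \<open>M(\<rho>)\<close> of all \<^term>\<open>modular_forms k \<rho>\<close>, as an internal sum of spaces of
  functions; the lemma \<open>modular_forms_sum_direct\<close> below shows that this sum is direct.\<close>

definition all_modular_forms ::
  "(int^2^2 \<Rightarrow> complex^'n^'n) \<Rightarrow> (complex \<Rightarrow> complex^'n) set" where
  "all_modular_forms \<rho> =
     {(\<lambda>\<tau>. \<Sum>k\<in>K. F k \<tau>) | K F. finite K \<and> (\<forall>k\<in>K. F k \<in> modular_forms k \<rho>)}"

text \<open>\<open>P\<close> is the matrix of the surjection \<open>\<rho> \<rightarrow> \<rho>1\<close> of an \<^const>\<open>exact_sequence\<close>.\<close>

definition M_split ::
  "(int^2^2 \<Rightarrow> complex^'n^'n) \<Rightarrow> complex^'n^'l \<Rightarrow> (int^2^2 \<Rightarrow> complex^'l^'l) \<Rightarrow> bool" where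
  "M_split \<rho> P \<rho>1 \<longleftrightarrow> (\<lambda>F \<tau>. P *v F \<tau>) ` all_modular_forms \<rho> = all_modular_forms \<rho>1"


section \<open>The module structure over the ring generated by the Eisenstein series\<close>

text \<open>Normalised to have constant term 1; absolutely convergent for \<open>k \<ge> 3\<close>.\<close>

definition eisenstein :: "nat \<Rightarrow> complex \<Rightarrow> complex" where
  "eisenstein k \<tau> =
     (1/2) * (\<Sum>\<^sub>\<infinity>(c, d) \<in> {(c, d). coprime c d}. 1 / (of_int c * \<tau> + of_int d) ^ k)"

text \<open>The algebra \<open>R = \<complex>[E\<^sub>4, E\<^sub>6]\<close>; its elements are only ever considered on
  \<^const>\<open>upper_half_plane\<close>.\<close>

inductive_set E4E6_ring :: "(complex \<Rightarrow> complex) set" where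
  const: "(\<lambda>\<tau>. a) \<in> E4E6_ring"
| E4: "eisenstein 4 \<in> E4E6_ring"
| E6: "eisenstein 6 \<in> E4E6_ring"
| add: "f \<in> E4E6_ring \<Longrightarrow> g \<in> E4E6_ring \<Longrightarrow> (\<lambda>\<tau>. f \<tau> + g \<tau>) \<in> E4E6_ring"
| mult: "f \<in> E4E6_ring \<Longrightarrow> g \<in> E4E6_ring \<Longrightarrow> (\<lambda>\<tau>. f \<tau> * g \<tau>) \<in> E4E6_ring"

text \<open>\<open>B 0, \<dots>, B (n - 1)\<close> with \<open>n = length ws\<close> is an \<open>R\<close>-basis of \<open>M(\<rho>)\<close> and
  \<open>B i\<close> is homogeneous of weight \<open>ws ! i\<close>.\<close>

definition homogeneous_basis ::
  "(int^2^2 \<Rightarrow> complex^'n^'n) \<Rightarrow> int list \<Rightarrow> (nat \<Rightarrow> complex \<Rightarrow> complex^'n) \<Rightarrow> bool" where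
  "homogeneous_basis \<rho> ws B \<longleftrightarrow>
     (\<forall>i<length ws. B i \<in> modular_forms (ws ! i) \<rho>) \<and>
     (\<forall>F\<in>all_modular_forms \<rho>. \<exists>r. (\<forall>i<length ws. r i \<in> E4E6_ring) \<and>
        F = (\<lambda>\<tau>. \<Sum>i<length ws. r i \<tau> *s B i \<tau>)) \<and>
     (\<forall>r. (\<forall>i<length ws. r i \<in> E4E6_ring) \<and>
        (\<forall>\<tau>\<in>upper_half_plane. (\<Sum>i<length ws. r i \<tau> *s B i \<tau>) = 0) \<longrightarrow>
        (\<forall>i<length ws. \<forall>\<tau>\<in>upper_half_plane. r i \<tau> = 0))"

text \<open>The weights are a multiset: a homogeneous basis carries no preferred order.\<close>

definition generating_weights :: "(int^2^2 \<Rightarrow> complex^'n^'n) \<Rightarrow> int multiset \<Rightarrow> bool" where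
  "generating_weights \<rho> W \<longleftrightarrow> (\<exists>ws B. homogeneous_basis \<rho> ws B \<and> W = mset ws)"


section \<open>The three-dimensional representations\<close>

definition type_A :: "(nat \<times> nat \<times> nat) set" where
  "type_A = {(1,2,0), (5,4,0), (2,3,1), (0,5,1), (3,4,2), (4,5,3)}"

definition type_B :: "(nat \<times> nat \<times> nat) set" where
  "type_B = {(5,0,1), (1,0,5), (0,1,2), (2,1,0), (1,2,3), (3,2,1), (2,3,4), (4,3,2), (3,4,5),
             (5,4,3), (4,5,0), (0,5,4)}"

definition lam :: "nat \<Rightarrow> complex" where
  "lam x = exp (2 * of_real pi * \<i> * of_nat x / 6)"

definition rho_T :: "nat \<times> nat \<times> nat \<Rightarrow> complex^3^3" where
  "rho_T = (\<lambda>(x1, x2, x3).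
     vector [vector [lam x1, 0, 0], vector [0, lam x2, 0], vector [0, 0, lam x3]])"

definition rho_S_A :: "nat \<times> nat \<times> nat \<Rightarrow> complex^3^3" where
  "rho_S_A = (\<lambda>(x1, x2, x3). let \<sigma> = lam x2 ^ 3 in
     vector [vector [-\<sigma>, 1, 1], vector [0, \<sigma>, 0], vector [0, 0, \<sigma>]])"

definition rho_S_B :: "nat \<times> nat \<times> nat \<Rightarrow> complex^3^3" where
  "rho_S_B = (\<lambda>(x1, x2, x3). let \<sigma> = lam x1 ^ 3 in
     vector [vector [\<sigma>, -2 * \<sigma>, 1], vector [0, -\<sigma>, 1], vector [0, 0, \<sigma>]])"

text \<open>As \<^const>\<open>S_mat\<close> and \<^const>\<open>T_mat\<close> generate \<^const>\<open>SL2Z\<close>, this determines \<open>\<rho>\<close> there.\<close>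

definition is_rho :: "nat \<times> nat \<times> nat \<Rightarrow> (int^2^2 \<Rightarrow> complex^3^3) \<Rightarrow> bool" where
  "is_rho x \<rho> \<longleftrightarrow> PSL2Z_rep \<rho> \<and> \<rho> T_mat = rho_T x \<and>
     (x \<in> type_A \<and> \<rho> S_mat = rho_S_A x \<or> x \<in> type_B \<and> \<rho> S_mat = rho_S_B x)"

definition incl12 :: "complex^2^3" where
  "incl12 = vector [vector [1, 0], vector [0, 1], vector [0, 0]]"

definition proj3 :: "complex^3^1" where
  "proj3 = vector [vector [0, 0, 1]]"

text \<open>The diagonal blocks of \<open>\<rho>\<close>: if the span of the first two basis vectors is invariant, these
  are the restriction to it and the quotient by it, in the evident bases.\<close>

definition sub12 :: "(int^2^2 \<Rightarrow> complex^3^3) \<Rightarrow> int^2^2 \<Rightarrow> complex^2^2" where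
  "sub12 \<rho> \<gamma> = vector [vector [\<rho> \<gamma> $ 1 $ 1, \<rho> \<gamma> $ 1 $ 2], vector [\<rho> \<gamma> $ 2 $ 1, \<rho> \<gamma> $ 2 $ 2]]"

definition quot3 :: "(int^2^2 \<Rightarrow> complex^3^3) \<Rightarrow> int^2^2 \<Rightarrow> complex^1^1" where
  "quot3 \<rho> \<gamma> = mat (\<rho> \<gamma> $ 3 $ 3)"


section \<open>Directness of the sum over all weights\<close>

lemma laurent_coeffs_zero:
  fixes c :: "int \<Rightarrow> complex"
  assumes K: "finite K" and inf: "infinite Z" and Z: "0 \<notin> Z"
    and eq: "\<And>z. z \<in> Z \<Longrightarrow> (\<Sum>k\<in>K. z powi k * c k) = 0"
    and k: "k \<in> K"
  shows "c k = 0"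
proof -
  define N where "N = Min K"
  have N: "N \<le> j" if "j \<in> K" for j
    using that K by (simp add: N_def)
  define p :: "complex poly" where "p = (\<Sum>j\<in>K. monom (c j) (nat (j - N)))"
  have "poly p z = 0" if z: "z \<in> Z" for z
  proof -
    have z0: "z \<noteq> 0" using z Z by auto
    have "poly p z = (\<Sum>j\<in>K. c j * z ^ nat (j - N))"
      by (simp add: p_def poly_sum poly_monom)
    also have "\<dots> = (\<Sum>j\<in>K. z powi (- N) * (z powi j * c j))"
    proof (rule sum.cong)
      fix j assume "j \<in> K"
      hence "z ^ nat (j - N) = z powi (- N + j)"
        using N[of j] by (simp add: power_int_def)
      also have "\<dots> = z powi (- N) * z powi j"
        using z0 by (subst power_int_add) simp_all
      finally show "c j * z ^ nat (j - N) = z powi (- N) * (z powi j * c j)" by simp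
    qed simp
    also have "\<dots> = 0"
      using eq[OF z] by (simp flip: sum_distrib_left)
    finally show ?thesis .
  qed
  hence "Z \<subseteq> {z. poly p z = 0}" by auto
  hence "p = 0"
    using inf poly_roots_finite finite_subset by blast
  hence "0 = coeff p (nat (k - N))" by simp
  also have "\<dots> = (\<Sum>j\<in>K. if j = k then c j else 0)"
    unfolding p_def coeff_sum using N k by (intro sum.cong) (auto simp: nat_eq_iff)
  also have "\<dots> = c k" using K k by simp
  finally show ?thesis by simp
qed

lemma modular_forms_sum_direct:
  fixes \<rho> :: "int^2^2 \<Rightarrow> complex^'n^'n"
  assumes rep: "SL2Z_rep \<rho>" and K: "finite K"
    and F: "\<And>k. k \<in> K \<Longrightarrow> F k \<in> modular_forms k \<rho>"
    and zero: "\<And>\<tau>. (\<Sum>k\<in>K. F k \<tau>) = 0"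
    and k: "k \<in> K"
  shows "F k = (\<lambda>\<tau>. 0)"
proof (rule ext)
  fix \<tau>
  show "F k \<tau> = 0"
  proof (cases "\<tau> \<in> upper_half_plane")
    case False
    thus ?thesis using F[OF k] by (auto simp: modular_forms_def)
  next
    case True
    hence im: "Im \<tau> > 0" by (simp add: upper_half_plane_def)
    define Z where "Z = range (\<lambda>n::int. \<tau> + of_int n)"
    have Z: "infinite Z"
      unfolding Z_def by (subst finite_image_iff) (auto simp: inj_on_def)
    have Z0: "0 \<notin> Z" using im by (auto simp: Z_def complex_eq_iff)
    have key: "(\<Sum>k\<in>K. (\<tau> + of_int n) powi k *s F k \<tau>) = 0" for n :: int
    proof -
      define g h :: "int^2^2" where "g = vector [vector [0, -1], vector [1, n]]"
        and "h = vector [vector [n, 1], vector [-1, 0]]"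
      have g: "g \<in> SL2Z" "h \<in> SL2Z" and hg: "h ** g = mat 1"
        by (simp_all add: SL2Z_def det_2 g_def h_def matrix_matrix_mult_def vec_eq_iff forall_2
              sum_2 mat_def)
      have inv: "\<rho> h ** \<rho> g = mat 1"
        using rep g hg unfolding SL2Z_rep_def by metis
      have "0 = (\<Sum>k\<in>K. F k (moebius g \<tau>))" using zero by simp
      also have "\<dots> = (\<Sum>k\<in>K. (\<tau> + of_int n) powi k *s (\<rho> g *v F k \<tau>))"
        using F True g(1) by (intro sum.cong) (auto simp: modular_forms_def g_def)
      also have "\<dots> = \<rho> g *v (\<Sum>k\<in>K. (\<tau> + of_int n) powi k *s F k \<tau>)"
        by (simp add: vec.sum vec.scale)
      finally have "\<rho> h *v (\<rho> g *v (\<Sum>k\<in>K. (\<tau> + of_int n) powi k *s F k \<tau>)) = 0"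
        by simp
      thus ?thesis by (simp add: matrix_vector_mul_assoc inv)
    qed
    have "F k \<tau> $ i = 0" for i
    proof (rule laurent_coeffs_zero[OF K Z Z0 _ k, where c = "\<lambda>k. F k \<tau> $ i"])
      fix z assume "z \<in> Z"
      then obtain n where "z = \<tau> + of_int n" by (auto simp: Z_def)
      thus "(\<Sum>k\<in>K. z powi k * F k \<tau> $ i) = 0"
        using arg_cong[OF key[of n], of "\<lambda>v. v $ i"] by simp
    qed
    thus ?thesis by (simp add: vec_eq_iff)
  qed
qed

end

theory Submission
  imports Defs "HOL-Real_Asymp.Real_Asymp"
begin

text \<open>Let \<open>\<eta>\<^sup>4\<close> be a sixth root of \<open>E4\<^sup>3 - E6\<^sup>2\<close>, so that \<open>M(\<chi>\<^bsup>2x\<^esup>) = \<eta>\<^bsup>4x\<^esup> R\<close> for \<open>0 \<le> x < 6\<close>.  The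
  primitives \<open>u \<sim> q\<^bsup>1/6\<^esup>\<close> of \<open>\<eta>\<^sup>4\<close> and \<open>v \<sim> q\<^bsup>-1/6\<^esup>\<close> of \<open>E4/\<eta>\<^sup>4\<close> can be scaled so that
  \<open>u(-1/\<tau>) = 1 - u(\<tau>)\<close> and \<open>v(-1/\<tau>) = 1 - v(\<tau>)\<close>.  Every extension in the list is made of \<open>u\<close> and \<open>v\<close>: a
  unipotent matrix \<open>U\<close> of polynomials in \<open>u\<close> and \<open>v\<close> turns vectors of scalar forms for the three diagonal
  characters into vectors transforming under \<open>\<rho>\<close>, and conversely.  What remains is the condition at the
  cusp.  Outside the three exceptions the columns of \<open>U\<close>, multiplied by \<open>\<eta>\<^bsup>4xj\<^esup>\<close>, satisfy it and form a
  basis.  In the exceptions \<open>v\<close> occurs multiplied by a form for the trivial character, and its pole has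
  to be cancelled by a form with a pole, \<open>E6/\<eta>\<^sup>4\<close> or \<open>E4\<^sup>2/\<eta>\<^sup>4\<close>.  This is possible for \<open>E4 v\<close> and
  \<open>E6 v\<close>, but not for \<open>v\<close>, since there are no forms of weight \<open>2\<close>.

  That \<open>E4\<^sup>3 - E6\<^sup>2\<close> has no zeros comes from the maximum principle alone, without the valence formula.\<close>

section \<open>The upper half plane and expansions in q\<close>

text \<open>The exponents \<open>x1\<close>, \<open>x2\<close>, \<open>x3\<close> are residues
  modulo 6, and the exceptions come from representing them in 0..5. Multiplication by u raises the
  residue by 1 and by v lowers it by 1, which suits every entry of U modulo 6. As an order at the
  cusp, in units of 1/6, an entry of U times the power of \<open>eta4\<close> for its column exceeds
  the exponent of its row by 0, 6 or -6. The values 0 and 6 are harmless. The value -6 occurs only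
  for (5,4,0), (5,0,1) and (4,5,0), always in an entry made of v or v^2, and then one term must be
  cancelled. In all three cases the weights 10 and 0 of the exponents 5 and 0 turn into 4 and 6. For
  (5,4,0) and (4,5,0) the trivial character is the quotient, so splitting would require a lift of
  the constant 1. For (5,0,1) it is the middle character and the quotient is generated by
  \<open>eta4\<close>. Its lift meets only the pole of v^2 \<open>eta4\<close>, which a multiple of
  \<open>E4\<close> / \<open>eta4\<close> cancels in weight 2.\<close>

abbreviation UH :: "complex set" where "UH \<equiv> upper_half_plane"

lemma UH_iff [simp]: "\<tau> \<in> UH \<longleftrightarrow> Im \<tau> > 0"
  by (simp add: upper_half_plane_def)

lemma open_UH: "open UH"
  unfolding upper_half_plane_def by (rule open_halfspace_Im_gt)

lemma convex_UH: "convex UH"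
  unfolding upper_half_plane_def by (rule convex_halfspace_Im_gt)

lemma Im_S: "Im (- 1 / \<tau>) = Im \<tau> / (norm \<tau>)\<^sup>2"
  by (simp add: Im_divide cmod_def)

lemma S_in_UH: "\<tau> \<in> UH \<Longrightarrow> - 1 / \<tau> \<in> UH"
  using sum_power2_gt_zero_iff[of "Re \<tau>" "Im \<tau>"] by (auto simp: Im_divide intro!: divide_pos_pos)

lemma periodic_int:
  assumes per: "\<And>\<tau>. \<tau> \<in> UH \<Longrightarrow> F (\<tau> + 1) = F \<tau>" and "\<tau> \<in> UH"
  shows "F (\<tau> + of_int n) = F \<tau>"
proof (induction n rule: int_induct[where k = 0])
  case (step1 i)
  thus ?case using per[of "\<tau> + of_int i"] assms(2) by (simp add: add_ac)
next
  case (step2 i)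
  have "F (\<tau> + of_int (i - 1) + 1) = F (\<tau> + of_int (i - 1))"
    by (rule per) (use assms(2) in auto)
  thus ?case using step2 by (simp add: algebra_simps)
qed simp

lemma Re_shift:
  obtains n :: int where "\<bar>Re (\<tau> + of_int n)\<bar> \<le> 1/2"
proof
  show "\<bar>Re (\<tau> + of_int (- round (Re \<tau>)))\<bar> \<le> 1/2"
    using of_int_round_abs_le[of "Re \<tau>"] by (simp add: abs_minus_commute)
qed

text \<open>The bound \<open>17/20\<close> is below the height \<open>\<surd>3/2\<close> of the lowest point of the usual fundamental
  domain, so that as long as it is not reached every inversion raises the imaginary part by a fixed
  factor.\<close>

lemma UH_reduction:
  assumes T: "\<And>\<tau>. \<tau> \<in> UH \<Longrightarrow> Q (\<tau> + 1) \<longleftrightarrow> Q \<tau>"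
    and S: "\<And>\<tau>. \<tau> \<in> UH \<Longrightarrow> Q (- 1 / \<tau>) \<longleftrightarrow> Q \<tau>"
    and base: "\<And>\<tau>. Im \<tau> \<ge> 17/20 \<Longrightarrow> Q \<tau>"
    and \<tau>: "\<tau> \<in> UH"
  shows "Q \<tau>"
proof -
  \<comment> \<open>In the strip |Re z| \<le> 1/2 below height 17/20 one has |z|^2 \<le> 1/4 +
    (17/20)^2 = 389/400, hence the factor 400/389.\<close>
  have main: "Q \<tau>" if "Im \<tau> > 0" "Im \<tau> * (400/389) ^ n \<ge> 17/20" for n \<tau>
    using that
  proof (induction n arbitrary: \<tau>)
    case 0
    thus ?case using base by simp
  next
    case (Suc n)
    obtain m where m: "\<bar>Re (\<tau> + of_int m)\<bar> \<le> 1/2" by (rule Re_shift)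
    define z where "z = \<tau> + of_int m"
    have z: "Im z = Im \<tau>" "\<bar>Re z\<bar> \<le> 1/2" "z \<in> UH" using m Suc.prems by (auto simp: z_def)
    have Qz: "Q z \<longleftrightarrow> Q \<tau>"
      unfolding z_def using periodic_int[of Q \<tau> m] T Suc.prems by auto
    show ?case
    proof (cases "Im \<tau> \<ge> 17/20")
      case True
      thus ?thesis by (rule base)
    next
      case False
      have "(Re z)\<^sup>2 \<le> (1/2)\<^sup>2" using z(2) by (metis abs_ge_zero power2_abs power_mono)
      moreover have "(Im z)\<^sup>2 \<le> (17/20)\<^sup>2" using z False Suc.prems by (intro power_mono) auto
      ultimately have le: "(norm z)\<^sup>2 \<le> 389/400"
        unfolding cmod_power2 by (simp add: power2_eq_square)
      have "z \<noteq> 0" using z by auto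
      hence pos: "(norm z)\<^sup>2 > 0" by simp
      have "Im (- 1 / z) \<ge> Im \<tau> * (400/389)"
        unfolding Im_S z(1) using le pos Suc.prems(1)
        by (simp add: field_simps)
      hence "Im (- 1 / z) * (400/389) ^ n \<ge> Im \<tau> * (400/389) * (400/389) ^ n"
        by (intro mult_right_mono) auto
      hence "17/20 \<le> Im (- 1 / z) * (400/389) ^ n"
        using Suc.prems(2) by simp
      moreover have "Im (-1 / z) > 0" using S_in_UH[OF z(3)] by simp
      ultimately have "Q (- 1 / z)" by (intro Suc.IH)
      thus ?thesis using S[OF z(3)] Qz by simp
    qed
  qed
  have im: "Im \<tau> > 0" using \<tau> by simp
  obtain n where "(17/20) / Im \<tau> < (400/389 :: real) ^ n"
    using real_arch_pow[of "400/389"] by auto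
  thus ?thesis using main[of \<tau> n] im by (simp add: field_simps)
qed

section \<open>The coordinate q and functions of period 1\<close>

definition qe :: "complex \<Rightarrow> complex" where
  "qe \<tau> = exp (2 * of_real pi * \<i> * \<tau>)"

lemma norm_qe: "norm (qe \<tau>) = exp (- 2 * pi * Im \<tau>)"
  by (simp add: qe_def)

lemma qe_nonzero [simp]: "qe \<tau> \<noteq> 0"
  by (simp add: qe_def)

lemma qe_add: "qe (a + b) = qe a * qe b"
  by (simp add: qe_def exp_add distrib_left)

lemma qe_of_int [simp]: "qe (of_int n) = 1"
  using exp_integer_2pi[of "of_int n"] by (simp add: qe_def mult_ac)

lemma qe_1 [simp]: "qe 1 = 1"
  using qe_of_int[of 1] by simp

lemma qe_0 [simp]: "qe 0 = 1"
  by (simp add: qe_def)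

lemma qe_uminus: "qe (- a) = inverse (qe a)"
  by (simp add: qe_def exp_minus)

lemma qe_in_ball: "\<tau> \<in> UH \<Longrightarrow> qe \<tau> \<in> ball 0 1"
  by (simp add: norm_qe)

lemma qe_eq_iff: "qe a = qe b \<longleftrightarrow> (\<exists>n::int. a = b + of_int n)"
proof -
  have "qe a = qe b \<longleftrightarrow> (\<exists>n::int. 2 * of_real pi * \<i> * a = 2 * of_real pi * \<i> * b + (of_int (2 * n) * pi) * \<i>)"
    unfolding qe_def exp_eq by simp
  also have "\<dots> \<longleftrightarrow> (\<exists>n::int. a = b + of_int n)"
  proof (intro ex_cong1 iffI)
    fix n assume "2 * of_real pi * \<i> * a = 2 * of_real pi * \<i> * b + (of_int (2 * n) * pi) * \<i>"
    hence "(2 * of_real pi * \<i>) * a = (2 * of_real pi * \<i>) * (b + of_int n)"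
      by (simp add: algebra_simps)
    thus "a = b + of_int n" by (subst (asm) mult_left_cancel) auto
  qed (simp add: algebra_simps)
  finally show ?thesis .
qed

definition q_log :: "complex \<Rightarrow> complex" where
  "q_log q = Ln q / (2 * of_real pi * \<i>)"

lemma qe_q_log: "q \<noteq> 0 \<Longrightarrow> qe (q_log q) = q"
  by (simp add: qe_def q_log_def)

lemma q_log_in_UH:
  assumes "q \<noteq> 0" "norm q < 1"
  shows "q_log q \<in> UH"
proof -
  have "norm (qe (q_log q)) < 1" using assms by (simp add: qe_q_log)
  thus ?thesis by (simp add: norm_qe zero_less_mult_iff)
qed

lemma qe_image: "q \<in> ball 0 1 - {0} \<Longrightarrow> \<exists>\<tau>\<in>UH. qe \<tau> = q"
  by (rule bexI[of _ "q_log q"]) (use q_log_in_UH qe_q_log in \<open>auto simp del: UH_iff\<close>)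

text \<open>Makes F a well-defined function of q, whichever logarithm of q is chosen.\<close>

lemma qe_eq_imp_eq:
  assumes per: "\<And>\<tau>. \<tau> \<in> UH \<Longrightarrow> F (\<tau> + 1) = F \<tau>" and "a \<in> UH" "b \<in> UH" "qe a = qe b"
  shows "F a = F b"
  using assms periodic_int[of F, OF per, of b] unfolding qe_eq_iff by auto

lemma has_field_derivative_qe [derivative_intros]:
  "(g has_field_derivative g') (at x within A) \<Longrightarrow>
   ((\<lambda>x. qe (g x)) has_field_derivative (2 * of_real pi * \<i> * g' * qe (g x))) (at x within A)"
  unfolding qe_def by (auto intro!: derivative_eq_intros)

lemma holomorphic_on_qe [holomorphic_intros]:
  "g holomorphic_on A \<Longrightarrow> (\<lambda>x. qe (g x)) holomorphic_on A"
  unfolding qe_def by (intro holomorphic_intros)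

text \<open>The logarithm in \<^const>\<open>q_log\<close> is discontinuous on the negative axis; near \<open>q0\<close> the branch
  \<open>q \<mapsto> q_log q0 + q_log (q / q0)\<close> is used instead.\<close>

lemma periodic_q_expansion:
  assumes hol: "F holomorphic_on UH"
    and per: "\<And>\<tau>. \<tau> \<in> UH \<Longrightarrow> F (\<tau> + 1) = F \<tau>"
    and lim: "\<And>\<epsilon>. \<epsilon> > 0 \<Longrightarrow> \<exists>Y. \<forall>\<tau>. Im \<tau> > Y \<longrightarrow> norm (F \<tau> - L) < \<epsilon>"
  obtains G where "G holomorphic_on ball 0 1" "G 0 = L" "\<And>\<tau>. \<tau> \<in> UH \<Longrightarrow> F \<tau> = G (qe \<tau>)"
proof
  define G where "G = (\<lambda>q. if q = 0 then L else F (q_log q))"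
  show G: "F \<tau> = G (qe \<tau>)" if "\<tau> \<in> UH" for \<tau>
  proof -
    have "F \<tau> = F (q_log (qe \<tau>))"
      by (rule qe_eq_imp_eq[of F, OF per])
         (use that qe_in_ball[OF that] q_log_in_UH[of "qe \<tau>"] qe_q_log in auto)
    thus ?thesis by (simp add: G_def)
  qed
  show "G 0 = L" by (simp add: G_def)
  show "G holomorphic_on ball 0 1"
  proof (rule no_isolated_singularity'[where K = "{0}"])
    fix z :: complex assume "z \<in> {0}"
    have "(G \<longlongrightarrow> L) (at 0 within ball 0 1)"
    proof (rule tendstoI)
      fix \<epsilon> :: real assume "\<epsilon> > 0"
      then obtain Y where Y: "\<And>\<tau>. Im \<tau> > Y \<Longrightarrow> norm (F \<tau> - L) < \<epsilon>" using lim by blast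
      have "norm (G q - L) < \<epsilon>" if "q \<noteq> 0" "norm q < exp (- 2 * pi * Y)" for q
      proof -
        have "norm (qe (q_log q)) < exp (- 2 * pi * Y)" using that by (simp add: qe_q_log)
        hence "Im (q_log q) > Y" by (simp add: norm_qe)
        thus ?thesis using Y that by (simp add: G_def)
      qed
      thus "\<forall>\<^sub>F q in at 0 within ball 0 1. dist (G q) L < \<epsilon>"
        unfolding eventually_at by (intro exI[of _ "exp (- 2 * pi * Y)"]) (auto simp: dist_norm)
    qed
    thus "(G \<longlongrightarrow> G z) (at z within ball 0 1)" using \<open>z \<in> {0}\<close> by (simp add: G_def)
  next
    have "\<exists>g'. (G has_field_derivative g') (at q0)" if q0: "q0 \<in> ball 0 1 - {0}" for q0
    proof -
      define b where "b = (\<lambda>q. q_log q0 + q_log (q / q0))"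
      have bq: "qe (b q) = q" if "q \<noteq> 0" for q
        using that q0 by (simp add: b_def qe_add qe_q_log)
      \<comment> \<open>If q / q0 were a nonpositive real, then |q - q0| \<ge> |q0|, so the first
        radius keeps the principal logarithm of q / q0 holomorphic. The second keeps q in the unit
        disc.\<close>
      define A where "A = ball q0 (min (norm q0) (1 - norm q0))"
      have openA: "open A" and q0A: "q0 \<in> A" using q0 by (auto simp: A_def)
      have A: "q \<noteq> 0 \<and> norm q < 1 \<and> q / q0 \<notin> \<real>\<^sub>\<le>\<^sub>0" if "q \<in> A" for q
      proof -
        have d: "norm (q - q0) < norm q0" "norm (q - q0) < 1 - norm q0"
          using that by (auto simp: A_def dist_norm norm_minus_commute)
        have "norm q \<le> norm (q - q0) + norm q0" by (metis diff_add_cancel norm_triangle_ineq)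
        moreover have "q \<noteq> 0" using d by auto
        moreover have "q / q0 \<notin> \<real>\<^sub>\<le>\<^sub>0"
        proof
          assume "q / q0 \<in> \<real>\<^sub>\<le>\<^sub>0"
          then obtain t where t: "q / q0 = of_real t" "t \<le> 0" by (auto elim!: nonpos_Reals_cases)
          hence "q - q0 = of_real (t - 1) * q0" using q0 by (simp add: field_simps)
          hence "norm (q - q0) = \<bar>t - 1\<bar> * norm q0" by (simp only: norm_mult norm_of_real)
          moreover have "\<bar>t - 1\<bar> * norm q0 \<ge> 1 * norm q0" using t by (intro mult_right_mono) auto
          ultimately show False using d by simp
        qed
        ultimately show ?thesis using d by simp
      qed
      have b_UH: "b q \<in> UH" if "q \<in> A" for q
      proof -
        have "norm (qe (b q)) < 1" using A[OF that] by (simp add: bq)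
        thus ?thesis by (simp add: norm_qe zero_less_mult_iff)
      qed
      have "b holomorphic_on A"
        unfolding b_def q_log_def using A q0 by (intro holomorphic_intros) auto
      hence "(F \<circ> b) holomorphic_on A"
        by (rule holomorphic_on_compose_gen[OF _ hol]) (use b_UH in auto)
      also have "?this \<longleftrightarrow> G holomorphic_on A"
      proof (rule holomorphic_cong)
        fix q assume q: "q \<in> A"
        have "F (b q) = F (q_log q)"
          by (rule qe_eq_imp_eq[of F, OF per])
             (use A[OF q] b_UH[OF q] q_log_in_UH[of q] qe_q_log bq in auto)
        thus "(F \<circ> b) q = G q" using A[OF q] by (simp add: G_def)
      qed simp
      finally show ?thesis using openA q0A holomorphic_on_open[of A G] by blast
    qed
    thus "G holomorphic_on ball 0 1 - {0}"
      by (meson field_differentiable_at_within field_differentiable_def holomorphic_on_def)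
  qed auto
qed

section \<open>Eisenstein series\<close>

lemma summable_inverse_square_int: "(\<lambda>n::int. 1 / (1 + \<bar>real_of_int n\<bar>)\<^sup>2) summable_on UNIV"
proof -
  have "summable (\<lambda>n. 1 / real (Suc n) ^ 2)"
    using inverse_power_summable[of 2, where 'a = real] by (subst summable_Suc_iff) (simp add: field_simps)
  hence *: "(\<lambda>n. 1 / real (Suc n) ^ 2) summable_on UNIV"
    by (subst summable_on_UNIV_nonneg_real_iff) auto
  have 1: "(\<lambda>n::int. 1 / (1 + \<bar>real_of_int n\<bar>)\<^sup>2) summable_on range int"
    using * by (subst summable_on_reindex) (auto simp: o_def add_ac inj_on_def)
  have 2: "(\<lambda>n::int. 1 / (1 + \<bar>real_of_int n\<bar>)\<^sup>2) summable_on range (\<lambda>n. - int n)"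
    using * by (subst summable_on_reindex) (auto simp: o_def add_ac inj_on_def)
  have "UNIV = range int \<union> range (\<lambda>n. - int n)"
    by (metis (mono_tags) UNIV_eq_I UnI1 UnI2 int_cases2 rangeI)
  thus ?thesis using summable_on_union[OF 1 2] by simp
qed

lemma summable_inverse_squares_int2:
  "(\<lambda>(c::int, d::int). 1 / ((1 + \<bar>real_of_int c\<bar>)\<^sup>2 * (1 + \<bar>real_of_int d\<bar>)\<^sup>2)) summable_on UNIV"
proof -
  let ?g = "\<lambda>n::int. 1 / (1 + \<bar>real_of_int n\<bar>)\<^sup>2"
  have "(\<lambda>(c, d). ?g c * ?g d) summable_on (SIGMA c:UNIV. UNIV)"
  proof (rule summable_on_SigmaI)
    fix c :: int
    show "((\<lambda>d. case (c, d) of (c, d) \<Rightarrow> ?g c * ?g d) has_sum (?g c * infsum ?g UNIV)) UNIV"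
      using has_sum_cmult_right[OF has_sum_infsum[OF summable_inverse_square_int], of "?g c"]
      by (simp only: prod.case)
  next
    show "(\<lambda>c. ?g c * infsum ?g UNIV) summable_on UNIV"
      using summable_inverse_square_int by (rule summable_on_cmult_left)
  qed auto
  thus ?thesis by (simp add: case_prod_unfold)
qed

definition coprime_pairs :: "(int \<times> int) set" where
  "coprime_pairs = {(c, d). coprime c d}"

text \<open>The imaginary part of c \<tau> + d is c Im \<tau>, which controls c; then the real part
  controls d.\<close>

lemma linear_form_bounds:
  fixes c d :: int
  assumes "0 < y0" "y0 \<le> Im \<tau>" "\<bar>Re \<tau>\<bar> \<le> X"
  shows "\<bar>real_of_int c\<bar> * Im \<tau> \<le> norm (of_int c * \<tau> + of_int d)"
    and "\<bar>real_of_int d\<bar> \<le> (1 + X / y0) * norm (of_int c * \<tau> + of_int d)"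
proof -
  let ?w = "of_int c * \<tau> + of_int d"
  show 1: "\<bar>real_of_int c\<bar> * Im \<tau> \<le> norm ?w"
    using abs_Im_le_cmod[of ?w] assms by (simp add: abs_mult)
  have "\<bar>real_of_int c\<bar> * y0 \<le> norm ?w"
    using 1 assms mult_left_mono[of y0 "Im \<tau>" "\<bar>real_of_int c\<bar>"] by simp
  hence c: "\<bar>real_of_int c\<bar> \<le> norm ?w / y0" using assms by (simp add: field_simps)
  have "\<bar>real_of_int d\<bar> \<le> \<bar>Re ?w\<bar> + \<bar>real_of_int c * Re \<tau>\<bar>" by simp
  also have "\<dots> \<le> norm ?w + norm ?w / y0 * X"
    using c assms abs_Re_le_cmod[of ?w] unfolding abs_mult
    by (intro add_mono mult_mono) auto
  finally show "\<bar>real_of_int d\<bar> \<le> (1 + X / y0) * norm ?w"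
    by (simp add: algebra_simps)
qed

text \<open>A majorant of product form reduces summability over pairs to inverse squares over the
  integers. It exists because the fourth power of max(|c|,|d|) dominates the product of the two
  squares up to the factor 16, and k \<ge> 4. The constant depends only on a strip containing
  \<tau>, as local uniformity requires.\<close>

lemma eisenstein_term_bound:
  fixes c d :: int
  assumes y0: "0 < y0" "y0 \<le> Im \<tau>" "\<bar>Re \<tau>\<bar> \<le> X" and cd: "(c, d) \<noteq> (0, 0)" and k: "k \<in> {4, 6}"
  defines "A \<equiv> 1 + 1 / y0 + X / y0"
  shows "norm (1 / (of_int c * \<tau> + of_int d) ^ k)
           \<le> 16 * A ^ k * (1 / ((1 + \<bar>real_of_int c\<bar>)\<^sup>2 * (1 + \<bar>real_of_int d\<bar>)\<^sup>2))"
proof -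
  define w where "w = of_int c * \<tau> + of_int d"
  define M where "M = max \<bar>real_of_int c\<bar> \<bar>real_of_int d\<bar>"
  have X: "X \<ge> 0" using y0 by linarith
  have A: "A \<ge> 1" using y0 X by (simp add: A_def)
  have "\<bar>real_of_int c\<bar> * y0 \<le> norm w"
    using linear_form_bounds(1)[OF y0] mult_left_mono[OF y0(2), of "\<bar>real_of_int c\<bar>"]
    unfolding w_def by (meson abs_ge_zero order.trans)
  hence "\<bar>real_of_int c\<bar> \<le> 1 / y0 * norm w" using y0 by (simp add: field_simps)
  also have "\<dots> \<le> A * norm w" using y0 X by (intro mult_right_mono) (auto simp: A_def)
  finally have 1: "\<bar>real_of_int c\<bar> \<le> A * norm w" .
  have "\<bar>real_of_int d\<bar> \<le> (1 + X / y0) * norm w"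
    using linear_form_bounds(2)[OF y0] unfolding w_def by blast
  also have "\<dots> \<le> A * norm w" using y0 X by (intro mult_right_mono) (auto simp: A_def)
  finally have M: "M \<le> A * norm w" using 1 by (simp add: M_def)
  have M1: "M \<ge> 1"
  proof -
    have "\<bar>c\<bar> \<ge> 1 \<or> \<bar>d\<bar> \<ge> 1" using cd by auto
    thus ?thesis unfolding M_def by linarith
  qed
  hence "0 < A * norm w" using M by linarith
  hence w: "norm w > 0" using A by (simp add: zero_less_mult_iff)
  have c: "1 + \<bar>real_of_int c\<bar> \<le> 2 * M" and d: "1 + \<bar>real_of_int d\<bar> \<le> 2 * M"
    using M1 unfolding M_def by linarith+
  have "(1 + \<bar>real_of_int c\<bar>)\<^sup>2 * (1 + \<bar>real_of_int d\<bar>)\<^sup>2 \<le> (2 * M)\<^sup>2 * (2 * M)\<^sup>2"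
    using c d by (intro mult_mono power_mono) auto
  also have "\<dots> = 16 * M ^ 4" by (simp add: power2_eq_square power4_eq_xxxx)
  also have "M ^ 4 \<le> M ^ k" using M1 k by (intro power_increasing) auto
  also have "M ^ k \<le> (A * norm w) ^ k" using M M1 by (intro power_mono) auto
  finally have "(1 + \<bar>real_of_int c\<bar>)\<^sup>2 * (1 + \<bar>real_of_int d\<bar>)\<^sup>2 \<le> 16 * A ^ k * norm w ^ k"
    by (simp add: power_mult_distrib)
  moreover have "0 < (1 + \<bar>real_of_int c\<bar>)\<^sup>2 * (1 + \<bar>real_of_int d\<bar>)\<^sup>2"
    by (intro mult_pos_pos zero_less_power) auto
  ultimately show ?thesis
    using w unfolding w_def[symmetric]
    by (simp add: norm_divide norm_power divide_simps del: UH_iff)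
qed

lemma eisenstein_alt:
  "eisenstein k \<tau> = (1/2) * (\<Sum>\<^sub>\<infinity>x\<in>coprime_pairs. 1 / (of_int (fst x) * \<tau> + of_int (snd x)) ^ k)"
  unfolding eisenstein_def coprime_pairs_def by (simp add: case_prod_unfold)

lemma coprime_pairs_nonzero: "x \<in> coprime_pairs \<Longrightarrow> (fst x, snd x) \<noteq> (0, 0)"
  by (auto simp: coprime_pairs_def)

lemma summable_eisenstein_majorant:
  "(\<lambda>x. C * (1 / ((1 + \<bar>real_of_int (fst x)\<bar>)\<^sup>2 * (1 + \<bar>real_of_int (snd x)\<bar>)\<^sup>2))) summable_on coprime_pairs"
  by (intro summable_on_cmult_right)
     (rule summable_on_subset_banach[of _ UNIV],
      use summable_inverse_squares_int2 in \<open>auto simp: case_prod_unfold\<close>)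

lemma eisenstein_summable:
  assumes "\<tau> \<in> UH" "k \<in> {4, 6}"
  shows "(\<lambda>x. 1 / (of_int (fst x) * \<tau> + of_int (snd x)) ^ k) summable_on coprime_pairs"
proof -
  have "(\<lambda>x. norm (1 / (of_int (fst x) * \<tau> + of_int (snd x)) ^ k)) summable_on coprime_pairs"
    by (rule Infinite_Sum.abs_summable_on_comparison_test'[OF summable_eisenstein_majorant])
       (rule eisenstein_term_bound[of "Im \<tau>" _ "\<bar>Re \<tau>\<bar>", OF _ _ _ coprime_pairs_nonzero], use assms in auto)
  thus ?thesis by (metis abs_summable_summable)
qed

lemma eisenstein_holomorphic:
  assumes k: "k \<in> {4, 6}"
  shows "eisenstein k holomorphic_on UH"
proof -
  let ?f = "\<lambda>x \<tau>. 1 / (of_int (fst x) * \<tau> + of_int (snd x)) ^ k"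
  let ?g = "\<lambda>\<tau>. \<Sum>\<^sub>\<infinity>x\<in>coprime_pairs. ?f x \<tau>"
  have nz: "of_int (fst x) * \<tau> + of_int (snd x) \<noteq> 0" if "x \<in> coprime_pairs" "\<tau> \<in> UH" for x \<tau>
  proof
    assume 0: "of_int (fst x) * \<tau> + of_int (snd x) = 0"
    hence "Im (of_int (fst x) * \<tau> + of_int (snd x)) = 0" by simp
    hence "fst x = 0" using that by auto
    moreover from this 0 have "snd x = 0" by simp
    ultimately show False using coprime_pairs_nonzero[OF that(1)] by simp
  qed
  have "\<exists>g'. (?g has_field_derivative g') (at \<tau>)" if \<tau>: "\<tau> \<in> UH" for \<tau>
  proof -
    define r where "r = Im \<tau> / 2"
    have r: "r > 0" using \<tau> by (simp add: r_def)
    have near: "r \<le> Im z \<and> \<bar>Re z\<bar> \<le> \<bar>Re \<tau>\<bar> + r" if "z \<in> cball \<tau> r" for z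
      using that abs_Im_le_cmod[of "\<tau> - z"] abs_Re_le_cmod[of "\<tau> - z"]
      by (auto simp: dist_norm r_def)
    have sub: "cball \<tau> r \<subseteq> UH" using near r by force
    have u: "uniform_limit (cball \<tau> r) (\<lambda>X y. \<Sum>x\<in>X. ?f x y) ?g (finite_subsets_at_top coprime_pairs)"
    proof (rule Weierstrass_m_test_general[OF _ summable_eisenstein_majorant])
      fix x y assume "x \<in> coprime_pairs" "y \<in> cball \<tau> r"
      thus "norm (?f x y) \<le> 16 * (1 + 1 / r + (\<bar>Re \<tau>\<bar> + r) / r) ^ k *
              (1 / ((1 + \<bar>real_of_int (fst x)\<bar>)\<^sup>2 * (1 + \<bar>real_of_int (snd x)\<bar>)\<^sup>2))"
        using near[of y] r k coprime_pairs_nonzero[of x] by (intro eisenstein_term_bound) auto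
    qed
    have "\<forall>\<^sub>F X in finite_subsets_at_top coprime_pairs.
            continuous_on (cball \<tau> r) (\<lambda>y. \<Sum>x\<in>X. ?f x y) \<and> (\<lambda>y. \<Sum>x\<in>X. ?f x y) holomorphic_on ball \<tau> r"
    proof (rule eventually_finite_subsets_at_top_weakI, rule conjI)
      fix X :: "(int \<times> int) set" assume X: "finite X" "X \<subseteq> coprime_pairs"
      have h: "(\<lambda>y. \<Sum>x\<in>X. ?f x y) holomorphic_on cball \<tau> r"
      proof (intro holomorphic_intros)
        fix x z assume "x \<in> X" "z \<in> cball \<tau> r"
        thus "(of_int (fst x) * z + of_int (snd x)) ^ k \<noteq> 0" using nz[of x z] X(2) sub by (metis power_not_zero subsetD)
      qed
      thus "continuous_on (cball \<tau> r) (\<lambda>y. \<Sum>x\<in>X. ?f x y)" by (rule holomorphic_on_imp_continuous_on)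
      show "(\<lambda>y. \<Sum>x\<in>X. ?f x y) holomorphic_on ball \<tau> r"
        using h by (rule holomorphic_on_subset) auto
    qed
    then obtain "?g holomorphic_on ball \<tau> r"
      using holomorphic_uniform_limit[OF _ u] by auto
    thus ?thesis using r holomorphic_on_open[of "ball \<tau> r" ?g] by auto
  qed
  hence "?g holomorphic_on UH" using open_UH by (subst holomorphic_on_open) auto
  hence "(\<lambda>\<tau>. (1/2) * ?g \<tau>) holomorphic_on UH" by (intro holomorphic_intros)
  thus ?thesis by (simp only: eisenstein_alt[abs_def])
qed

lemma eisenstein_T: "eisenstein k (\<tau> + 1) = eisenstein k \<tau>"
proof -
  have 1: "coprime c (c + d) \<longleftrightarrow> coprime c d" for c d :: int
    by (simp only: coprime_iff_gcd_eq_1 gcd_add2)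
  have 2: "coprime c (d - c) \<longleftrightarrow> coprime c d" for c d :: int
    using 1[of c "d - c"] by simp
  have "(\<Sum>\<^sub>\<infinity>x\<in>coprime_pairs. 1 / (of_int (fst x) * (\<tau> + 1) + of_int (snd x)) ^ k) =
        (\<Sum>\<^sub>\<infinity>x\<in>coprime_pairs. 1 / (of_int (fst x) * \<tau> + of_int (snd x)) ^ k)"
    by (rule infsum_reindex_bij_witness[of _ "\<lambda>(c, d). (c, d - c)" "\<lambda>(c, d). (c, c + d)"])
       (auto simp: coprime_pairs_def 1 2 distrib_left add_ac)
  thus ?thesis by (simp add: eisenstein_alt)
qed

lemma eisenstein_S:
  assumes \<tau>: "\<tau> \<in> UH" and k: "even k"
  shows "eisenstein k (- 1 / \<tau>) = \<tau> ^ k * eisenstein k \<tau>"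
proof -
  have 0: "\<tau> \<noteq> 0" using \<tau> by auto
  have "(\<Sum>\<^sub>\<infinity>x\<in>coprime_pairs. 1 / (of_int (fst x) * (- 1 / \<tau>) + of_int (snd x)) ^ k) =
        (\<Sum>\<^sub>\<infinity>x\<in>coprime_pairs. \<tau> ^ k * (1 / (of_int (fst x) * \<tau> + of_int (snd x)) ^ k))"
  proof (rule infsum_reindex_bij_witness[of _ "\<lambda>(c, d). (- d, c)" "\<lambda>(c, d). (d, - c)"])
    fix x :: "int \<times> int" assume "x \<in> coprime_pairs"
    obtain c d where x: "x = (c, d)" by force
    have "of_int c * (- 1 / \<tau>) + of_int d = (of_int d * \<tau> + of_int (- c)) / \<tau>"
      using 0 by (simp add: field_simps)
    thus "\<tau> ^ k * (1 / (of_int (fst (case x of (c, d) \<Rightarrow> (d, - c))) * \<tau> +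
             of_int (snd (case x of (c, d) \<Rightarrow> (d, - c)))) ^ k) =
          1 / (of_int (fst x) * (- 1 / \<tau>) + of_int (snd x)) ^ k"
      by (simp add: x power_divide)
  qed (auto simp: coprime_pairs_def coprime_commute)
  also have "\<dots> = \<tau> ^ k * (\<Sum>\<^sub>\<infinity>x\<in>coprime_pairs. 1 / (of_int (fst x) * \<tau> + of_int (snd x)) ^ k)"
    using 0 by (subst infsum_cmult_right') auto
  finally show ?thesis by (simp add: eisenstein_alt)
qed

text \<open>The two pairs with c = 0 give the constant term 1. In the other terms |c \<tau> + d|
  \<ge> |c| Im \<tau>, so two of the at least four factors can be spent on 1/(Im \<tau>)^2 while the
  remaining ones still leave a summable majorant. The estimate is made in the strip |Re \<tau>|
  \<le> 1/2 and spread by periodicity.\<close>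

lemma eisenstein_limit_bound:
  assumes k: "k \<in> {4, 6}"
  obtains C where "C \<ge> 0" "\<And>\<tau>. Im \<tau> \<ge> 1 \<Longrightarrow> norm (eisenstein k \<tau> - 1) \<le> C / (Im \<tau>)\<^sup>2"
proof -
  let ?f = "\<lambda>\<tau> x. 1 / (of_int (fst x) * \<tau> + of_int (snd x)) ^ k :: complex"
  define m where "m = (\<lambda>x. 36 * (1 / ((1 + \<bar>real_of_int (fst x)\<bar>)\<^sup>2 * (1 + \<bar>real_of_int (snd x)\<bar>)\<^sup>2)))"
  define C where "C = infsum m coprime_pairs"
  have sm: "m summable_on coprime_pairs" unfolding m_def by (rule summable_eisenstein_majorant)
  have C0: "C \<ge> 0" unfolding C_def m_def by (intro infsum_nonneg) auto
  define P0 where "P0 = {(0::int, 1::int), (0, -1)}"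
  have P0: "finite P0" "P0 \<subseteq> coprime_pairs" by (auto simp: P0_def coprime_pairs_def)
  have c0: "fst x \<noteq> 0" if "x \<in> coprime_pairs - P0" for x
    using that by (auto simp: P0_def coprime_pairs_def)
  have main: "norm (eisenstein k \<tau> - 1) \<le> C / (Im \<tau>)\<^sup>2" if \<tau>: "Im \<tau> \<ge> 1" "\<bar>Re \<tau>\<bar> \<le> 1/2" for \<tau>
  proof -
    have UH: "\<tau> \<in> UH" using \<tau> by simp
    have "(\<Sum>\<^sub>\<infinity>x\<in>coprime_pairs. ?f \<tau> x) = (\<Sum>\<^sub>\<infinity>x\<in>coprime_pairs - P0. ?f \<tau> x) + (\<Sum>\<^sub>\<infinity>x\<in>P0. ?f \<tau> x)"
      using infsum_Un_disjoint[of "?f \<tau>" "coprime_pairs - P0" P0] P0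
            summable_on_subset_banach[OF eisenstein_summable[OF UH k]]
      by (simp add: Un_absorb2 Int_commute del: infsum_finite)
    also have "(\<Sum>\<^sub>\<infinity>x\<in>P0. ?f \<tau> x) = 2" using k by (auto simp: P0_def)
    finally have "eisenstein k \<tau> - 1 = (1/2) * (\<Sum>\<^sub>\<infinity>x\<in>coprime_pairs - P0. ?f \<tau> x)"
      by (simp add: eisenstein_alt algebra_simps)
    also have "norm \<dots> \<le> norm (\<Sum>\<^sub>\<infinity>x\<in>coprime_pairs - P0. ?f \<tau> x)"
      by (simp add: norm_mult)
    also have "\<dots> \<le> (\<Sum>\<^sub>\<infinity>x\<in>coprime_pairs - P0. m x / (Im \<tau>)\<^sup>2)"
    proof (rule norm_infsum_le)
      show "(?f \<tau> has_sum (\<Sum>\<^sub>\<infinity>x\<in>coprime_pairs - P0. ?f \<tau> x)) (coprime_pairs - P0)"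
        using summable_on_subset_banach[OF eisenstein_summable[OF UH k]] by (intro has_sum_infsum) auto
      show "((\<lambda>x. m x / (Im \<tau>)\<^sup>2) has_sum (\<Sum>\<^sub>\<infinity>x\<in>coprime_pairs - P0. m x / (Im \<tau>)\<^sup>2)) (coprime_pairs - P0)"
        using summable_on_subset_banach[OF sm] unfolding divide_inverse by (intro has_sum_infsum summable_on_cmult_left) auto
      fix x assume x: "x \<in> coprime_pairs - P0"
      define c d where "c = \<bar>real_of_int (fst x)\<bar>" and "d = \<bar>real_of_int (snd x)\<bar>"
      define w where "w = of_int (fst x) * \<tau> + of_int (snd x)"
      have c: "c \<ge> 1" using c0[OF x] by (simp add: c_def)
      have 1: "c * Im \<tau> \<le> norm w" and 2: "d \<le> 3/2 * norm w"
        using linear_form_bounds[of 1 \<tau> "1/2", where c = "fst x" and d = "snd x"] \<tau> by (auto simp: w_def c_def d_def)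
      have cI: "c * Im \<tau> \<ge> 1" using c \<tau>(1) mult_mono[of 1 c 1 "Im \<tau>"] by simp
      hence w1: "norm w \<ge> 1" using 1 by linarith
      \<comment> \<open>Here 1 + c \<le> 2c gives the factor 2, and 1 + d \<le> |w| + 3/2 |w| gives
        at most 3. Their squares multiply to the 36 in \<open>m\<close>.\<close>
      have "((1 + c) * Im \<tau>)\<^sup>2 * (1 + d)\<^sup>2 \<le> (2 * norm w)\<^sup>2 * (3 * norm w)\<^sup>2"
      proof (rule mult_mono; (rule power_mono)?)
        have "(1 + c) * Im \<tau> \<le> (c + c) * Im \<tau>" using c \<tau> by (intro mult_right_mono) auto
        thus "(1 + c) * Im \<tau> \<le> 2 * norm w" using 1 by (simp add: algebra_simps)
        show "1 + d \<le> 3 * norm w" using 2 w1 by linarith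
      qed (use c \<tau> in \<open>auto simp: d_def\<close>)
      also have "\<dots> = 36 * norm w ^ 4" by (simp add: power2_eq_square power4_eq_xxxx)
      also have "\<dots> \<le> 36 * norm w ^ k" using k w1 by (intro mult_left_mono power_increasing) auto
      finally have le: "(1 + c)\<^sup>2 * (1 + d)\<^sup>2 * (Im \<tau>)\<^sup>2 \<le> 36 * norm w ^ k"
        by (simp add: power_mult_distrib mult_ac)
      have "0 < (1 + c)\<^sup>2 * (1 + d)\<^sup>2 * (Im \<tau>)\<^sup>2"
        using c \<tau> by (intro mult_pos_pos zero_less_power) (auto simp: d_def)
      moreover have "norm w ^ k > 0" using w1 by (intro zero_less_power) auto
      ultimately show "norm (?f \<tau> x) \<le> m x / (Im \<tau>)\<^sup>2"
        using le unfolding m_def w_def[symmetric] c_def[symmetric] d_def[symmetric]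
        by (simp add: norm_divide norm_power divide_simps mult_ac)
    qed
    also have "\<dots> = (\<Sum>\<^sub>\<infinity>x\<in>coprime_pairs - P0. m x) / (Im \<tau>)\<^sup>2"
      by (simp add: divide_inverse infsum_cmult_left')
    also have "\<dots> \<le> C / (Im \<tau>)\<^sup>2"
    proof (rule divide_right_mono)
      show "(\<Sum>\<^sub>\<infinity>x\<in>coprime_pairs - P0. m x) \<le> C"
        unfolding C_def using sm summable_on_subset_banach[OF sm]
        by (intro infsum_mono_neutral) (auto simp: m_def)
    qed auto
    finally show ?thesis .
  qed
  have "norm (eisenstein k \<tau> - 1) \<le> C / (Im \<tau>)\<^sup>2" if \<tau>: "Im \<tau> \<ge> 1" for \<tau>
  proof -
    obtain n where n: "\<bar>Re (\<tau> + of_int n)\<bar> \<le> 1/2" by (rule Re_shift)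
    have "eisenstein k (\<tau> + of_int n) = eisenstein k \<tau>"
      using \<tau> by (intro periodic_int eisenstein_T) auto
    thus ?thesis using main[of "\<tau> + of_int n"] n \<tau> by simp
  qed
  thus ?thesis using C0 that by blast
qed

lemma eisenstein_q_expansion:
  assumes k: "k \<in> {4, 6}"
  obtains G where "G holomorphic_on ball 0 1" "G 0 = 1" "\<And>\<tau>. \<tau> \<in> UH \<Longrightarrow> eisenstein k \<tau> = G (qe \<tau>)"
proof -
  obtain C where C: "C \<ge> 0" "\<And>\<tau>. Im \<tau> \<ge> 1 \<Longrightarrow> norm (eisenstein k \<tau> - 1) \<le> C / (Im \<tau>)\<^sup>2"
    using eisenstein_limit_bound[OF k] by blast
  have "\<exists>Y. \<forall>\<tau>. Im \<tau> > Y \<longrightarrow> norm (eisenstein k \<tau> - 1) < \<epsilon>" if "\<epsilon> > 0" for \<epsilon>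
  proof (intro exI allI impI)
    fix \<tau> :: complex assume \<tau>: "Im \<tau> > 1 + C / \<epsilon>"
    moreover have "C / \<epsilon> \<ge> 0" using C(1) that by simp
    ultimately have 1: "Im \<tau> > 1" by linarith
    have "C / \<epsilon> < Im \<tau>" using \<tau> by linarith
    also have "\<dots> \<le> (Im \<tau>)\<^sup>2" using 1 by (simp add: power2_eq_square)
    finally have "C / (Im \<tau>)\<^sup>2 < \<epsilon>" using that 1 by (simp add: field_simps)
    thus "norm (eisenstein k \<tau> - 1) < \<epsilon>" using C(2)[of \<tau>] 1 by linarith
  qed
  hence lim: "\<And>\<epsilon>. \<epsilon> > 0 \<Longrightarrow> \<exists>Y. \<forall>\<tau>. Im \<tau> > Y \<longrightarrow> norm (eisenstein k \<tau> - 1) < \<epsilon>" by blast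
  show ?thesis
    by (rule periodic_q_expansion[OF eisenstein_holomorphic[OF k] eisenstein_T lim])
       (auto intro: that)
qed

section \<open>Scalar forms for the characters of the modular group\<close>

text \<open>A scalar form of weight \<open>k\<close> for the character \<open>\<chi>\<^sup>2\<^sup>x\<close>, whose values at \<open>S\<close> and \<open>T\<close>
  are \<open>(-1)\<^sup>x\<close> and \<open>qe (x/6)\<close>.  The cusp condition is measured against \<open>q\<^bsup>x/6\<^esup>\<close> with an arbitrary
  integer \<open>x\<close>, so \<open>x < 0\<close> describes forms with a pole at the cusp.\<close>

definition q_exp :: "int \<Rightarrow> complex \<Rightarrow> (complex \<Rightarrow> complex) \<Rightarrow> bool" where
  "q_exp x c f \<longleftrightarrow> (\<exists>G. G holomorphic_on ball 0 1 \<and> G 0 = c \<and>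
      (\<forall>\<tau>\<in>UH. f \<tau> = qe (of_int x * \<tau> / 6) * G (qe \<tau>)))"

text \<open>Kept apart from the cusp condition: a component of a vector may satisfy it while only a
  combination of components, such as \<open>pol4\<close> + \<open>eich 1\<close> \<open>E4\<close>,
  has the right order at the cusp.\<close>

definition S_law :: "int \<Rightarrow> int \<Rightarrow> (complex \<Rightarrow> complex) \<Rightarrow> bool" where
  "S_law k x f \<longleftrightarrow> (\<forall>\<tau>\<in>UH. f (- 1 / \<tau>) = (-1) powi x * \<tau> powi k * f \<tau>)"

definition scalar_form :: "int \<Rightarrow> int \<Rightarrow> (complex \<Rightarrow> complex) \<Rightarrow> bool" where
  "scalar_form k x f \<longleftrightarrow> S_law k x f \<and> (\<exists>c. q_exp x c f)"

lemma UH_nonzero: "\<tau> \<in> UH \<Longrightarrow> \<tau> \<noteq> 0"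
  by auto

lemma q_exp_holomorphic:
  assumes "q_exp x c f"
  shows "f holomorphic_on UH"
proof -
  obtain G where G: "G holomorphic_on ball 0 1" "\<And>\<tau>. \<tau> \<in> UH \<Longrightarrow> f \<tau> = qe (of_int x * \<tau> / 6) * G (qe \<tau>)"
    using assms by (auto simp: q_exp_def)
  have "(G \<circ> qe) holomorphic_on UH"
    by (rule holomorphic_on_compose_gen[OF _ G(1)]) (auto intro!: holomorphic_intros simp: norm_qe)
  hence "(\<lambda>\<tau>. qe (of_int x * \<tau> / 6) * G (qe \<tau>)) holomorphic_on UH"
    by (intro holomorphic_intros) (auto simp: o_def)
  thus ?thesis by (rule holomorphic_transform) (simp add: G(2))
qed

lemma q_exp_cong: "(\<And>\<tau>. \<tau> \<in> UH \<Longrightarrow> f \<tau> = g \<tau>) \<Longrightarrow> q_exp x c f \<longleftrightarrow> q_exp x c g"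
  unfolding q_exp_def by (intro ex_cong1) auto

lemma q_exp_mult:
  assumes "q_exp x c f" "q_exp y d g"
  shows "q_exp (x + y) (c * d) (\<lambda>\<tau>. f \<tau> * g \<tau>)"
proof -
  obtain F where F: "F holomorphic_on ball 0 1" "F 0 = c" "\<And>\<tau>. \<tau> \<in> UH \<Longrightarrow> f \<tau> = qe (of_int x * \<tau> / 6) * F (qe \<tau>)"
    using assms(1) by (auto simp: q_exp_def)
  obtain G where G: "G holomorphic_on ball 0 1" "G 0 = d" "\<And>\<tau>. \<tau> \<in> UH \<Longrightarrow> g \<tau> = qe (of_int y * \<tau> / 6) * G (qe \<tau>)"
    using assms(2) by (auto simp: q_exp_def)
  have "(\<lambda>z. F z * G z) holomorphic_on ball 0 1" using F G by (intro holomorphic_intros)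
  moreover have "f \<tau> * g \<tau> = qe (of_int (x + y) * \<tau> / 6) * (F (qe \<tau>) * G (qe \<tau>))" if "\<tau> \<in> UH" for \<tau>
    using F(3)[OF that] G(3)[OF that] by (simp add: qe_add distrib_right add_divide_distrib)
  ultimately show ?thesis using F(2) G(2) unfolding q_exp_def by blast
qed

lemma q_exp_add:
  assumes "q_exp x c f" "q_exp x d g"
  shows "q_exp x (c + d) (\<lambda>\<tau>. f \<tau> + g \<tau>)"
proof -
  obtain F where F: "F holomorphic_on ball 0 1" "F 0 = c" "\<And>\<tau>. \<tau> \<in> UH \<Longrightarrow> f \<tau> = qe (of_int x * \<tau> / 6) * F (qe \<tau>)"
    using assms(1) by (auto simp: q_exp_def)
  obtain G where G: "G holomorphic_on ball 0 1" "G 0 = d" "\<And>\<tau>. \<tau> \<in> UH \<Longrightarrow> g \<tau> = qe (of_int x * \<tau> / 6) * G (qe \<tau>)"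
    using assms(2) by (auto simp: q_exp_def)
  have "(\<lambda>z. F z + G z) holomorphic_on ball 0 1" using F G by (intro holomorphic_intros)
  moreover have "f \<tau> + g \<tau> = qe (of_int x * \<tau> / 6) * (F (qe \<tau>) + G (qe \<tau>))" if "\<tau> \<in> UH" for \<tau>
    using F(3)[OF that] G(3)[OF that] by (simp add: distrib_left)
  ultimately show ?thesis using F(2) G(2) unfolding q_exp_def
    by (intro exI[of _ "\<lambda>z. F z + G z"]) auto
qed

lemma q_exp_const: "q_exp 0 c (\<lambda>\<tau>. c)"
  unfolding q_exp_def by (intro exI[of _ "\<lambda>z. c"]) auto

lemma q_exp_zero: "q_exp x 0 (\<lambda>\<tau>. 0)"
  unfolding q_exp_def by (intro exI[of _ "\<lambda>z. 0"]) auto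

lemma q_exp_cmult: "q_exp x c f \<Longrightarrow> q_exp x (a * c) (\<lambda>\<tau>. a * f \<tau>)"
  using q_exp_mult[OF q_exp_const] by simp

lemma q_exp_diff: "q_exp x c f \<Longrightarrow> q_exp x d g \<Longrightarrow> q_exp x (c - d) (\<lambda>\<tau>. f \<tau> - g \<tau>)"
  using q_exp_add[of x c f "- d" "\<lambda>\<tau>. - g \<tau>"] q_exp_cmult[of x d g "-1"] by simp

lemma q_exp_power: "q_exp x c f \<Longrightarrow> q_exp (int n * x) (c ^ n) (\<lambda>\<tau>. f \<tau> ^ n)"
proof (induction n)
  case 0
  thus ?case using q_exp_const[of 1] by simp
next
  case (Suc n)
  thus ?case using q_exp_mult[of x c f "int n * x" "c ^ n" "\<lambda>\<tau>. f \<tau> ^ n"] by (simp add: algebra_simps)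
qed

lemma holomorphic_factor_zero:
  fixes G :: "complex \<Rightarrow> complex"
  assumes "G holomorphic_on S" "open S"  "a \<in> S" "G a = 0"
  obtains K where "K holomorphic_on S" "\<And>z. z \<in> S \<Longrightarrow> G z = (z - a) * K z"
  by (rule that[OF pole_lemma_open[OF assms(1,2), of a]]) (use assms in auto)

text \<open>If the leading coefficient is cancelled, a whole factor q can be taken out, which is six
  units of 1/6. Every cancellation of a pole below ends here.\<close>

lemma q_exp_raise:
  assumes "q_exp x 0 f"
  shows "\<exists>c. q_exp (x + 6) c f"
proof -
  obtain G where G: "G holomorphic_on ball 0 1" "G 0 = 0" "\<And>\<tau>. \<tau> \<in> UH \<Longrightarrow> f \<tau> = qe (of_int x * \<tau> / 6) * G (qe \<tau>)"
    using assms by (auto simp: q_exp_def)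
  obtain K where K: "K holomorphic_on ball 0 1" "\<And>z. z \<in> ball 0 1 \<Longrightarrow> G z = (z - 0) * K z"
    using holomorphic_factor_zero[OF G(1) _ _ G(2)] by auto
  have "f \<tau> = qe (of_int (x + 6) * \<tau> / 6) * K (qe \<tau>)" if "\<tau> \<in> UH" for \<tau>
  proof -
    have "of_int (x + 6) * \<tau> / 6 = of_int x * \<tau> / 6 + \<tau>"
      by (simp add: distrib_right add_divide_distrib)
    thus ?thesis using G(3)[OF that] K(2)[OF qe_in_ball[OF that]] by (simp only: qe_add) simp
  qed
  thus ?thesis using K(1) unfolding q_exp_def by blast
qed

lemma q_exp_drop:
  assumes "q_exp (x + 6) c f"
  shows "q_exp x 0 f"
proof -
  \<comment> \<open>The function is written as f q^(-1) q. The factor q^(-1) lowers the order by 6,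
    and q is read as an expansion of order 0 with leading coefficient 0.\<close>
  have "q_exp 6 1 (\<lambda>\<tau>. qe \<tau>)" "q_exp (- 6) 1 (\<lambda>\<tau>. qe (- \<tau>))" "q_exp 0 0 (\<lambda>\<tau>. qe \<tau>)"
    unfolding q_exp_def
    by (rule exI[of _ "\<lambda>z. 1"], simp, rule exI[of _ "\<lambda>z. 1"], simp, rule exI[of _ "\<lambda>z. z"], simp)
  hence "q_exp (x + 6 + (- 6) + 0) (c * 1 * 0) (\<lambda>\<tau>. f \<tau> * qe (- \<tau>) * qe \<tau>)"
    using assms by (intro q_exp_mult) auto
  thus ?thesis by (simp add: qe_uminus mult.assoc)
qed

lemma q_exp_T:
  assumes "q_exp x c f" "\<tau> \<in> UH"
  shows "f (\<tau> + 1) = qe (of_int x / 6) * f \<tau>"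
proof -
  obtain G where G: "\<And>\<tau>. \<tau> \<in> UH \<Longrightarrow> f \<tau> = qe (of_int x * \<tau> / 6) * G (qe \<tau>)"
    using assms by (auto simp: q_exp_def)
  show ?thesis using G[of \<tau>] G[of "\<tau> + 1"] assms(2)
    by (simp add: qe_add distrib_left add_divide_distrib)
qed

lemma S_law_cong: "(\<And>\<tau>. \<tau> \<in> UH \<Longrightarrow> f \<tau> = g \<tau>) \<Longrightarrow> S_law k x f \<longleftrightarrow> S_law k x g"
  unfolding S_law_def using S_in_UH by (metis (no_types, lifting))

lemma S_law_mult: "S_law k x f \<Longrightarrow> S_law l y g \<Longrightarrow> S_law (k + l) (x + y) (\<lambda>\<tau>. f \<tau> * g \<tau>)"
  unfolding S_law_def using UH_nonzero by (auto simp: power_int_add)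

lemma S_law_add: "S_law k x f \<Longrightarrow> S_law k x g \<Longrightarrow> S_law k x (\<lambda>\<tau>. f \<tau> + g \<tau>)"
  unfolding S_law_def by (auto simp: distrib_left)

lemma S_law_diff: "S_law k x f \<Longrightarrow> S_law k x g \<Longrightarrow> S_law k x (\<lambda>\<tau>. f \<tau> - g \<tau>)"
  unfolding S_law_def by (auto simp: right_diff_distrib)

lemma S_law_const: "S_law 0 0 (\<lambda>\<tau>. c)"
  unfolding S_law_def by auto

lemma S_law_zero: "S_law k x (\<lambda>\<tau>. 0)"
  unfolding S_law_def by auto

lemma S_law_cmult: "S_law k x f \<Longrightarrow> S_law k x (\<lambda>\<tau>. a * f \<tau>)"
  unfolding S_law_def by auto

lemma S_law_power: "S_law k x f \<Longrightarrow> S_law (int n * k) (int n * x) (\<lambda>\<tau>. f \<tau> ^ n)"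
proof (induction n)
  case 0
  thus ?case using S_law_const[of 1] by simp
next
  case (Suc n)
  thus ?case using S_law_mult[of k x f "int n * k" "int n * x" "\<lambda>\<tau>. f \<tau> ^ n"] by (simp add: algebra_simps)
qed

lemma S_law_parity: "S_law k x f \<Longrightarrow> even (x - y) \<Longrightarrow> S_law k y f"
  unfolding S_law_def
proof (intro ballI)
  fix \<tau> assume 1: "even (x - y)" "\<tau> \<in> UH" "\<forall>\<tau>\<in>UH. f (- 1 / \<tau>) = (- 1) powi x * \<tau> powi k * f \<tau>"
  have "even x \<longleftrightarrow> even y" using 1(1) by auto
  hence "(- 1 :: complex) powi x = (- 1) powi y" by (auto simp: power_int_minus_left)
  thus "f (- 1 / \<tau>) = (- 1) powi y * \<tau> powi k * f \<tau>" using 1 by simp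
qed

lemma scalar_form_cong:
  assumes "\<And>\<tau>. \<tau> \<in> UH \<Longrightarrow> f \<tau> = g \<tau>"
  shows "scalar_form k x f \<longleftrightarrow> scalar_form k x g"
  unfolding scalar_form_def using S_law_cong[OF assms] q_exp_cong[OF assms] by simp

lemma scalar_form_mult:
  "scalar_form k x f \<Longrightarrow> scalar_form l y g \<Longrightarrow> scalar_form (k + l) (x + y) (\<lambda>\<tau>. f \<tau> * g \<tau>)"
  unfolding scalar_form_def by (auto intro!: exI intro: S_law_mult q_exp_mult)

lemma scalar_form_add: "scalar_form k x f \<Longrightarrow> scalar_form k x g \<Longrightarrow> scalar_form k x (\<lambda>\<tau>. f \<tau> + g \<tau>)"
  unfolding scalar_form_def by (auto intro!: exI intro: S_law_add q_exp_add)

lemma scalar_form_diff: "scalar_form k x f \<Longrightarrow> scalar_form k x g \<Longrightarrow> scalar_form k x (\<lambda>\<tau>. f \<tau> - g \<tau>)"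
  unfolding scalar_form_def by (auto intro!: exI intro: S_law_diff q_exp_diff)

lemma scalar_form_cmult: "scalar_form k x f \<Longrightarrow> scalar_form k x (\<lambda>\<tau>. a * f \<tau>)"
  unfolding scalar_form_def by (auto intro!: exI intro: S_law_cmult q_exp_cmult)

lemma scalar_form_zero: "scalar_form k x (\<lambda>\<tau>. 0)"
  unfolding scalar_form_def by (auto intro!: exI intro: S_law_zero q_exp_zero)

lemma scalar_form_const: "scalar_form 0 0 (\<lambda>\<tau>. c)"
  unfolding scalar_form_def by (auto intro!: exI intro: S_law_const q_exp_const)

lemma scalar_form_power: "scalar_form k x f \<Longrightarrow> scalar_form (int n * k) (int n * x) (\<lambda>\<tau>. f \<tau> ^ n)"
  unfolding scalar_form_def by (auto intro!: exI intro: S_law_power q_exp_power)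

lemma scalar_form_raise: "scalar_form k x f \<Longrightarrow> q_exp x 0 f \<Longrightarrow> scalar_form k (x + 6) f"
  unfolding scalar_form_def using q_exp_raise[of x f] S_law_parity[of k x f "x + 6"] by simp

lemma eisenstein_forms:
  "S_law 4 0 (eisenstein 4)" "q_exp 0 1 (eisenstein 4)"
  "S_law 6 0 (eisenstein 6)" "q_exp 0 1 (eisenstein 6)"
proof -
  have "q_exp 0 1 (eisenstein k)" if "k \<in> {4, 6}" for k
    using eisenstein_q_expansion[OF that] unfolding q_exp_def by (metis (no_types, lifting) div_0 mult_1 mult_zero_left of_int_0 qe_0)
  thus "q_exp 0 1 (eisenstein 4)" "q_exp 0 1 (eisenstein 6)" by auto
  show "S_law 4 0 (eisenstein 4)" "S_law 6 0 (eisenstein 6)"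
    using eisenstein_S[of _ 4] eisenstein_S[of _ 6] unfolding S_law_def by (auto simp: power_int_def)
qed

lemma scalar_form_eisenstein:
  "scalar_form 4 0 (eisenstein 4)" "scalar_form 6 0 (eisenstein 6)"
  unfolding scalar_form_def using eisenstein_forms by blast+

text \<open>Applying S twice returns to \<tau> with the factor (-1)^k, the sign of the character at
  S squaring to 1.\<close>

lemma scalar_form_odd_weight:
  assumes "scalar_form k x f" "odd k" "\<tau> \<in> UH"
  shows "f \<tau> = 0"
proof -
  have S: "f (- 1 / \<tau>) = (-1) powi x * \<tau> powi k * f \<tau>" if "\<tau> \<in> UH" for \<tau>
    using assms that by (auto simp: scalar_form_def S_law_def)
  have "\<tau> \<noteq> 0" using assms(3) by auto
  have "f \<tau> = f (- 1 / (- 1 / \<tau>))" by simp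
  also have "\<dots> = (-1) powi x * (- 1 / \<tau>) powi k * ((-1) powi x * \<tau> powi k * f \<tau>)"
    using S[OF S_in_UH[OF assms(3)]] S[OF assms(3)] by simp
  also have "\<dots> = ((-1) powi x * (-1) powi x) * ((- 1 / \<tau>) powi k * \<tau> powi k) * f \<tau>" by (simp add: mult_ac)
  also have "(- 1 / \<tau>) powi k * \<tau> powi k = -1"
    using \<open>\<tau> \<noteq> 0\<close> assms(2) by (simp flip: power_int_mult_distrib)
  also have "(-1) powi x * (-1) powi x = (1 :: complex)"
    by (simp flip: power_int_mult_distrib)
  finally show ?thesis by simp
qed

text \<open>Every orbit meets Im \<tau> \<ge> 17/20, that is |q| \<le> r, so the maximum of |G| over
  this compact disc is its maximum over the whole open unit disc. Being attained inside, it forces G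
  to be constant.\<close>

lemma scalar_form_weight_zero:
  assumes "scalar_form 0 0 f"
  obtains c where "\<And>\<tau>. \<tau> \<in> UH \<Longrightarrow> f \<tau> = c"
proof -
  obtain G where G: "G holomorphic_on ball 0 1" "\<And>\<tau>. \<tau> \<in> UH \<Longrightarrow> f \<tau> = G (qe \<tau>)"
    using assms by (auto simp: scalar_form_def q_exp_def)
  have S: "f (- 1 / \<tau>) = f \<tau>" if "\<tau> \<in> UH" for \<tau>
    using assms that by (auto simp: scalar_form_def S_law_def)
  have T: "f (\<tau> + 1) = f \<tau>" if "\<tau> \<in> UH" for \<tau>
    using assms that q_exp_T[of 0 _ f] by (auto simp: scalar_form_def)
  define r where "r = exp (- 2 * pi * (17/20))"
  have r: "r > 0" "r < 1" by (auto simp: r_def)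
  have "continuous_on (cball 0 r) (\<lambda>q. norm (G q))"
    using r by (intro continuous_on_norm holomorphic_on_imp_continuous_on holomorphic_on_subset[OF G(1)]) auto
  then obtain z0 where z0: "z0 \<in> cball 0 r" "\<And>z. z \<in> cball 0 r \<Longrightarrow> norm (G z) \<le> norm (G z0)"
    using continuous_attains_sup[of "cball 0 r" "\<lambda>q. norm (G q)"] r by auto
  have bound: "norm (f \<tau>) \<le> norm (G z0)" if "\<tau> \<in> UH" for \<tau>
  proof (rule UH_reduction[where Q = "\<lambda>\<tau>. norm (f \<tau>) \<le> norm (G z0)", OF _ _ _ that])
    fix \<tau> assume \<tau>: "Im \<tau> \<ge> 17/20"
    have "qe \<tau> \<in> cball 0 r" using \<tau> by (simp add: norm_qe r_def)
    thus "norm (f \<tau>) \<le> norm (G z0)" using z0(2) G(2)[of \<tau>] \<tau> by simp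
  qed (simp_all only: S T)
  have "norm (G z) \<le> norm (G z0)" if z: "z \<in> ball 0 1" for z
  proof (cases "z = 0")
    case True
    thus ?thesis using z0(2)[of 0] r by simp
  next
    case False
    then obtain \<tau> where "\<tau> \<in> UH" "qe \<tau> = z" using qe_image[of z] z by auto
    thus ?thesis using bound[of \<tau>] G(2)[of \<tau>] by simp
  qed
  hence "G constant_on ball 0 1"
    using z0(1) r by (intro maximum_modulus_principle[OF G(1), of "ball 0 1" z0]) auto
  then obtain c where "\<And>z. z \<in> ball 0 1 \<Longrightarrow> G z = c" by (auto simp: constant_on_def)
  thus ?thesis using G(2) qe_in_ball that by metis
qed

section \<open>Nonvanishing of cusp forms of weight 12\<close>

lemma S_derivative:
  assumes "\<tau> \<in> UH" "(P has_field_derivative p) (at (- 1 / \<tau>))"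
  shows "((\<lambda>\<tau>. P (- 1 / \<tau>)) has_field_derivative p / \<tau>\<^sup>2) (at \<tau>)"
proof -
  have "\<tau> \<noteq> 0" using assms(1) by auto
  hence "((\<lambda>\<tau>. - 1 / \<tau>) has_field_derivative 1 / \<tau>\<^sup>2) (at \<tau>)"
    by (auto intro!: derivative_eq_intros simp: power2_eq_square)
  from DERIV_chain2[OF assms(2) this] show ?thesis by simp
qed

lemma primitive_on_UH:
  assumes "f holomorphic_on UH"
  obtains P where "\<And>\<tau>. \<tau> \<in> UH \<Longrightarrow> (P has_field_derivative f \<tau>) (at \<tau>)"
proof -
  obtain P where "\<And>\<tau>. \<tau> \<in> UH \<Longrightarrow> (P has_field_derivative f \<tau>) (at \<tau> within UH)"
    using holomorphic_convex_primitive'[OF convex_UH open_UH assms] by blast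
  thus ?thesis using that at_within_open[OF _ open_UH] by metis
qed

lemma constant_on_UH:
  assumes "\<And>\<tau>. \<tau> \<in> UH \<Longrightarrow> (P has_field_derivative 0) (at \<tau>)"
  obtains c where "\<And>\<tau>. \<tau> \<in> UH \<Longrightarrow> P \<tau> = c"
  using has_field_derivative_zero_constant[OF convex_UH, of P] assms
  by (meson has_field_derivative_at_within)

text \<open>A primitive of a form of weight \<open>2\<close> changes by a homomorphism into \<open>\<complex>\<close> under the modular
  group; this is trivial because \<open>S\<close> fixes \<open>\<i>\<close> and \<open>S T\<close> fixes a primitive cube root of unity.
  So the form has vanishing constant term.\<close>

lemma scalar_form_weight_2_cusp:
  assumes f: "S_law 2 0 f" "q_exp 0 c f"
  shows "c = 0"
proof -
  have hol: "f holomorphic_on UH" using f(2) by (rule q_exp_holomorphic)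
  obtain G where G: "G holomorphic_on ball 0 1" "G 0 = c" "\<And>\<tau>. \<tau> \<in> UH \<Longrightarrow> f \<tau> = G (qe \<tau>)"
    using f(2) by (auto simp: q_exp_def)
  have "(\<lambda>z. G z - c) holomorphic_on ball 0 1" using G by (intro holomorphic_intros)
  then obtain K where K: "K holomorphic_on ball 0 1" "\<And>z. z \<in> ball 0 1 \<Longrightarrow> G z - c = (z - 0) * K z"
    using holomorphic_factor_zero[of "\<lambda>z. G z - c" "ball 0 1" 0] G(2) by auto
  obtain Q where Q: "\<And>z. z \<in> ball 0 1 \<Longrightarrow> (Q has_field_derivative K z) (at z)"
    using holomorphic_convex_primitive'[OF _ _ K(1)] at_within_open[OF _ open_ball]
    by (metis convex_ball open_ball)
  obtain P where P: "\<And>\<tau>. \<tau> \<in> UH \<Longrightarrow> (P has_field_derivative f \<tau>) (at \<tau>)"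
    using primitive_on_UH[OF hol] by blast
  have "((\<lambda>\<tau>. P (- 1 / \<tau>) - P \<tau>) has_field_derivative 0) (at \<tau>)" if "\<tau> \<in> UH" for \<tau>
  proof -
    have "f (- 1 / \<tau>) / \<tau>\<^sup>2 = f \<tau>"
      using f(1) that UH_nonzero[OF that] by (auto simp: S_law_def power_int_def)
    thus ?thesis
      using DERIV_diff[OF S_derivative[OF that P[OF S_in_UH[OF that]]] P[OF that]] by simp
  qed
  then obtain a where a: "\<And>\<tau>. \<tau> \<in> UH \<Longrightarrow> P (- 1 / \<tau>) - P \<tau> = a"
    using constant_on_UH[of "\<lambda>\<tau>. P (- 1 / \<tau>) - P \<tau>"] by blast
  have "a = 0" using a[of \<i>] by simp
  \<comment> \<open>The primitive is c \<tau> plus a function of q up to a constant, so its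
    increment under T is exactly c.\<close>
  have "((\<lambda>\<tau>. P \<tau> - c * \<tau> - Q (qe \<tau>) / (2 * of_real pi * \<i>)) has_field_derivative 0) (at \<tau>)"
    if "\<tau> \<in> UH" for \<tau>
  proof -
    have "((\<lambda>\<tau>. Q (qe \<tau>)) has_field_derivative K (qe \<tau>) * (2 * of_real pi * \<i> * 1 * qe \<tau>)) (at \<tau>)"
      by (rule DERIV_chain2[of Q _ qe, OF Q[OF qe_in_ball[OF that]]])
         (rule has_field_derivative_qe[OF DERIV_ident])
    hence "((\<lambda>\<tau>. P \<tau> - c * \<tau> - Q (qe \<tau>) / (2 * of_real pi * \<i>)) has_field_derivative
            f \<tau> - c * 1 - K (qe \<tau>) * (2 * of_real pi * \<i> * 1 * qe \<tau>) / (2 * of_real pi * \<i>)) (at \<tau>)"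
      using P[OF that] by (intro DERIV_diff DERIV_cmult DERIV_ident DERIV_cdivide)
    also have "f \<tau> - c * 1 - K (qe \<tau>) * (2 * of_real pi * \<i> * 1 * qe \<tau>) / (2 * of_real pi * \<i>) = 0"
      using G(3)[OF that] K(2)[OF qe_in_ball[OF that]] by (simp add: field_simps)
    finally show ?thesis .
  qed
  then obtain b where b: "\<And>\<tau>. \<tau> \<in> UH \<Longrightarrow> P \<tau> - c * \<tau> - Q (qe \<tau>) / (2 * of_real pi * \<i>) = b"
    using constant_on_UH[of "\<lambda>\<tau>. P \<tau> - c * \<tau> - Q (qe \<tau>) / (2 * of_real pi * \<i>)"] by blast
  define w where "w = Complex (-1/2) (sqrt 3 / 2)"
  have w: "w \<in> UH" "w + 1 \<in> UH" by (simp_all add: w_def)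
  have "w * (w + 1) = -1"
    by (simp add: w_def complex_eq_iff field_simps)
  hence "- 1 / (w + 1) = w"
    using UH_nonzero[OF w(2)] by (metis nonzero_mult_div_cancel_right)
  hence "P (w + 1) = P w" using a[OF w(2)] \<open>a = 0\<close> by simp
  moreover have "P (w + 1) - P w = c"
    using b[OF w(1)] b[OF w(2)] by (simp add: qe_add algebra_simps)
  ultimately show ?thesis by simp
qed

abbreviation E4 :: "complex \<Rightarrow> complex" where "E4 \<equiv> eisenstein 4"
abbreviation E6 :: "complex \<Rightarrow> complex" where "E6 \<equiv> eisenstein 6"

lemma q_exp_nontrivial:
  assumes "q_exp x c f" "c \<noteq> 0"
  shows "\<exists>\<tau>\<in>UH. f \<tau> \<noteq> 0"
proof (rule ccontr)
  assume "\<not> ?thesis"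
  hence f0: "\<And>\<tau>. \<tau> \<in> UH \<Longrightarrow> f \<tau> = 0" by blast
  obtain G where G: "G holomorphic_on ball 0 1" "G 0 = c" "\<And>\<tau>. \<tau> \<in> UH \<Longrightarrow> f \<tau> = qe (of_int x * \<tau> / 6) * G (qe \<tau>)"
    using assms(1) by (auto simp: q_exp_def)
  have "G z = 0" if z: "z \<in> ball 0 1 - {0}" for z
  proof -
    obtain \<tau> where \<tau>: "\<tau> \<in> UH" "qe \<tau> = z" using qe_image[OF z] by blast
    thus ?thesis using G(3)[of \<tau>] f0[of \<tau>] by simp
  qed
  hence "\<forall>\<^sub>F z in at 0. G z = 0"
    unfolding eventually_at by (intro exI[of _ 1]) auto
  hence "(G \<longlongrightarrow> 0) (at 0)" by (rule tendsto_eventually)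
  moreover have "(G \<longlongrightarrow> G 0) (at 0)"
    using holomorphic_on_imp_continuous_on[OF G(1)] by (simp add: continuous_on_eq_continuous_at isCont_def)
  ultimately show False using tendsto_unique[of "at (0::complex)"] G(2) assms(2) by auto
qed

lemma q_exp_coeff_unique:
  assumes "q_exp x c f" "q_exp x d f"
  shows "c = d"
  using q_exp_nontrivial[of x "c - d" "\<lambda>\<tau>. f \<tau> - f \<tau>"] q_exp_diff[OF assms] by auto

text \<open>Otherwise \<open>E6 / E4\<close> would be a holomorphic square root of \<open>E4\<close>, hence a form of weight \<open>2\<close>
  with constant term \<open>1\<close>.\<close>

lemma E4_cubed_neq_E6_squared: "\<exists>\<tau>\<in>UH. E4 \<tau> ^ 3 \<noteq> E6 \<tau> ^ 2"
proof (rule ccontr)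
  assume "\<not> ?thesis"
  hence eq: "\<And>\<tau>. \<tau> \<in> UH \<Longrightarrow> E4 \<tau> ^ 3 = E6 \<tau> ^ 2" by blast
  have hol: "E4 holomorphic_on UH" "E6 holomorphic_on UH"
    using eisenstein_forms q_exp_holomorphic by blast+
  define g where "g = (\<lambda>\<tau>. E6 \<tau> / E4 \<tau>)"
  \<comment> \<open>This includes the zeros of \<open>E4\<close>, where division by zero gives g the
    value 0. Since |g|^2 = |E4|, that is also the limit of g there, so the singularity is removable
    with the value g already has.\<close>
  have g2: "g \<tau> ^ 2 = E4 \<tau>" if "\<tau> \<in> UH" for \<tau>
  proof -
    have "g \<tau> ^ 2 = E4 \<tau> ^ 3 / E4 \<tau> ^ 2" by (simp add: g_def power_divide eq[OF that])
    thus ?thesis by (simp add: power3_eq_cube power2_eq_square)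
  qed
  obtain \<beta> where \<beta>: "\<beta> \<in> UH" "E4 \<beta> \<noteq> 0"
    using q_exp_nontrivial[OF eisenstein_forms(2)] by auto
  have "\<exists>g'. (g has_field_derivative g') (at \<tau>)" if \<tau>: "\<tau> \<in> UH" for \<tau>
  proof (cases "E4 \<tau> = 0")
    case False
    obtain a b where "(E6 has_field_derivative a) (at \<tau>)" "(E4 has_field_derivative b) (at \<tau>)"
      using hol \<tau> open_UH by (meson holomorphic_on_open)
    thus ?thesis unfolding g_def using False by (auto intro!: exI derivative_eq_intros)
  next
    case True
    obtain r where r: "r > 0" "ball \<tau> r \<subseteq> UH" "\<And>z. z \<in> ball \<tau> r - {\<tau>} \<Longrightarrow> E4 z \<noteq> 0"
      using isolated_zeros[OF hol(1) open_UH convex_connected[OF convex_UH] \<tau> True \<beta>] by blast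
    have "g holomorphic_on ball \<tau> r"
    proof (rule no_isolated_singularity'[where K = "{\<tau>}"])
      show "g holomorphic_on ball \<tau> r - {\<tau>}"
        unfolding g_def using r hol
        by (intro holomorphic_intros) (auto intro: holomorphic_on_subset)
      fix z assume z: "z \<in> {\<tau>}"
      have "isCont E4 \<tau>"
        using holomorphic_on_imp_continuous_on[OF hol(1)] \<tau> open_UH continuous_on_eq_continuous_at by blast
      hence "((\<lambda>z. sqrt (norm (E4 z))) \<longlongrightarrow> sqrt (norm (E4 \<tau>))) (at \<tau> within ball \<tau> r)"
        by (intro tendsto_intros) (auto simp: isCont_def intro: tendsto_within_subset)
      hence "((\<lambda>z. sqrt (norm (E4 z))) \<longlongrightarrow> 0) (at \<tau> within ball \<tau> r)" using True by simp
      hence "(g \<longlongrightarrow> 0) (at \<tau> within ball \<tau> r)"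
      proof (rule Lim_null_comparison[rotated])
        have "norm (g z) \<le> sqrt (norm (E4 z))" if "z \<in> ball \<tau> r" for z
        proof -
          have "E4 z = g z ^ 2" using g2[of z] r(2) that by auto
          thus ?thesis by (simp add: norm_power)
        qed
        thus "\<forall>\<^sub>F z in at \<tau> within ball \<tau> r. norm (g z) \<le> sqrt (norm (E4 z))"
          by (simp add: eventually_at_filter)
      qed
      moreover have "g \<tau> = 0" using True by (simp add: g_def)
      ultimately show "(g \<longlongrightarrow> g z) (at z within ball \<tau> r)" using z by simp
    qed auto
    thus ?thesis using r(1) holomorphic_on_open[of "ball \<tau> r" g] by auto
  qed
  hence ghol: "g holomorphic_on UH" using open_UH by (subst holomorphic_on_open) auto
  have gS: "S_law 2 0 g"
  proof -
    have "g (- 1 / \<tau>) = \<tau> ^ 2 * g \<tau>" if "\<tau> \<in> UH" for \<tau>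
    proof -
      have "g (- 1 / \<tau>) = (\<tau> ^ 2 * \<tau> ^ 4 * E6 \<tau>) / (\<tau> ^ 4 * E4 \<tau>)"
        unfolding g_def using that by (simp only: eisenstein_S even_numeral flip: power_add) simp
      also have "\<dots> = (\<tau> ^ 4 * (\<tau> ^ 2 * E6 \<tau>)) / (\<tau> ^ 4 * E4 \<tau>)" by (simp only: mult_ac)
      also have "\<dots> = \<tau> ^ 2 * E6 \<tau> / E4 \<tau>"
        using UH_nonzero[OF that] by (intro nonzero_mult_divide_mult_cancel_left) simp
      also have "\<dots> = \<tau> ^ 2 * g \<tau>" by (simp add: g_def)
      finally show ?thesis .
    qed
    thus ?thesis by (simp add: S_law_def power_int_def)
  qed
  have "g (\<tau> + 1) = g \<tau>" for \<tau> by (simp add: g_def eisenstein_T)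
  moreover have "\<exists>Y. \<forall>\<tau>. Im \<tau> > Y \<longrightarrow> norm (g \<tau> - 1) < \<epsilon>" if \<epsilon>: "\<epsilon> > 0" for \<epsilon>
  proof -
    obtain A B where A: "A holomorphic_on ball 0 1" "A 0 = 1" "\<And>\<tau>. \<tau> \<in> UH \<Longrightarrow> E4 \<tau> = A (qe \<tau>)"
      and B: "B holomorphic_on ball 0 1" "B 0 = 1" "\<And>\<tau>. \<tau> \<in> UH \<Longrightarrow> E6 \<tau> = B (qe \<tau>)"
      using eisenstein_q_expansion[of 4] eisenstein_q_expansion[of 6] by (metis insertI1 insertI2)
    have "isCont A 0" "isCont B 0"
      using holomorphic_on_imp_continuous_on[OF A(1)] holomorphic_on_imp_continuous_on[OF B(1)]
      by (simp_all add: continuous_on_eq_continuous_at)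
    hence "isCont (\<lambda>q. B q / A q) 0" using A by (intro continuous_intros) auto
    then obtain d where d: "d > 0" "\<And>q. norm q < d \<Longrightarrow> norm (B q / A q - 1) < \<epsilon>"
      using \<epsilon> A(2) B(2) unfolding continuous_at_eps_delta by (auto simp: dist_norm)
    have "norm (g \<tau> - 1) < \<epsilon>" if "Im \<tau> > max 0 (- ln d / (2 * pi))" for \<tau>
    proof -
      have "exp (- 2 * pi * Im \<tau>) < exp (ln d)"
        using that by (subst exp_less_cancel_iff) (auto simp: field_simps)
      hence "norm (qe \<tau>) < d" using d(1) by (simp add: norm_qe)
      thus ?thesis using d(2)[of "qe \<tau>"] A(3)[of \<tau>] B(3)[of \<tau>] that by (simp add: g_def)
    qed
    thus ?thesis by blast
  qed
  ultimately obtain G where "G holomorphic_on ball 0 1" "G 0 = 1" "\<And>\<tau>. \<tau> \<in> UH \<Longrightarrow> g \<tau> = G (qe \<tau>)"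
    using periodic_q_expansion[OF ghol, of 1] by metis
  hence "q_exp 0 1 g" unfolding q_exp_def by auto
  with gS show False using scalar_form_weight_2_cusp by fastforce
qed

section \<open>Numerical bounds for the maximum principle argument\<close>

lemma pi_bounds: "3 \<le> pi" "pi \<le> 3161/1000"
proof -
  have "sin (pi/6) \<le> pi/6" by (rule sin_x_le_x) simp
  thus "3 \<le> pi" by (simp add: sin_30)
  \<comment> \<open>Euler's arctangent formula for \<pi>/4 with arctan x \<le> x. The resulting
    bound is sharp enough for 3\<pi>/10 \<le> 19/20.\<close>
  have "pi/4 \<le> 5 * (1/7) + 2 * (3/79)"
    using machin_Euler arctan_le_self[of "1/7"] arctan_le_self[of "3/79"] by linarith
  hence "pi \<le> 1748/553" by simp
  thus "pi \<le> 3161/1000" by simp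
qed

text \<open>With R = e^(-\<pi>) and r = e^(-17\<pi>/10) this says 128 r < 396 R (R - r), which
  contradicts what a zero would imply in \<open>cusp_form_weight_12_no_zeros\<close>. Numerically it
  amounts to 128 times 2.6 being less than 396 times 7/8.\<close>

lemma exp_bounds_for_cusp_form:
  "128 * exp (3/10 * pi) < 396 * (1 - exp (- (7/10) * pi))"
proof -
  have e: "exp 1 < (272/100::real)" by (rule e_less_272)
  have e2: "exp 1 > (271/100::real)" using e_approx_32 by (simp add: abs_if split: if_splits)
  have "exp (1/20) \<ge> 1 + (1/20::real)" by (rule exp_ge_add_one_self)
  hence "exp (19/20) * (21/20) \<le> exp (19/20) * exp (1/20::real)" by (intro mult_left_mono) auto
  also have "\<dots> = exp 1" by (simp flip: exp_add)
  finally have 1: "exp (19/20) \<le> (260/100::real)" using e by linarith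
  have "exp (3/10 * pi) \<le> exp (19/20)" using pi_bounds by simp
  hence 2: "exp (3/10 * pi) \<le> 260/100" using 1 by linarith
  have "8 \<le> (271/100)\<^sup>2 * (11/10::real)" by (simp add: power2_eq_square)
  also have "\<dots> \<le> (exp 1)\<^sup>2 * exp (1/10)"
    using e2 exp_ge_add_one_self[of "1/10"] by (intro mult_mono power_mono) auto
  also have "\<dots> = exp (21/10)" by (simp flip: exp_of_nat_mult exp_add)
  finally have "exp (- (21/10)) \<le> (1/8::real)" by (simp add: exp_minus field_simps)
  moreover have "exp (- (7/10) * pi) \<le> exp (- (21/10))" using pi_bounds by simp
  ultimately have "exp (- (7/10) * pi) \<le> 1/8" by linarith
  thus ?thesis using 2 by simp
qed

text \<open>The minimum over y is (e \<pi>/3)^6, at y = 3/\<pi>, and 396 is just below 2.71^6. The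
  proof is the tangent inequality t \<le> e^(t-1) at t = \<pi> y/3, raised to the sixth
  power.\<close>

lemma exp_over_power_six_bound:
  assumes "y > 0"
  shows "396 \<le> exp (2 * pi * y) / y ^ 6"
proof -
  have "exp 1 > (271/100::real)" using e_approx_32 by (simp add: abs_if split: if_splits)
  hence "(271/100) ^ 6 \<le> exp (1::real) ^ 6" by (intro power_mono) auto
  hence 1: "396 \<le> exp (1::real) ^ 6" by (simp add: eval_nat_numeral)
  have "y \<le> pi * y / 3" using pi_bounds assms by simp
  also have "\<dots> \<le> exp (pi * y / 3 - 1)" using exp_ge_add_one_self[of "pi * y / 3 - 1"] by simp
  finally have "y ^ 6 \<le> exp (pi * y / 3 - 1) ^ 6" using assms by (intro power_mono) auto
  also have "\<dots> = exp (2 * pi * y) / exp 1 ^ 6"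
    by (simp flip: exp_of_nat_mult exp_diff)
  finally have "y ^ 6 * exp 1 ^ 6 \<le> exp (2 * pi * y)" by (simp add: field_simps)
  moreover have "396 * y ^ 6 \<le> exp 1 ^ 6 * y ^ 6" using 1 assms by (intro mult_right_mono) auto
  ultimately have "396 * y ^ 6 \<le> exp (2 * pi * y)" by (simp add: mult.commute)
  thus ?thesis using assms by (simp add: field_simps)
qed


text \<open>The invariant function \<open>\<bar>F\<bar> y\<^sup>6\<close> attains its maximum \<open>M\<close> at some \<open>\<tau>1\<close> of height at least
  \<open>17/20\<close>, and a zero may be moved to a point of height at least \<open>17/20\<close> or to the cusp.  Dividing out the zero, the
  maximum modulus principle on the disc \<open>\<bar>q\<bar> \<le> e\<^bsup>-\<pi>\<^esup>\<close>, where \<open>\<bar>F\<bar> \<le> 64 M\<close>, bounds \<open>\<bar>F(\<tau>1)\<bar>\<close>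
  by less than \<open>M / y1\<^sup>6\<close>.\<close>

lemma cusp_form_weight_12_no_zeros:
  assumes F: "S_law 12 0 F" and G: "G holomorphic_on ball 0 1" "\<And>\<tau>. \<tau> \<in> UH \<Longrightarrow> F \<tau> = qe \<tau> * G (qe \<tau>)"
    and nz: "\<exists>\<tau>\<in>UH. F \<tau> \<noteq> 0" and q: "q \<in> ball 0 1"
  shows "G q \<noteq> 0"
proof (rule ccontr)
  assume zero: "\<not> G q \<noteq> 0"
  have S: "F (- 1 / \<tau>) = \<tau> ^ 12 * F \<tau>" if "\<tau> \<in> UH" for \<tau>
    using F that by (auto simp: S_law_def power_int_def)
  have T: "F (\<tau> + 1) = F \<tau>" if "\<tau> \<in> UH" for \<tau>
    using G(2)[OF that] G(2)[of "\<tau> + 1"] that by (simp add: qe_add)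
  define r where "r = exp (- 2 * pi * (17/20))"
  have r: "r > 0" "r < 1" by (auto simp: r_def)
  have qe_r: "qe \<tau> \<in> cball 0 r \<longleftrightarrow> Im \<tau> \<ge> 17/20" for \<tau>
    by (simp add: norm_qe r_def mult.commute)
  define h where "h = (\<lambda>\<tau>. norm (F \<tau>) * Im \<tau> ^ 6)"
  \<comment> \<open>This is h in terms of q, by Im \<tau> = - ln |q| / (2\<pi>). At q = 0 the factor
    |q| makes it 0, which is its limit, so it is continuous on the closed disc including the
    cusp.\<close>
  define \<psi> where "\<psi> = (\<lambda>q. norm (G q) * (norm q * (- ln (norm q) / (2 * pi)) ^ 6))"
  have h\<psi>: "h \<tau> = \<psi> (qe \<tau>)" if "\<tau> \<in> UH" for \<tau>
    using G(2)[OF that] by (simp add: h_def \<psi>_def norm_mult norm_qe)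
  have contG: "continuous_on (cball 0 r) G"
    using r by (intro holomorphic_on_imp_continuous_on holomorphic_on_subset[OF G(1)]) auto
  have "continuous_on (cball 0 r) (\<lambda>q::complex. norm q * (- ln (norm q) / (2 * pi)) ^ 6)"
    unfolding continuous_on_def
  proof
    fix q :: complex
    show "((\<lambda>q. norm q * (- ln (norm q) / (2 * pi)) ^ 6) \<longlongrightarrow>
             norm q * (- ln (norm q) / (2 * pi)) ^ 6) (at q within cball 0 r)"
    proof (cases "q = 0")
      case False
      thus ?thesis by (intro tendsto_intros) auto
    next
      case True
      have "((\<lambda>x::real. x * (- ln x / (2 * pi)) ^ 6) \<longlongrightarrow> 0) (at_right 0)" by real_asymp
      moreover have "filterlim norm (at_right 0) (at (0::complex) within cball 0 r)"
        unfolding filterlim_at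
        by (auto simp: eventually_at_filter intro!: tendsto_norm_zero tendsto_ident_at)
      ultimately have "((\<lambda>q::complex. norm q * (- ln (norm q) / (2 * pi)) ^ 6) \<longlongrightarrow> 0) (at 0 within cball 0 r)"
        by (rule filterlim_compose)
      thus ?thesis using True by simp
    qed
  qed
  hence "continuous_on (cball 0 r) \<psi>"
    unfolding \<psi>_def by (intro continuous_on_mult[OF continuous_on_norm[OF contG]])
  then obtain q1 where q1: "q1 \<in> cball 0 r" "\<And>q. q \<in> cball 0 r \<Longrightarrow> \<psi> q \<le> \<psi> q1"
    using continuous_attains_sup[of "cball 0 r" \<psi>] r by auto
  define M where "M = \<psi> q1"
  have hS: "h (- 1 / \<tau>) = h \<tau>" if "\<tau> \<in> UH" for \<tau>
  proof -
    have "h (- 1 / \<tau>) = norm \<tau> ^ 12 * norm (F \<tau>) * (Im \<tau> / (norm \<tau>)\<^sup>2) ^ 6"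
      unfolding h_def Im_S using S[OF that] by (simp add: norm_mult norm_power)
    also have "\<dots> = h \<tau>"
      using UH_nonzero[OF that] by (simp add: h_def power_divide flip: power_mult)
    finally show ?thesis .
  qed
  have hT: "h (\<tau> + 1) = h \<tau>" if "\<tau> \<in> UH" for \<tau>
    using T[OF that] by (simp add: h_def)
  have hM: "h \<tau> \<le> M" if "\<tau> \<in> UH" for \<tau>
  proof (rule UH_reduction[where Q = "\<lambda>\<tau>. h \<tau> \<le> M", OF _ _ _ that])
    fix \<tau> assume "Im \<tau> \<ge> 17/20"
    thus "h \<tau> \<le> M" using q1(2)[of "qe \<tau>"] qe_r[of \<tau>] h\<psi>[of \<tau>] by (simp add: M_def)
  qed (simp_all only: hS hT)
  obtain \<tau>2 where "\<tau>2 \<in> UH" "F \<tau>2 \<noteq> 0" using nz by blast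
  hence "h \<tau>2 > 0" by (simp add: h_def)
  hence M: "M > 0" using hM[of \<tau>2] \<open>\<tau>2 \<in> UH\<close> by linarith
  hence "q1 \<noteq> 0" by (auto simp: M_def \<psi>_def)
  then obtain \<tau>1 where \<tau>1: "\<tau>1 \<in> UH" "qe \<tau>1 = q1" using qe_image[of q1] q1(1) r by auto
  have "\<exists>q0\<in>cball 0 r. G q0 = 0"
  proof (cases "q = 0")
    case True
    thus ?thesis using zero r by (intro bexI[of _ 0]) auto
  next
    case False
    then obtain \<tau> where \<tau>: "\<tau> \<in> UH" "qe \<tau> = q" using qe_image[of q] q by auto
    have "\<exists>\<tau>0. Im \<tau>0 \<ge> 17/20 \<and> F \<tau>0 = 0"
    proof (rule ccontr)
      assume no: "\<not> ?thesis"
      have "F \<tau> \<noteq> 0"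
        by (rule UH_reduction[where Q = "\<lambda>\<tau>. F \<tau> \<noteq> 0", OF _ _ _ \<tau>(1)])
           (use no S T UH_nonzero in \<open>auto simp del: divide_minus_left\<close>)
      thus False using zero G(2)[OF \<tau>(1)] \<tau>(2) by simp
    qed
    then obtain \<tau>0 where "Im \<tau>0 \<ge> 17/20" "F \<tau>0 = 0" by blast
    thus ?thesis using G(2)[of \<tau>0] qe_r[of \<tau>0] by (intro bexI[of _ "qe \<tau>0"]) auto
  qed
  then obtain q0 where q0: "q0 \<in> cball 0 r" "G q0 = 0" by blast
  obtain K where K: "K holomorphic_on ball 0 1" "\<And>z. z \<in> ball 0 1 \<Longrightarrow> G z = (z - q0) * K z"
    using holomorphic_factor_zero[OF G(1) _ _ q0(2)] q0(1) r by auto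
  define R where "R = exp (- pi)"
  have rR: "r = exp (- (7/10) * pi) * R" unfolding r_def R_def by (simp flip: exp_add)
  have R: "R > 0" "R < 1" by (auto simp: R_def)
  have "exp (- (7/10) * pi) < 1" by simp
  hence "r < R" unfolding rR using R(1) by (simp add: mult_less_cancel_right1)
  \<comment> \<open>On |z| = R the height is 1/2, so |F| \<le> 2^6 M. There F = z (z - q0) K with |z
    - q0| \<ge> R - r, and dividing gives this bound for K.\<close>
  define B where "B = 64 * M / (R * (R - r))"
  have "norm (K q1) \<le> B"
  proof (rule maximum_modulus_frontier[of K "cball 0 R"])
    show "K holomorphic_on interior (cball 0 R)" "continuous_on (closure (cball 0 R)) K"
      using R by (auto intro!: holomorphic_on_imp_continuous_on holomorphic_on_subset[OF K(1)])
    show "q1 \<in> cball 0 R" using q1(1) \<open>r < R\<close> by auto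
    fix z :: complex assume "z \<in> frontier (cball 0 R)"
    hence z: "norm z = R" by (simp add: frontier_cball)
    hence "z \<in> ball 0 1 - {0}" using R by auto
    then obtain \<tau>z where \<tau>z: "\<tau>z \<in> UH" "qe \<tau>z = z" using qe_image by blast
    have "exp (- 2 * pi * Im \<tau>z) = exp (- pi)" using z \<tau>z(2) norm_qe[of \<tau>z] by (simp add: R_def)
    hence "Im \<tau>z = 1/2" by simp
    hence "norm (F \<tau>z) \<le> 64 * M"
      using hM[OF \<tau>z(1)] unfolding h_def by (simp only:) (simp add: power_divide)
    moreover have "norm (F \<tau>z) = R * (norm (z - q0) * norm (K z))"
      using G(2)[OF \<tau>z(1)] K(2)[of z] z R \<tau>z(2) by (simp add: norm_mult)
    moreover have "R * ((R - r) * norm (K z)) \<le> R * (norm (z - q0) * norm (K z))"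
    proof (intro mult_left_mono mult_right_mono)
      have "R \<le> norm (z - q0) + norm q0" using z by (metis diff_add_cancel norm_triangle_ineq)
      thus "R - r \<le> norm (z - q0)" using q0(1) by simp
    qed (use R in auto)
    ultimately have "R * ((R - r) * norm (K z)) \<le> 64 * M" by linarith
    thus "norm (K z) \<le> B" using R \<open>r < R\<close> by (simp add: B_def field_simps)
  qed auto
  moreover have "norm (q1 - q0) \<le> 2 * r"
    using norm_triangle_ineq4[of q1 q0] q0(1) q1(1) by simp
  ultimately have "norm (q1 - q0) * norm (K q1) \<le> (2 * r) * B"
    using r by (intro mult_mono) auto
  hence G1: "norm (G q1) \<le> 2 * r * B"
    using K(2)[of q1] q1(1) r by (simp add: norm_mult)
  have y1: "Im \<tau>1 > 0" using \<tau>1 by simp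
  have "M = norm (F \<tau>1) * Im \<tau>1 ^ 6" using h\<psi>[OF \<tau>1(1)] \<tau>1(2) by (simp add: M_def h_def)
  also have "norm (F \<tau>1) = exp (- 2 * pi * Im \<tau>1) * norm (G q1)"
    using G(2)[OF \<tau>1(1)] \<tau>1(2) norm_qe[of \<tau>1] by (simp add: norm_mult)
  finally have "norm (G q1) = M * (exp (2 * pi * Im \<tau>1) / Im \<tau>1 ^ 6)"
    using y1 by (simp add: exp_minus field_simps)
  moreover have "M * 396 \<le> M * (exp (2 * pi * Im \<tau>1) / Im \<tau>1 ^ 6)"
    using M exp_over_power_six_bound[OF y1] by (intro mult_left_mono) auto
  ultimately have "M * 396 \<le> 2 * r * B" using G1 by linarith
  also have "2 * r * B = M * (128 * r / (R * (R - r)))" by (simp add: B_def)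
  finally have "396 \<le> 128 * r / (R * (R - r))" using M by (subst (asm) mult_le_cancel_left_pos)
  hence "396 * (R * (R - r)) \<le> 128 * r"
    using R \<open>r < R\<close> by (subst (asm) pos_le_divide_eq) auto
  also have "R - r = R * (1 - exp (- (7/10) * pi))" by (simp add: rR algebra_simps)
  finally have "R\<^sup>2 * (396 * (1 - exp (- (7/10) * pi))) \<le> 128 * r" by (simp add: power2_eq_square algebra_simps)
  also have "r = R\<^sup>2 * exp (3/10 * pi)"
    unfolding r_def R_def by (simp flip: exp_of_nat_mult exp_add)
  finally have "R\<^sup>2 * (396 * (1 - exp (- (7/10) * pi))) \<le> R\<^sup>2 * (128 * exp (3/10 * pi))" by (simp add: mult_ac)
  hence "396 * (1 - exp (- (7/10) * pi)) \<le> 128 * exp (3/10 * pi)"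
    using R by (subst (asm) mult_le_cancel_left_pos) auto
  thus False using exp_bounds_for_cusp_form by linarith
qed

section \<open>The ring of modular forms and the Eichler integrals\<close>

text \<open>This is 1728 times the usual discriminant form.\<close>

definition Delta :: "complex \<Rightarrow> complex" where
  "Delta \<tau> = E4 \<tau> ^ 3 - E6 \<tau> ^ 2"

lemma Delta_S: "S_law 12 0 Delta"
  using S_law_diff[OF S_law_power[OF eisenstein_forms(1), of 3] _, of "\<lambda>\<tau>. E6 \<tau> ^ 2"]
        S_law_power[OF eisenstein_forms(3), of 2]
  by (simp add: Delta_def[abs_def])

lemma Delta_expansion:
  obtains G where "G holomorphic_on ball 0 1" "\<And>q. q \<in> ball 0 1 \<Longrightarrow> G q \<noteq> 0"
    "\<And>\<tau>. \<tau> \<in> UH \<Longrightarrow> Delta \<tau> = qe \<tau> * G (qe \<tau>)"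
proof -
  have "q_exp 0 0 Delta"
    using q_exp_diff[OF q_exp_power[OF eisenstein_forms(2), of 3] _, of 1 "\<lambda>\<tau>. E6 \<tau> ^ 2"]
          q_exp_power[OF eisenstein_forms(4), of 2]
    by (simp add: Delta_def[abs_def])
  then obtain c where "q_exp 6 c Delta" using q_exp_raise by fastforce
  then obtain G where G: "G holomorphic_on ball 0 1" "\<And>\<tau>. \<tau> \<in> UH \<Longrightarrow> Delta \<tau> = qe \<tau> * G (qe \<tau>)"
    by (auto simp: q_exp_def)
  have "\<exists>\<tau>\<in>UH. Delta \<tau> \<noteq> 0" using E4_cubed_neq_E6_squared by (auto simp: Delta_def)
  from that[OF G(1) cusp_form_weight_12_no_zeros[OF Delta_S G this] G(2)] show ?thesis .
qed

text \<open>A sixth root of \<^const>\<open>Delta\<close>, that is, a multiple of \<open>\<eta>\<^sup>4\<close>.\<close>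

lemma eta4_exists:
  "\<exists>f c. S_law 2 1 f \<and> c \<noteq> 0 \<and> q_exp 1 c f \<and> q_exp (- 1) (inverse c) (\<lambda>\<tau>. inverse (f \<tau>)) \<and>
     (\<forall>\<tau>\<in>UH. f \<tau> ^ 6 = Delta \<tau> \<and> f \<tau> \<noteq> 0)"
proof -
  obtain G where G: "G holomorphic_on ball 0 1" "\<And>q. q \<in> ball 0 1 \<Longrightarrow> G q \<noteq> 0"
    "\<And>\<tau>. \<tau> \<in> UH \<Longrightarrow> Delta \<tau> = qe \<tau> * G (qe \<tau>)"
    using Delta_expansion by blast
  obtain g where g: "g holomorphic_on ball 0 1" "\<And>q. q \<in> ball 0 1 \<Longrightarrow> exp (g q) = G q"
    using holomorphic_logarithm_exists[OF convex_ball open_ball G(1,2), of 0] by auto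
  define h where "h = (\<lambda>q. exp (g q / 6))"
  define f where "f = (\<lambda>\<tau>. qe (\<tau> / 6) * h (qe \<tau>))"
  have h: "h holomorphic_on ball 0 1" "(\<lambda>q. inverse (h q)) holomorphic_on ball 0 1"
    unfolding h_def using g(1) by (auto intro!: holomorphic_intros)
  have q1: "q_exp 1 (h 0) f"
    unfolding q_exp_def by (rule exI[of _ h]) (use h in \<open>auto simp: f_def\<close>)
  have q2: "q_exp (- 1) (inverse (h 0)) (\<lambda>\<tau>. inverse (f \<tau>))"
    unfolding q_exp_def
    by (rule exI[of _ "\<lambda>q. inverse (h q)"]) (use h in \<open>auto simp: f_def qe_uminus\<close>)
  have f6: "f \<tau> ^ 6 = Delta \<tau>" if "\<tau> \<in> UH" for \<tau>
  proof -
    have "qe (\<tau> / 6) ^ 6 = qe \<tau>" by (simp add: qe_def mult_ac flip: exp_of_nat_mult)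
    moreover have "h (qe \<tau>) ^ 6 = G (qe \<tau>)"
      using g(2)[OF qe_in_ball[OF that]] by (simp add: h_def flip: exp_of_nat_mult)
    ultimately show ?thesis using G(3)[OF that] by (simp add: f_def power_mult_distrib)
  qed
  have f0: "f \<tau> \<noteq> 0" for \<tau> by (simp add: f_def h_def)
  have fcont: "continuous_on UH f"
    using q_exp_holomorphic[OF q1] by (rule holomorphic_on_imp_continuous_on)
  \<comment> \<open>The sixth power of this quotient is 1 by the law for \<open>Delta\<close>, and
    it is continuous on a connected set, hence constant. Its value -1 is read off at the fixed point
    \<i> of S, where \<tau>^2 = -1. This is where the sign of the character at S comes from.\<close>
  define \<kappa> where "\<kappa> = (\<lambda>\<tau>. f (- 1 / \<tau>) / (\<tau>\<^sup>2 * f \<tau>))"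
  have "continuous_on UH \<kappa>"
    unfolding \<kappa>_def using UH_nonzero f0 S_in_UH
    by (intro continuous_intros continuous_on_compose2[OF fcont] fcont) (auto simp del: UH_iff divide_minus_left)
  moreover have "\<kappa> ` UH \<subseteq> {z. z ^ 6 = 1}"
  proof (intro image_subsetI, rule CollectI)
    fix \<tau> assume \<tau>: "\<tau> \<in> UH"
    have "Delta (- 1 / \<tau>) = \<tau> ^ 12 * Delta \<tau>" using Delta_S \<tau> by (auto simp: S_law_def power_int_def)
    hence "f (- 1 / \<tau>) ^ 6 = (\<tau>\<^sup>2 * f \<tau>) ^ 6"
      using f6[OF \<tau>] f6[OF S_in_UH[OF \<tau>]] by (simp add: power_mult_distrib flip: power_mult)
    thus "\<kappa> \<tau> ^ 6 = 1" using f0 UH_nonzero[OF \<tau>] by (simp add: \<kappa>_def power_divide)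
  qed
  hence "finite (\<kappa> ` UH)" by (rule finite_subset) (auto intro: finite_nth_roots)
  ultimately have "\<kappa> constant_on UH"
    by (rule continuous_finite_range_constant[OF convex_connected[OF convex_UH]])
  then obtain k where k: "\<And>\<tau>. \<tau> \<in> UH \<Longrightarrow> \<kappa> \<tau> = k" by (auto simp: constant_on_def)
  have "k = -1" using k[of \<i>] f0 by (simp add: \<kappa>_def)
  hence "f (- 1 / \<tau>) = - (\<tau>\<^sup>2 * f \<tau>)" if "\<tau> \<in> UH" for \<tau>
    using k[OF that] f0[of \<tau>] UH_nonzero[OF that] unfolding \<kappa>_def by (simp add: divide_eq_eq)
  hence "S_law 2 1 f" by (simp add: S_law_def power_int_def)
  moreover have "h 0 \<noteq> 0" by (simp add: h_def)
  ultimately show ?thesis using q1 q2 f6 f0 by blast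
qed

definition eta4 :: "complex \<Rightarrow> complex" where
  "eta4 = (SOME f. \<exists>c. S_law 2 1 f \<and> c \<noteq> 0 \<and> q_exp 1 c f \<and> q_exp (- 1) (inverse c) (\<lambda>\<tau>. inverse (f \<tau>)) \<and>
     (\<forall>\<tau>\<in>UH. f \<tau> ^ 6 = Delta \<tau> \<and> f \<tau> \<noteq> 0))"

lemma eta4_properties:
  obtains c where "S_law 2 1 eta4" "c \<noteq> 0" "q_exp 1 c eta4" "q_exp (- 1) (inverse c) (\<lambda>\<tau>. inverse (eta4 \<tau>))"
    "\<And>\<tau>. \<tau> \<in> UH \<Longrightarrow> eta4 \<tau> ^ 6 = Delta \<tau>" "\<And>\<tau>. \<tau> \<in> UH \<Longrightarrow> eta4 \<tau> \<noteq> 0"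
  using someI_ex[OF eta4_exists] unfolding eta4_def[symmetric] by blast

lemma eta4_nonzero: "\<tau> \<in> UH \<Longrightarrow> eta4 \<tau> \<noteq> 0"
  and eta4_power_6: "\<tau> \<in> UH \<Longrightarrow> eta4 \<tau> ^ 6 = Delta \<tau>"
  by (rule eta4_properties, simp)+

section \<open>Division by powers of \<open>eta4\<close> and the ring of level one\<close>

lemma S_law_inverse: "S_law k x f \<Longrightarrow> S_law (- k) (- x) (\<lambda>\<tau>. inverse (f \<tau>))"
  unfolding S_law_def by (auto simp: power_int_minus)

lemma eta4_powi: "scalar_form (2 * n) n (\<lambda>\<tau>. eta4 \<tau> powi n)"
  and eta4_powi_coeff: "\<exists>c. c \<noteq> 0 \<and> q_exp n c (\<lambda>\<tau>. eta4 \<tau> powi n)"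
proof -
  obtain c where c: "S_law 2 1 eta4" "c \<noteq> 0" "q_exp 1 c eta4" "q_exp (- 1) (inverse c) (\<lambda>\<tau>. inverse (eta4 \<tau>))"
    using eta4_properties by metis
  have "S_law (2 * n) n (\<lambda>\<tau>. eta4 \<tau> powi n) \<and> (\<exists>c. c \<noteq> 0 \<and> q_exp n c (\<lambda>\<tau>. eta4 \<tau> powi n))"
  proof (cases "n \<ge> 0")
    case True
    thus ?thesis
      using S_law_power[OF c(1), of "nat n"] q_exp_power[OF c(3), of "nat n"] c(2)
      by (auto simp: power_int_def mult.commute intro!: exI[of _ "c ^ nat n"])
  next
    case False
    thus ?thesis
      using S_law_power[OF S_law_inverse[OF c(1)], of "nat (- n)"] q_exp_power[OF c(4), of "nat (- n)"] c(2)
      by (auto simp: power_int_def mult.commute intro!: exI[of _ "inverse c ^ nat (- n)"])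
  qed
  thus "scalar_form (2 * n) n (\<lambda>\<tau>. eta4 \<tau> powi n)" "\<exists>c. c \<noteq> 0 \<and> q_exp n c (\<lambda>\<tau>. eta4 \<tau> powi n)"
    by (auto simp: scalar_form_def)
qed

text \<open>\<open>eta4\<close> has no zeros and order exactly 1/6 at the cusp, so dividing by its
  powers preserves forms. For negative x this describes forms with a pole at the cusp.\<close>

lemma scalar_form_eta4_factor:
  assumes "scalar_form k x F"
  obtains r where "scalar_form (k - 2 * x) 0 r" "\<And>\<tau>. \<tau> \<in> UH \<Longrightarrow> F \<tau> = eta4 \<tau> powi x * r \<tau>"
proof
  show "scalar_form (k - 2 * x) 0 (\<lambda>\<tau>. F \<tau> * eta4 \<tau> powi (- x))"
    using scalar_form_mult[OF assms eta4_powi[of "- x"]] by simp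
  show "F \<tau> = eta4 \<tau> powi x * (F \<tau> * eta4 \<tau> powi (- x))" if "\<tau> \<in> UH" for \<tau>
    using eta4_nonzero[OF that] by (simp add: power_int_minus)
qed

text \<open>With m = -k, the product of F^12 and \<open>eta4\<close>^(6m), the m-th power of
  \<open>Delta\<close>, has weight 0 and vanishes at the cusp, so it is the constant 0.\<close>

lemma scalar_form_negative_weight:
  assumes F: "scalar_form k 0 F" and k: "k < 0" and \<tau>: "\<tau> \<in> UH"
  shows "F \<tau> = 0"
proof -
  define m where "m = nat (- k)"
  have m: "m > 0" "k = - int m" using k by (auto simp: m_def)
  define g where "g = (\<lambda>\<tau>. F \<tau> ^ 12 * eta4 \<tau> powi (6 * int m))"
  have "scalar_form (12 * k + 2 * (6 * int m)) (12 * 0 + 6 * int m) g"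
    unfolding g_def using scalar_form_mult[OF scalar_form_power[OF F, of 12] eta4_powi[of "6 * int m"]] by simp
  hence "scalar_form 0 (6 * int m) g" using m by simp
  then obtain c where c: "S_law 0 (6 * int m) g" "q_exp (6 * int m) c g" by (auto simp: scalar_form_def)
  have "q_exp 0 0 g" if "q_exp (6 * int (Suc n)) c g" for n c
    using that
  proof (induction n arbitrary: c)
    case 0
    thus ?case using q_exp_drop[of 0] by simp
  next
    case (Suc n)
    hence "q_exp (6 * int (Suc n) + 6) c g" by (simp add: algebra_simps)
    from Suc.IH[OF q_exp_drop[OF this]] show ?case .
  qed
  hence q0: "q_exp 0 0 g" using c(2) m(1) by (metis gr0_implies_Suc)
  moreover have "S_law 0 0 g" using c(1) by (rule S_law_parity) simp
  ultimately obtain a where a: "\<And>\<tau>. \<tau> \<in> UH \<Longrightarrow> g \<tau> = a"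
    using scalar_form_weight_zero[of g] by (auto simp: scalar_form_def)
  have "q_exp 0 a g" using q_exp_const[of a] q_exp_cong[of g "\<lambda>\<tau>. a"] a by simp
  hence "a = 0" using q0 by (rule q_exp_coeff_unique)
  thus ?thesis using a[OF \<tau>] eta4_nonzero[OF \<tau>] by (simp add: g_def)
qed

lemma cusp_form_Delta_factor:
  assumes "S_law k 0 F" "q_exp 0 0 F"
  obtains H where "scalar_form (k - 12) 0 H" "\<And>\<tau>. \<tau> \<in> UH \<Longrightarrow> F \<tau> = Delta \<tau> * H \<tau>"
proof -
  have "scalar_form k 6 F"
    using scalar_form_raise[of k 0 F] assms by (auto simp: scalar_form_def)
  then obtain H where "scalar_form (k - 2 * 6) 0 H" "\<And>\<tau>. \<tau> \<in> UH \<Longrightarrow> F \<tau> = eta4 \<tau> powi 6 * H \<tau>"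
    by (rule scalar_form_eta4_factor) blast
  thus ?thesis using that eta4_power_6 by simp
qed

text \<open>The constant term vanishes, so \<open>Delta\<close> divides F and leaves a quotient of
  weight -10.\<close>

lemma scalar_form_weight_2:
  assumes F: "scalar_form 2 0 F" and \<tau>: "\<tau> \<in> UH"
  shows "F \<tau> = 0"
proof -
  obtain c where c: "S_law 2 0 F" "q_exp 0 c F" using F by (auto simp: scalar_form_def)
  hence "c = 0" by (rule scalar_form_weight_2_cusp)
  then obtain H where "scalar_form (2 - 12) 0 H" "\<And>\<tau>. \<tau> \<in> UH \<Longrightarrow> F \<tau> = Delta \<tau> * H \<tau>"
    using cusp_form_Delta_factor[of 2 F] c by auto
  thus ?thesis using scalar_form_negative_weight[of "- 10" H] \<tau> by simp
qed

lemma scalar_form_E4_E6: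
  "scalar_form (4 * int a + 6 * int b) 0 (\<lambda>\<tau>. E4 \<tau> ^ a * E6 \<tau> ^ b)"
  "q_exp 0 1 (\<lambda>\<tau>. E4 \<tau> ^ a * E6 \<tau> ^ b)"
proof -
  show "scalar_form (4 * int a + 6 * int b) 0 (\<lambda>\<tau>. E4 \<tau> ^ a * E6 \<tau> ^ b)"
    using scalar_form_mult[OF scalar_form_power[OF scalar_form_eisenstein(1), of a]
                              scalar_form_power[OF scalar_form_eisenstein(2), of b]]
    by (simp add: mult.commute)
  show "q_exp 0 1 (\<lambda>\<tau>. E4 \<tau> ^ a * E6 \<tau> ^ b)"
    using q_exp_mult[OF q_exp_power[OF eisenstein_forms(2), of a] q_exp_power[OF eisenstein_forms(4), of b]]
    by simp
qed

text \<open>Every even k \<ge> 4 is the weight of a monomial in \<open>E4\<close> and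
  \<open>E6\<close>, whose constant term is 1. Subtracting the right multiple leaves a cusp form,
  which \<open>Delta\<close> divides.\<close>

lemma level_one_decomposition:
  assumes F: "scalar_form k 0 F" and k: "k \<ge> 4" "even k"
  obtains a b c H where "4 * int a + 6 * int b = k" "scalar_form (k - 12) 0 H"
    "\<And>\<tau>. \<tau> \<in> UH \<Longrightarrow> F \<tau> = c * (E4 \<tau> ^ a * E6 \<tau> ^ b) + Delta \<tau> * H \<tau>"
proof -
  have "\<exists>a b. 4 * int a + 6 * int b = k"
  proof (cases "k mod 4 = 0")
    case True
    thus ?thesis using k by (intro exI[of _ "nat (k div 4)"] exI[of _ 0]) auto
  next
    case False
    hence "k mod 4 = 2" using k(2) by presburger
    hence "4 * ((k - 6) div 4) = k - 6" "(k - 6) div 4 \<ge> 0" using k by presburger+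
    hence "4 * int (nat ((k - 6) div 4)) + 6 * int 1 = k" by simp
    thus ?thesis by blast
  qed
  then obtain a b where ab: "4 * int a + 6 * int b = k" by blast
  define m where "m = (\<lambda>\<tau>. E4 \<tau> ^ a * E6 \<tau> ^ b)"
  have m: "S_law k 0 m" "q_exp 0 1 m"
    using scalar_form_E4_E6[of a b] ab by (auto simp: m_def scalar_form_def)
  obtain c where c: "S_law k 0 F" "q_exp 0 c F" using F by (auto simp: scalar_form_def)
  have "S_law k 0 (\<lambda>\<tau>. F \<tau> - c * m \<tau>)" using c m by (intro S_law_diff S_law_cmult)
  moreover have "q_exp 0 0 (\<lambda>\<tau>. F \<tau> - c * m \<tau>)" using q_exp_diff[OF c(2) q_exp_cmult[OF m(2), of c]] by simp
  ultimately obtain H where "scalar_form (k - 12) 0 H" "\<And>\<tau>. \<tau> \<in> UH \<Longrightarrow> F \<tau> - c * m \<tau> = Delta \<tau> * H \<tau>"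
    by (rule cusp_form_Delta_factor) blast
  thus ?thesis using that[OF ab, of H c] unfolding m_def by (simp add: algebra_simps)
qed

lemma E4E6_ring_diff: "f \<in> E4E6_ring \<Longrightarrow> g \<in> E4E6_ring \<Longrightarrow> (\<lambda>\<tau>. f \<tau> - g \<tau>) \<in> E4E6_ring"
  using E4E6_ring.add[OF _ E4E6_ring.mult[OF E4E6_ring.const[of "-1"]], of f g] by simp

lemma E4E6_ring_power: "f \<in> E4E6_ring \<Longrightarrow> (\<lambda>\<tau>. f \<tau> ^ n) \<in> E4E6_ring"
  by (induction n) (auto intro: E4E6_ring.intros)

lemma E4E6_ring_sum: "(\<And>i. i \<in> A \<Longrightarrow> f i \<in> E4E6_ring) \<Longrightarrow> (\<lambda>\<tau>. \<Sum>i\<in>A. f i \<tau>) \<in> E4E6_ring"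
  by (induction A rule: infinite_finite_induct) (auto intro: E4E6_ring.intros)

text \<open>Induction on the weight: \<open>level_one_decomposition\<close> lowers it by 12, and
  below weight 4 only constants survive. The equality is stated on UH since a scalar form is
  arbitrary elsewhere.\<close>

lemma scalar_form_imp_E4E6_ring:
  assumes "scalar_form k 0 F"
  obtains r where "r \<in> E4E6_ring" "\<And>\<tau>. \<tau> \<in> UH \<Longrightarrow> F \<tau> = r \<tau>"
proof -
  have "\<exists>r\<in>E4E6_ring. \<forall>\<tau>\<in>UH. F \<tau> = r \<tau>"
    using assms
  proof (induction "nat k" arbitrary: k F rule: less_induct)
    case less
    have zero: ?case if "\<And>\<tau>. \<tau> \<in> UH \<Longrightarrow> F \<tau> = 0"
      using that by (intro bexI[OF _ E4E6_ring.const[of 0]]) auto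
    have "k < 0 \<or> odd k \<or> k = 0 \<or> k = 2 \<or> (k \<ge> 4 \<and> even k)" by presburger
    then consider "k < 0" | "odd k" | "k = 0" | "k = 2" | "k \<ge> 4" "even k" by blast
    thus ?case
    proof cases
      case 1
      thus ?thesis using scalar_form_negative_weight[OF less.prems] zero by blast
    next
      case 2
      thus ?thesis using scalar_form_odd_weight[OF less.prems] zero by blast
    next
      case 3
      then obtain c where "\<And>\<tau>. \<tau> \<in> UH \<Longrightarrow> F \<tau> = c"
        using scalar_form_weight_zero[of F] less.prems by blast
      thus ?thesis by (intro bexI[OF _ E4E6_ring.const[of c]]) auto
    next
      case 4
      thus ?thesis using scalar_form_weight_2[of F] less.prems zero by blast
    next
      case 5
      obtain a b c H where H: "scalar_form (k - 12) 0 H"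
        "\<And>\<tau>. \<tau> \<in> UH \<Longrightarrow> F \<tau> = c * (E4 \<tau> ^ a * E6 \<tau> ^ b) + Delta \<tau> * H \<tau>"
        using level_one_decomposition[OF less.prems 5] by metis
      obtain r where r: "r \<in> E4E6_ring" "\<And>\<tau>. \<tau> \<in> UH \<Longrightarrow> H \<tau> = r \<tau>"
        using less.hyps[OF _ H(1)] 5 by auto
      have "(\<lambda>\<tau>. c * (E4 \<tau> ^ a * E6 \<tau> ^ b) + Delta \<tau> * r \<tau>) \<in> E4E6_ring"
        unfolding Delta_def by (intro E4E6_ring.intros E4E6_ring_diff E4E6_ring_power r(1))
      thus ?thesis using H(2) r(2) by (intro bexI[of _ "\<lambda>\<tau>. c * (E4 \<tau> ^ a * E6 \<tau> ^ b) + Delta \<tau> * r \<tau>"]) auto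
    qed
  qed
  thus ?thesis using that by blast
qed

text \<open>Outside weight 0 the monomial in \<open>level_one_decomposition\<close> contains
  \<open>E4\<close> or \<open>E6\<close>, and \<open>Delta\<close> itself lies in the ideal they
  generate. Weight 0 has to be excluded because of the constants, and this is the source of the
  failure of splitting.\<close>

lemma scalar_form_E4_E6_ideal:
  assumes F: "scalar_form k 0 F" and k: "k \<noteq> 0"
  obtains A B where "scalar_form (k - 4) 0 A" "scalar_form (k - 6) 0 B"
    "\<And>\<tau>. \<tau> \<in> UH \<Longrightarrow> F \<tau> = E4 \<tau> * A \<tau> + E6 \<tau> * B \<tau>"
proof -
  note decomp = that
  have zero: ?thesis if "\<And>\<tau>. \<tau> \<in> UH \<Longrightarrow> F \<tau> = 0"
    by (rule decomp[OF scalar_form_zero scalar_form_zero]) (simp add: that)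
  have "k < 0 \<or> odd k \<or> k = 2 \<or> (k \<ge> 4 \<and> even k)" using k by presburger
  then consider "k < 0" | "odd k" | "k = 2" | "k \<ge> 4" "even k" by blast
  thus ?thesis
  proof cases
    case 1
    thus ?thesis using scalar_form_negative_weight[OF F] zero by blast
  next
    case 2
    thus ?thesis using scalar_form_odd_weight[OF F] zero by blast
  next
    case 3
    thus ?thesis using scalar_form_weight_2[of F] F zero by blast
  next
    case 4
    obtain a b c H where ab: "4 * int a + 6 * int b = k" and H: "scalar_form (k - 12) 0 H"
      "\<And>\<tau>. \<tau> \<in> UH \<Longrightarrow> F \<tau> = c * (E4 \<tau> ^ a * E6 \<tau> ^ b) + Delta \<tau> * H \<tau>"
      using level_one_decomposition[OF F 4] by metis
    have A': "scalar_form (k - 4) 0 (\<lambda>\<tau>. E4 \<tau> ^ 2 * H \<tau>)"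
      using scalar_form_mult[OF scalar_form_power[OF scalar_form_eisenstein(1), of 2] H(1)] by simp
    have B': "scalar_form (k - 6) 0 (\<lambda>\<tau>. (- 1) * (E6 \<tau> * H \<tau>))"
      using scalar_form_cmult[OF scalar_form_mult[OF scalar_form_eisenstein(2) H(1)], of "- 1"] by simp
    have D: "Delta \<tau> * H \<tau> = E4 \<tau> * (E4 \<tau> ^ 2 * H \<tau>) + E6 \<tau> * ((- 1) * (E6 \<tau> * H \<tau>))" for \<tau>
      by (simp add: Delta_def algebra_simps power2_eq_square power3_eq_cube)
    show ?thesis
    proof (cases a)
      case (Suc a')
      have "scalar_form (k - 4) 0 (\<lambda>\<tau>. c * (E4 \<tau> ^ a' * E6 \<tau> ^ b))"
        proof -
        have "4 * int a' + 6 * int b = k - 4" using ab Suc by simp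
        thus ?thesis using scalar_form_cmult[OF scalar_form_E4_E6(1)[of a' b], of c] by simp
      qed
      from scalar_form_add[OF this A'] show ?thesis
        by (rule that[OF _ B']) (simp only: H(2) D Suc, simp add: algebra_simps)
    next
      case 0
      then obtain b' where b': "b = Suc b'" using ab 4 by (cases b) auto
      have "scalar_form (k - 6) 0 (\<lambda>\<tau>. c * (E4 \<tau> ^ a * E6 \<tau> ^ b'))"
        proof -
        have "4 * int a + 6 * int b' = k - 6" using ab b' by simp
        thus ?thesis using scalar_form_cmult[OF scalar_form_E4_E6(1)[of a b'], of c] by simp
      qed
      from scalar_form_add[OF this B'] show ?thesis
        by (rule that[OF A']) (simp only: H(2) D b', simp add: algebra_simps)
    qed
  qed
qed

section \<open>Primitives of expansions and the Eichler integrals\<close>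

lemma q_exp_primitive:
  assumes f: "q_exp x c f" and x: "\<And>n::nat. x + 6 * int n \<noteq> 0"
  obtains U where "\<And>\<tau>. \<tau> \<in> UH \<Longrightarrow> (U has_field_derivative f \<tau>) (at \<tau>)"
    "q_exp x (3 * c / (of_real pi * \<i> * of_int x)) U"
proof -
  obtain G where G: "G holomorphic_on ball 0 1" "G 0 = c" "\<And>\<tau>. \<tau> \<in> UH \<Longrightarrow> f \<tau> = qe (of_int x * \<tau> / 6) * G (qe \<tau>)"
    using f by (auto simp: q_exp_def)
  define a where "a = (\<lambda>n. (deriv ^^ n) G 0 / fact n)"
  have a: "(\<lambda>n. a n * q ^ n) sums G q" if "q \<in> ball 0 1" for q
    using holomorphic_power_series[OF G(1) that] by (simp add: a_def)
  \<comment> \<open>Termwise integration: differentiating q^(x/6 + n) in \<tau> multiplies it by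
    \<open>e n\<close>, which is nonzero by the assumption on x and has modulus at least 1, so
    division preserves convergence. Choosing no constant of integration keeps the expansion in
    powers q^(x/6 + n).\<close>
  define e where "e = (\<lambda>n. of_real pi * \<i> * of_int (x + 6 * int n) / 3 :: complex)"
  have e0: "e n \<noteq> 0" for n using x[of n] by (simp add: e_def del: of_int_add)
  define b where "b = (\<lambda>n. a n / e n)"
  have nb: "norm (b n) \<le> norm (a n)" for n
  proof -
    have "1 \<le> \<bar>real_of_int (x + 6 * int n)\<bar>" using x[of n] by linarith
    moreover have "1 \<le> pi / 3" using pi_bounds by simp
    ultimately have "1 * 1 \<le> pi / 3 * \<bar>real_of_int (x + 6 * int n)\<bar>" by (intro mult_mono) auto
    also have "\<dots> = norm (e n)" by (simp only: e_def norm_mult norm_divide norm_of_real norm_of_int) simp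
    finally have "1 \<le> norm (e n)" by simp
    hence "norm (a n) / norm (e n) \<le> norm (a n) / 1" by (intro divide_left_mono) auto
    thus ?thesis by (simp add: b_def norm_divide)
  qed
  have sb: "summable (\<lambda>n. b n * q ^ n)" if "norm q < 1" for q
  proof (rule summable_comparison_test'[of "\<lambda>n. norm (a n) * norm q ^ n" 0])
    define s where "s = (1 + norm q) / 2"
    have s: "norm q < s" "s < 1" "s > 0" using that by (simp_all add: s_def add_pos_nonneg)
    have "summable (\<lambda>n. a n * of_real s ^ n)" using a[of "of_real s"] s by (auto simp: sums_iff)
    hence "summable (\<lambda>n. norm (a n * q ^ n))" by (rule powser_insidea) (use s in auto)
    thus "summable (\<lambda>n. norm (a n) * norm q ^ n)" by (simp add: norm_mult norm_power)
    show "norm (b n * q ^ n) \<le> norm (a n) * norm q ^ n" for n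
      using nb[of n] by (auto simp: norm_mult norm_power intro: mult_right_mono)
  qed
  define H where "H = (\<lambda>q. \<Sum>n. b n * q ^ n)"
  define H' where "H' = (\<lambda>q. \<Sum>n. diffs b n * q ^ n)"
  have H: "(H has_field_derivative H' q) (at q)" if "norm q < 1" for q
    unfolding H_def H'_def by (rule termdiffs_strong'[of 1]) (use sb that in auto)
  have ode: "2 * of_real pi * \<i> * (of_int x / 6 * H q + H' q * q) = G q" if q: "norm q < 1" for q
  proof -
    have "summable (\<lambda>n. diffs b n * q ^ n)"
      using termdiff_converges[of q 1 b] sb q by auto
    from sums_mult2[OF diffs_equiv[OF this], of q]
    have 1: "(\<lambda>n. of_nat n * b n * q ^ (n - Suc 0) * q) sums (H' q * q)" by (simp add: H'_def)
    have "of_nat n * b n * q ^ (n - Suc 0) * q = of_nat n * b n * q ^ n" for n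
      by (cases n) (auto simp: mult_ac)
    with 1 have 1: "(\<lambda>n. of_nat n * b n * q ^ n) sums (H' q * q)" by simp
    have "(\<lambda>n. of_int x / 6 * (b n * q ^ n)) sums (of_int x / 6 * H q)"
      unfolding H_def by (intro sums_mult summable_sums sb q)
    from sums_mult[OF sums_add[OF this 1], of "2 * of_real pi * \<i>"]
    have "(\<lambda>n. 2 * of_real pi * \<i> * (of_int x / 6 * (b n * q ^ n) + of_nat n * b n * q ^ n)) sums
            (2 * of_real pi * \<i> * (of_int x / 6 * H q + H' q * q))" .
    also have "(\<lambda>n. 2 * of_real pi * \<i> * (of_int x / 6 * (b n * q ^ n) + of_nat n * b n * q ^ n)) =
               (\<lambda>n. a n * q ^ n)"
    proof
      fix n
      have "2 * of_real pi * \<i> * (of_int x / 6 * (b n * q ^ n) + of_nat n * b n * q ^ n) = e n * b n * q ^ n"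
        by (simp add: e_def field_simps)
      thus "2 * of_real pi * \<i> * (of_int x / 6 * (b n * q ^ n) + of_nat n * b n * q ^ n) = a n * q ^ n"
        using e0[of n] by (simp add: b_def)
    qed
    finally show ?thesis using a[of q] q sums_unique2 by auto
  qed
  define U where "U = (\<lambda>\<tau>. qe (of_int x * \<tau> / 6) * H (qe \<tau>))"
  show ?thesis
  proof (rule that[of U])
    fix \<tau> assume \<tau>: "\<tau> \<in> UH"
    have q: "norm (qe \<tau>) < 1" using qe_in_ball[OF \<tau>] by simp
    have 1: "((\<lambda>\<tau>. H (qe \<tau>)) has_field_derivative H' (qe \<tau>) * (2 * of_real pi * \<i> * 1 * qe \<tau>)) (at \<tau>)"
      by (rule DERIV_chain2[of H _ qe, OF H[OF q]]) (rule has_field_derivative_qe[OF DERIV_ident])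
    have 2: "((\<lambda>\<tau>. qe (of_int x * \<tau> / 6)) has_field_derivative
               (2 * of_real pi * \<i> * (of_int x / 6) * qe (of_int x * \<tau> / 6))) (at \<tau>)"
      by (rule has_field_derivative_qe) (auto intro!: derivative_eq_intros)
    have "(U has_field_derivative
            2 * of_real pi * \<i> * (of_int x / 6) * qe (of_int x * \<tau> / 6) * H (qe \<tau>) +
            H' (qe \<tau>) * (2 * of_real pi * \<i> * 1 * qe \<tau>) * qe (of_int x * \<tau> / 6)) (at \<tau>)"
      unfolding U_def by (rule DERIV_mult[OF 2 1])
    also have "2 * of_real pi * \<i> * (of_int x / 6) * qe (of_int x * \<tau> / 6) * H (qe \<tau>) +
            H' (qe \<tau>) * (2 * of_real pi * \<i> * 1 * qe \<tau>) * qe (of_int x * \<tau> / 6) =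
          qe (of_int x * \<tau> / 6) * (2 * of_real pi * \<i> * (of_int x / 6 * H (qe \<tau>) + H' (qe \<tau>) * qe \<tau>))"
      by (simp add: algebra_simps)
    also have "\<dots> = f \<tau>" using ode[OF q] G(3)[OF \<tau>] by simp
    finally show "(U has_field_derivative f \<tau>) (at \<tau>)" .
  next
    have "H holomorphic_on ball 0 1"
      unfolding holomorphic_on_open[OF open_ball] by (intro ballI, rule exI, rule H) simp
    moreover have "H 0 = b 0" by (simp add: H_def powser_zero)
    hence "H 0 = 3 * c / (of_real pi * \<i> * of_int x)"
      using G(2) by (simp add: b_def e_def a_def)
    ultimately show "q_exp x (3 * c / (of_real pi * \<i> * of_int x)) U"
      unfolding q_exp_def U_def by blast
  qed
qed

text \<open>\<open>U(-1/\<tau>) + U(\<tau>)\<close> is constant, and it can be scaled to \<open>1\<close> unless \<open>U\<close> is itself a form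
  of weight \<open>0\<close>.\<close>

lemma normalized_primitive:
  assumes f: "S_law 2 1 f" "q_exp x c f" and c: "c \<noteq> 0" and x: "\<And>n::nat. x + 6 * int n \<noteq> 0"
    and no_form: "\<And>U. S_law 0 1 U \<Longrightarrow> \<exists>c. q_exp x c U \<Longrightarrow> \<forall>\<tau>\<in>UH. U \<tau> = 0"
  shows "\<exists>U d. d \<noteq> 0 \<and> q_exp x d U \<and> (\<forall>\<tau>\<in>UH. U (- 1 / \<tau>) = 1 - U \<tau>)"
proof -
  obtain U where U: "\<And>\<tau>. \<tau> \<in> UH \<Longrightarrow> (U has_field_derivative f \<tau>) (at \<tau>)"
    "q_exp x (3 * c / (of_real pi * \<i> * of_int x)) U"
    by (rule q_exp_primitive[OF f(2) x]) blast
  define d where "d = 3 * c / (of_real pi * \<i> * of_int x)"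
  have d: "d \<noteq> 0" "q_exp x d U" using x[of 0] c U(2) by (auto simp: d_def)
  have "((\<lambda>\<tau>. U (- 1 / \<tau>) + U \<tau>) has_field_derivative 0) (at \<tau>)" if "\<tau> \<in> UH" for \<tau>
  proof -
    have "f (- 1 / \<tau>) / \<tau>\<^sup>2 + f \<tau> = 0"
      using f(1) that UH_nonzero[OF that] by (auto simp: S_law_def power_int_def)
    thus ?thesis
      using DERIV_add[OF S_derivative[OF that U(1)[OF S_in_UH[OF that]]] U(1)[OF that]] by simp
  qed
  then obtain a where a: "\<And>\<tau>. \<tau> \<in> UH \<Longrightarrow> U (- 1 / \<tau>) + U \<tau> = a"
    using constant_on_UH[of "\<lambda>\<tau>. U (- 1 / \<tau>) + U \<tau>"] by blast
  have "a \<noteq> 0"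
  proof
    assume "a = 0"
    hence "S_law 0 1 U" using a by (auto simp: S_law_def eq_neg_iff_add_eq_0)
    hence "\<forall>\<tau>\<in>UH. U \<tau> = 0" using no_form d(2) by blast
    thus False using q_exp_nontrivial[OF d(2,1)] by blast
  qed
  show ?thesis
  proof (intro exI conjI ballI)
    show "q_exp x (1 / a * d) (\<lambda>\<tau>. 1 / a * U \<tau>)" using d(2) by (rule q_exp_cmult)
    show "1 / a * U (- 1 / \<tau>) = 1 - 1 / a * U \<tau>" if "\<tau> \<in> UH" for \<tau>
      using a[OF that] \<open>a \<noteq> 0\<close> by (simp add: field_simps eq_diff_eq)
  qed (use d \<open>a \<noteq> 0\<close> in auto)
qed

text \<open>Up to scaling \<open>eich (-1)\<close> and \<open>eich 1\<close> are the primitives of \<open>\<eta>\<^sup>4\<close> and \<open>E4 / \<eta>\<^sup>4\<close>: an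
  abelian integral \<open>u\<close> of the first kind and \<open>\<zeta>(u)\<close> on the elliptic curve uniformized by the
  commutator subgroup of \<open>\<Gamma>\<close>.  The argument is the exponent \<open>d\<close> for which multiplication maps
  functions of type \<open>q\<^bsup>x/6\<^esup>\<close> to functions of type \<open>q\<^bsup>(x-d)/6\<^esup>\<close>.\<close>

lemma eich_exists:
  "\<exists>U d. d \<noteq> 0 \<and> q_exp 1 d U \<and> (\<forall>\<tau>\<in>UH. U (- 1 / \<tau>) = 1 - U \<tau>)"
  "\<exists>U d. d \<noteq> 0 \<and> q_exp (- 1) d U \<and> (\<forall>\<tau>\<in>UH. U (- 1 / \<tau>) = 1 - U \<tau>)"
proof -
  obtain c where c: "S_law 2 1 eta4" "c \<noteq> 0" "q_exp 1 c eta4" "q_exp (- 1) (inverse c) (\<lambda>\<tau>. inverse (eta4 \<tau>))"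
    using eta4_properties by metis
  show "\<exists>U d. d \<noteq> 0 \<and> q_exp 1 d U \<and> (\<forall>\<tau>\<in>UH. U (- 1 / \<tau>) = 1 - U \<tau>)"
  proof (rule normalized_primitive[OF c(1,3,2)])
    \<comment> \<open>Such a U would be \<open>eta4\<close> times a form of weight -2.\<close>
    fix U assume "S_law 0 1 U" "\<exists>c. q_exp 1 c U"
    hence "scalar_form 0 1 U" by (simp add: scalar_form_def)
    then obtain r where "scalar_form (- 2) 0 r" "\<And>\<tau>. \<tau> \<in> UH \<Longrightarrow> U \<tau> = eta4 \<tau> powi 1 * r \<tau>"
      using scalar_form_eta4_factor by (metis diff_0 mult_1_right)
    thus "\<forall>\<tau>\<in>UH. U \<tau> = 0" using scalar_form_negative_weight[of "- 2" r] by simp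
  qed presburger
  have E: "q_exp (- 1) (1 * inverse c) (\<lambda>\<tau>. E4 \<tau> * inverse (eta4 \<tau>))"
    using q_exp_mult[OF eisenstein_forms(2) c(4)] by simp
  have "S_law 2 (- 1) (\<lambda>\<tau>. E4 \<tau> * inverse (eta4 \<tau>))"
    using S_law_mult[OF eisenstein_forms(1) S_law_inverse[OF c(1)]] by simp
  hence S: "S_law 2 1 (\<lambda>\<tau>. E4 \<tau> * inverse (eta4 \<tau>))" by (rule S_law_parity) simp
  show "\<exists>U d. d \<noteq> 0 \<and> q_exp (- 1) d U \<and> (\<forall>\<tau>\<in>UH. U (- 1 / \<tau>) = 1 - U \<tau>)"
  proof (rule normalized_primitive[OF S E])
    \<comment> \<open>Here U would be a form of weight 2 divided by \<open>eta4\<close>. The absence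
      of forms of weight 2 thus makes the period of the second integral nonzero.\<close>
    fix U assume U: "S_law 0 1 U" "\<exists>c. q_exp (- 1) c U"
    have "S_law 0 (- 1) U" using U(1) by (rule S_law_parity) simp
    hence "scalar_form 0 (- 1) U" using U(2) by (simp add: scalar_form_def)
    then obtain r where "scalar_form 2 0 r" "\<And>\<tau>. \<tau> \<in> UH \<Longrightarrow> U \<tau> = eta4 \<tau> powi (- 1) * r \<tau>"
      using scalar_form_eta4_factor[of 0 "- 1" U] by auto
    thus "\<forall>\<tau>\<in>UH. U \<tau> = 0" using scalar_form_weight_2[of r] by simp
  qed (use c(2) in auto, presburger)
qed

definition eich :: "int \<Rightarrow> complex \<Rightarrow> complex" where
  "eich d = (SOME U. \<exists>c. c \<noteq> 0 \<and> q_exp (- d) c U \<and> (\<forall>\<tau>\<in>UH. U (- 1 / \<tau>) = 1 - U \<tau>))"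

lemma eich_properties:
  assumes "d \<in> {1, - 1}"
  shows "\<exists>c. c \<noteq> 0 \<and> q_exp (- d) c (eich d)" and "\<tau> \<in> UH \<Longrightarrow> eich d (- 1 / \<tau>) = 1 - eich d \<tau>"
proof -
  have "\<exists>U c. c \<noteq> 0 \<and> q_exp (- d) c U \<and> (\<forall>\<tau>\<in>UH. U (- 1 / \<tau>) = 1 - U \<tau>)"
  proof (cases "d = 1")
    case False
    hence "d = - 1" using assms by simp
    thus ?thesis using eich_exists(1) by (simp only: minus_minus)
  qed (use eich_exists(2) in \<open>simp only:\<close>)
  from someI_ex[OF this] show "\<exists>c. c \<noteq> 0 \<and> q_exp (- d) c (eich d)"
    and "\<tau> \<in> UH \<Longrightarrow> eich d (- 1 / \<tau>) = 1 - eich d \<tau>"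
    unfolding eich_def by blast+
qed

text \<open>\<open>E4\<close> and \<open>E6\<close> have constant term 1, so both products with
  \<open>eich 1\<close> share the leading coefficient of \<open>eich 1\<close>, and both quotients
  share that of 1/\<open>eta4\<close>. A single constant therefore serves both differences.
  Cancelling the term of order -1 raises the order to 5.\<close>

lemma eich_pole_cancellation:
  obtains c where "c \<noteq> 0"
    "\<exists>a. q_exp 5 a (\<lambda>\<tau>. E4 \<tau> * eich 1 \<tau> - c * (E6 \<tau> * inverse (eta4 \<tau>)))"
    "\<exists>a. q_exp 5 a (\<lambda>\<tau>. E6 \<tau> * eich 1 \<tau> - c * (E4 \<tau> ^ 2 * inverse (eta4 \<tau>)))"
proof -
  obtain e where e: "e \<noteq> 0" "q_exp (- 1) (inverse e) (\<lambda>\<tau>. inverse (eta4 \<tau>))"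
    using eta4_properties by metis
  obtain d where d: "d \<noteq> 0" "q_exp (- 1) d (eich 1)" using eich_properties(1)[of 1] by auto
  have 1: "q_exp (- 1) d (\<lambda>\<tau>. E4 \<tau> * eich 1 \<tau>)" "q_exp (- 1) d (\<lambda>\<tau>. E6 \<tau> * eich 1 \<tau>)"
    "q_exp (- 1) (inverse e) (\<lambda>\<tau>. E6 \<tau> * inverse (eta4 \<tau>))"
    "q_exp (- 1) (inverse e) (\<lambda>\<tau>. E4 \<tau> ^ 2 * inverse (eta4 \<tau>))"
    using q_exp_mult[OF eisenstein_forms(2) d(2)] q_exp_mult[OF eisenstein_forms(4) d(2)]
      q_exp_mult[OF eisenstein_forms(4) e(2)]
      q_exp_mult[OF q_exp_power[OF eisenstein_forms(2), of 2] e(2)] by auto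
  have 0: "d - d * e * inverse e = 0" using e(1) by simp
  show ?thesis
  proof (rule that[of "d * e"])
    show "\<exists>a. q_exp 5 a (\<lambda>\<tau>. E4 \<tau> * eich 1 \<tau> - d * e * (E6 \<tau> * inverse (eta4 \<tau>)))"
      using q_exp_raise[of "- 1"] q_exp_diff[OF 1(1) q_exp_cmult[OF 1(3), of "d * e"], unfolded 0] by simp
    show "\<exists>a. q_exp 5 a (\<lambda>\<tau>. E6 \<tau> * eich 1 \<tau> - d * e * (E4 \<tau> ^ 2 * inverse (eta4 \<tau>)))"
      using q_exp_raise[of "- 1"] q_exp_diff[OF 1(2) q_exp_cmult[OF 1(4), of "d * e"], unfolded 0] by simp
  qed (use d e in auto)
qed

section \<open>Representations and exponents\<close>

lemmas mat2_simps = matrix_matrix_mult_def vec_eq_iff forall_2 sum_2 vector_2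

lemma S_in_SL2Z: "S_mat \<in> SL2Z" and T_in_SL2Z: "T_mat \<in> SL2Z"
  by (simp_all add: SL2Z_def S_mat_def T_mat_def det_2 vector_2)

lemma one_in_SL2Z: "mat 1 \<in> SL2Z"
  by (simp add: SL2Z_def)

lemma SL2Z_mult: "A \<in> SL2Z \<Longrightarrow> B \<in> SL2Z \<Longrightarrow> A ** B \<in> SL2Z"
  unfolding SL2Z_def mem_Collect_eq det_mul by simp

text \<open>The product T^n A for any integer n, written out so that negative n cause no
  trouble.\<close>

definition T_shift :: "int \<Rightarrow> int^2^2 \<Rightarrow> int^2^2" where
  "T_shift n A = vector [vector [A$1$1 + n * A$2$1, A$1$2 + n * A$2$2], vector [A$2$1, A$2$2]]"

text \<open>Euclid's algorithm on the first column: a power of T reduces the upper entry modulo the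
  lower one, and S exchanges them up to sign. The rule offers only multiplication by S and T, so
  their inverses are expressed as T^(-1) = S^3 T S T S and S^(-1) = S^3. When the lower entry is 0,
  the matrix is T^n or S^2 T^n.\<close>

lemma SL2Z_induct [consumes 1, case_names one S T]:
  assumes A: "A \<in> SL2Z"
    and one: "P (mat 1)"
    and S: "\<And>A. A \<in> SL2Z \<Longrightarrow> P A \<Longrightarrow> P (S_mat ** A)"
    and T: "\<And>A. A \<in> SL2Z \<Longrightarrow> P A \<Longrightarrow> P (T_mat ** A)"
  shows "P A"
proof -
  have T1: "T_shift 1 A = T_mat ** A" for A
    by (simp add: T_shift_def T_mat_def mat2_simps)
  have T2: "T_shift (- 1) A = S_mat ** (S_mat ** (S_mat ** (T_mat ** (S_mat ** (T_mat ** (S_mat ** A))))))" for A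
    by (simp add: T_shift_def T_mat_def S_mat_def mat2_simps)
  have S4: "A = S_mat ** (S_mat ** (S_mat ** (S_mat ** A)))" for A
    by (simp add: S_mat_def mat2_simps)
  have add: "T_shift m (T_shift n A) = T_shift (m + n) A" for m n A
    by (simp add: T_shift_def mat2_simps algebra_simps)
  have shift0: "T_shift 0 A = A" for A by (simp add: T_shift_def mat2_simps)
  have SL: "T_shift n A \<in> SL2Z" if "A \<in> SL2Z" for n A
    using that by (simp add: SL2Z_def T_shift_def det_2 algebra_simps)
  have shift: "P (T_shift n A)" if "A \<in> SL2Z" "P A" for n A
  proof (induction n rule: int_induct[where k = 0])
    case base
    thus ?case using that by (simp add: shift0)
  next
    case (step1 i)
    have "P (T_shift 1 (T_shift i A))" unfolding T1 by (rule T[OF SL[OF that(1)] step1(2)])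
    thus ?case unfolding add by (simp only: add.commute)
  next
    case (step2 i)
    have "P (T_shift (- 1) (T_shift i A))"
      unfolding T2 by (intro S T SL2Z_mult S_in_SL2Z T_in_SL2Z SL[OF that(1)] step2)
    thus ?case unfolding add by simp
  qed
  show ?thesis using A
  proof (induction "nat \<bar>A$2$1\<bar>" arbitrary: A rule: less_induct)
    case less
    have det: "A$1$1 * A$2$2 - A$1$2 * A$2$1 = 1" using less.prems by (simp add: SL2Z_def det_2)
    show ?case
    proof (cases "A$2$1 = 0")
      case True
      hence "A$1$1 * A$2$2 = 1" using det by simp
      then consider "A$1$1 = 1" "A$2$2 = 1" | "A$1$1 = -1" "A$2$2 = -1"
        using zmult_eq_1_iff by blast
      thus ?thesis
      proof cases
        case 1
        hence "A = T_shift (A$1$2) (mat 1)" using True by (simp add: T_shift_def mat2_simps mat_def)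
        thus ?thesis using shift[OF one_in_SL2Z one] by metis
      next
        case 2
        hence "A = T_shift (- A$1$2) (S_mat ** (S_mat ** mat 1))"
          using True by (simp add: T_shift_def S_mat_def mat2_simps mat_def)
        thus ?thesis using shift S S_in_SL2Z SL2Z_mult one_in_SL2Z one by metis
      qed
    next
      case False
      define n where "n = A$1$1 div A$2$1"
      define B where "B = T_shift (- n) A"
      have B: "B \<in> SL2Z" unfolding B_def by (rule SL[OF less.prems])
      have "(S_mat ** B)$2$1 = A$1$1 mod A$2$1"
        by (simp add: B_def S_mat_def T_shift_def mat2_simps n_def minus_div_mult_eq_mod[symmetric])
      hence "nat \<bar>(S_mat ** B)$2$1\<bar> < nat \<bar>A$2$1\<bar>"
        using abs_mod_less[OF False, of "A$1$1"] by simp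
      hence "P (S_mat ** B)" using less.hyps SL2Z_mult[OF S_in_SL2Z B] by blast
      hence "P B" using S S_in_SL2Z SL2Z_mult B S4[of B] by metis
      moreover have "A = T_shift n B" by (simp add: B_def add shift0)
      ultimately show ?thesis using shift[OF B] by metis
    qed
  qed
qed

section \<open>From S and T to the whole group\<close>

definition automorphy :: "int^2^2 \<Rightarrow> complex \<Rightarrow> complex" where
  "automorphy \<gamma> \<tau> = of_int (\<gamma>$2$1) * \<tau> + of_int (\<gamma>$2$2)"

lemma moebius_simps:
  "moebius S_mat \<tau> = - 1 / \<tau>" "moebius T_mat \<tau> = \<tau> + 1" "moebius (mat 1) \<tau> = \<tau>" "moebius (- mat 1) \<tau> = \<tau>"
  "automorphy S_mat \<tau> = \<tau>" "automorphy T_mat \<tau> = 1" "automorphy (mat 1) \<tau> = 1" "automorphy (- mat 1) \<tau> = -1"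
  by (simp_all add: moebius_def automorphy_def S_mat_def T_mat_def mat_def vector_2)

lemma automorphy_nonzero:
  assumes "\<gamma> \<in> SL2Z" "\<tau> \<in> UH"
  shows "automorphy \<gamma> \<tau> \<noteq> 0"
proof
  assume 0: "automorphy \<gamma> \<tau> = 0"
  hence "Im (automorphy \<gamma> \<tau>) = 0" by simp
  hence "\<gamma>$2$1 = 0" using assms(2) by (simp add: automorphy_def)
  thus False using 0 assms(1) by (auto simp: automorphy_def SL2Z_def det_2)
qed

lemma moebius_mult:
  assumes "B \<in> SL2Z" "\<tau> \<in> UH"
  shows "moebius (S_mat ** B) \<tau> = - 1 / moebius B \<tau>" "moebius (T_mat ** B) \<tau> = moebius B \<tau> + 1"
    "automorphy (S_mat ** B) \<tau> = moebius B \<tau> * automorphy B \<tau>" "automorphy (T_mat ** B) \<tau> = automorphy B \<tau>"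
proof -
  define n where "n = of_int (B$1$1) * \<tau> + of_int (B$1$2)"
  have j: "automorphy B \<tau> \<noteq> 0" by (rule automorphy_nonzero[OF assms])
  have B: "moebius B \<tau> = n / automorphy B \<tau>" by (simp add: moebius_def automorphy_def n_def)
  have S: "(S_mat ** B)$1$1 = - B$2$1" "(S_mat ** B)$1$2 = - B$2$2"
    "(S_mat ** B)$2$1 = B$1$1" "(S_mat ** B)$2$2 = B$1$2"
    and T: "(T_mat ** B)$1$1 = B$1$1 + B$2$1" "(T_mat ** B)$1$2 = B$1$2 + B$2$2"
    "(T_mat ** B)$2$1 = B$2$1" "(T_mat ** B)$2$2 = B$2$2"
    by (simp_all add: S_mat_def T_mat_def mat2_simps)
  have "moebius (S_mat ** B) \<tau> = - automorphy B \<tau> / n"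
    unfolding moebius_def S by (simp add: automorphy_def n_def)
  thus "moebius (S_mat ** B) \<tau> = - 1 / moebius B \<tau>" by (simp add: B)
  have "moebius (T_mat ** B) \<tau> = (n + automorphy B \<tau>) / automorphy B \<tau>"
    unfolding moebius_def T by (simp add: automorphy_def n_def algebra_simps)
  thus "moebius (T_mat ** B) \<tau> = moebius B \<tau> + 1" using j by (simp add: B add_divide_distrib)
  show "automorphy (T_mat ** B) \<tau> = automorphy B \<tau>" by (simp add: automorphy_def T)
  have "automorphy (S_mat ** B) \<tau> = n" by (simp add: automorphy_def S n_def)
  thus "automorphy (S_mat ** B) \<tau> = moebius B \<tau> * automorphy B \<tau>" using j by (simp add: B)
qed

lemma moebius_in_UH:
  assumes "\<gamma> \<in> SL2Z" "\<tau> \<in> UH"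
  shows "moebius \<gamma> \<tau> \<in> UH"
  using assms(1)
proof (induction rule: SL2Z_induct)
  case (S A)
  thus ?case using moebius_mult(1)[OF S(1) assms(2)] S_in_UH[OF S(2)] by simp
next
  case (T A)
  thus ?case using moebius_mult(2)[OF T(1) assms(2)] by simp
qed (use assms(2) moebius_simps in auto)

lemma SL2Z_rep_mult: "SL2Z_rep \<rho> \<Longrightarrow> A \<in> SL2Z \<Longrightarrow> B \<in> SL2Z \<Longrightarrow> \<rho> (A ** B) = \<rho> A ** \<rho> B"
  and SL2Z_rep_one: "SL2Z_rep \<rho> \<Longrightarrow> \<rho> (mat 1) = mat 1"
  by (auto simp: SL2Z_rep_def)

lemma SL2Z_transformation:
  fixes \<rho> :: "int^2^2 \<Rightarrow> complex^'n^'n"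
  assumes rep: "SL2Z_rep \<rho>"
    and S: "\<And>\<tau>. \<tau> \<in> UH \<Longrightarrow> F (- 1 / \<tau>) = \<tau> powi k *s (\<rho> S_mat *v F \<tau>)"
    and T: "\<And>\<tau>. \<tau> \<in> UH \<Longrightarrow> F (\<tau> + 1) = \<rho> T_mat *v F \<tau>"
    and \<gamma>: "\<gamma> \<in> SL2Z" and \<tau>: "\<tau> \<in> UH"
  shows "F (moebius \<gamma> \<tau>) = automorphy \<gamma> \<tau> powi k *s (\<rho> \<gamma> *v F \<tau>)"
  using \<gamma>
proof (induction rule: SL2Z_induct)
  case one
  thus ?case using SL2Z_rep_one[OF rep] by (simp add: moebius_simps)
next
  case (S A)
  note A = S
  show ?case
    unfolding moebius_mult(1)[OF A(1) \<tau>] assms(2)[OF moebius_in_UH[OF A(1) \<tau>]] A(2)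
      moebius_mult(3)[OF A(1) \<tau>] SL2Z_rep_mult[OF rep S_in_SL2Z A(1)]
    by (simp add: vec.scale power_int_mult_distrib matrix_vector_mul_assoc)
next
  case (T A)
  note A = T
  show ?case
    unfolding moebius_mult(2)[OF A(1) \<tau>] assms(3)[OF moebius_in_UH[OF A(1) \<tau>]] A(2)
      moebius_mult(4)[OF A(1) \<tau>] SL2Z_rep_mult[OF rep T_in_SL2Z A(1)]
    by (simp add: vec.scale matrix_vector_mul_assoc)
qed

text \<open>This replaces a presentation of \<^const>\<open>SL2Z\<close> in the construction of representations: the
  relations hold automatically in an action on functions.\<close>

lemma rep_from_functions:
  fixes \<Phi> :: "complex \<Rightarrow> complex^'n" and S' T' :: "complex^'n^'n"
  assumes S: "\<And>\<tau>. \<tau> \<in> UH \<Longrightarrow> \<Phi> (- 1 / \<tau>) = \<tau> powi k *s (S' *v \<Phi> \<tau>)"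
    and T: "\<And>\<tau>. \<tau> \<in> UH \<Longrightarrow> \<Phi> (\<tau> + 1) = T' *v \<Phi> \<tau>"
    and k: "even k"
    and indep: "\<And>M N :: complex^'n^'n. \<forall>\<tau>\<in>UH. M *v \<Phi> \<tau> = N *v \<Phi> \<tau> \<Longrightarrow> M = N"
  shows "\<exists>\<rho>. PSL2Z_rep \<rho> \<and> \<rho> S_mat = S' \<and> \<rho> T_mat = T'"
proof -
  define acts where "acts = (\<lambda>\<gamma> M. \<forall>\<tau>\<in>UH. \<Phi> (moebius \<gamma> \<tau>) = automorphy \<gamma> \<tau> powi k *s (M *v \<Phi> \<tau>))"
  have acts_unique: "M = N" if "\<gamma> \<in> SL2Z" "acts \<gamma> M" "acts \<gamma> N" for \<gamma> M N
  proof (rule indep, rule ballI)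
    fix \<tau> assume \<tau>: "\<tau> \<in> UH"
    have "automorphy \<gamma> \<tau> powi k *s (M *v \<Phi> \<tau>) = automorphy \<gamma> \<tau> powi k *s (N *v \<Phi> \<tau>)"
      using that(2,3) \<tau> unfolding acts_def by metis
    thus "M *v \<Phi> \<tau> = N *v \<Phi> \<tau>" using automorphy_nonzero[OF that(1) \<tau>] by simp
  qed
  have acts_S: "acts (S_mat ** A) (S' ** M)" and acts_T: "acts (T_mat ** A) (T' ** M)"
    if "A \<in> SL2Z" "acts A M" for A M
    unfolding acts_def using that
    by (auto simp: moebius_mult S T moebius_in_UH acts_def vec.scale power_int_mult_distrib
          matrix_vector_mul_assoc simp del: UH_iff divide_minus_left)
  \<comment> \<open>Evenness of k enters here: minus the identity acts trivially on functions, so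
    the representation factors through the quotient by it.\<close>
  have acts_one: "acts (mat 1) (mat 1)" "acts (- mat 1) (mat 1)"
    using k by (auto simp: acts_def moebius_simps power_int_minus_left)
  have ex: "\<exists>M. acts A M" if "A \<in> SL2Z" for A
    using that by (induction rule: SL2Z_induct) (use acts_S acts_T acts_one in blast)+
  define \<rho> where "\<rho> = (\<lambda>A. SOME M. acts A M)"
  have \<rho>: "acts A (\<rho> A)" if "A \<in> SL2Z" for A
    unfolding \<rho>_def using someI_ex[OF ex[OF that]] .
  have eq: "\<rho> A = M" if "A \<in> SL2Z" "acts A M" for A M
    using acts_unique[OF that(1) \<rho>[OF that(1)] that(2)] .
  have S_eq: "\<rho> (S_mat ** A) = S' ** \<rho> A" and T_eq: "\<rho> (T_mat ** A) = T' ** \<rho> A" if "A \<in> SL2Z" for A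
    by (rule eq[OF SL2Z_mult[OF S_in_SL2Z that] acts_S[OF that \<rho>[OF that]]],
        rule eq[OF SL2Z_mult[OF T_in_SL2Z that] acts_T[OF that \<rho>[OF that]]])
  have one: "\<rho> (mat 1) = mat 1" by (rule eq[OF one_in_SL2Z acts_one(1)])
  have "\<rho> (A ** B) = \<rho> A ** \<rho> B" if "A \<in> SL2Z" "B \<in> SL2Z" for A B
    using that(1)
  proof (induction rule: SL2Z_induct)
    case (S A)
    have "\<rho> (S_mat ** (A ** B)) = S' ** \<rho> (A ** B)" by (rule S_eq[OF SL2Z_mult[OF S(1) that(2)]])
    thus ?case using S S_eq[OF S(1)] by (simp add: matrix_mul_assoc)
  next
    case (T A)
    have "\<rho> (T_mat ** (A ** B)) = T' ** \<rho> (A ** B)" by (rule T_eq[OF SL2Z_mult[OF T(1) that(2)]])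
    thus ?case using T T_eq[OF T(1)] by (simp add: matrix_mul_assoc)
  qed (simp add: one)
  moreover have "- mat 1 \<in> SL2Z" by (simp add: SL2Z_def det_2 mat_def)
  hence "\<rho> (- mat 1) = mat 1" using eq[OF _ acts_one(2)] by simp
  moreover have "\<rho> S_mat = S'" "\<rho> T_mat = T'"
    using S_eq[OF one_in_SL2Z] T_eq[OF one_in_SL2Z] one by simp_all
  ultimately show ?thesis using one unfolding PSL2Z_rep_def SL2Z_rep_def by blast
qed

section \<open>Diagonal matrices and the exponent matrix\<close>

definition diag_mat :: "('n \<Rightarrow> complex) \<Rightarrow> complex^'n^'n" where
  "diag_mat d = (\<chi> i j. if i = j then d i else 0)"

lemma diag_mat_mult_left: "(diag_mat d ** A) $ i $ j = d i * A $ i $ j"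
  by (simp add: diag_mat_def matrix_matrix_mult_def if_distrib[of "\<lambda>x. x * _"] cong: if_cong)

lemma diag_mat_mult_right: "(A ** diag_mat d) $ i $ j = A $ i $ j * d j"
  by (simp add: diag_mat_def matrix_matrix_mult_def if_distrib[of "\<lambda>x. _ * x"] cong: if_cong)

lemma diag_mat_vector: "(diag_mat d *v v) $ i = d i * v $ i"
  by (simp add: diag_mat_def matrix_vector_mult_def if_distrib[of "\<lambda>x. x * _"] cong: if_cong)

lemma mat_eq_diag_mat: "mat c = diag_mat (\<lambda>_. c)"
  by (simp add: mat_def diag_mat_def)

lemma mat_times_diag_mat: "mat c ** diag_mat d = diag_mat (\<lambda>i. c * d i)"
  by (simp add: mat_eq_diag_mat vec_eq_iff diag_mat_mult_left) (simp add: diag_mat_def)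

lemma matrix_exp_diag_mat: "matrix_exp (diag_mat d :: complex^'n^'n) = diag_mat (\<lambda>i. exp (d i))"
proof -
  have pow: "((**) (diag_mat d) ^^ k) (mat 1) = (diag_mat (\<lambda>i. d i ^ k) :: complex^'n^'n)" for k
    by (induction k) (simp_all add: mat_eq_diag_mat vec_eq_iff diag_mat_mult_left, simp_all add: diag_mat_def)
  have "(\<lambda>k. (1 / fact k) *\<^sub>R ((**) (diag_mat d) ^^ k) (mat 1)) sums (diag_mat (\<lambda>i. exp (d i)) :: complex^'n^'n)"
    unfolding pow sums_def
  proof (intro vec_tendstoI)
    fix i j :: 'n
    have "(\<lambda>n. (\<Sum>k<n. d i ^ k /\<^sub>R fact k)) \<longlonglongrightarrow> exp (d i)"
      using exp_converges[of "d i"] by (simp add: sums_def)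
    thus "(\<lambda>n. (\<Sum>k<n. (1 / fact k) *\<^sub>R (diag_mat (\<lambda>i. d i ^ k) :: complex^'n^'n)) $ i $ j) \<longlonglongrightarrow>
            diag_mat (\<lambda>i. exp (d i)) $ i $ j"
      by (cases "i = j") (simp_all add: diag_mat_def divide_inverse)
  qed
  thus ?thesis unfolding matrix_exp_def by (simp add: sums_iff)
qed

text \<open>Serves the uniqueness of the exponent matrix: a logarithm of \<rho>(T) commutes with
  \<rho>(T).\<close>

lemma matrix_exp_commute:
  fixes L M :: "complex^'n^'n"
  assumes "L ** M = M ** L"
  shows "L ** matrix_exp M = matrix_exp M ** L"
proof -
  let ?mm = "(**) :: complex^'n^'n \<Rightarrow> complex^'n^'n \<Rightarrow> complex^'n^'n"
  have lin1: "linear (\<lambda>X. A ** X)" and lin2: "linear (\<lambda>X. X ** A)" for A :: "complex^'n^'n"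
    by (rule linearI; simp add: matrix_matrix_mult_def vec_eq_iff sum.distrib distrib_left distrib_right
          scaleR_sum_right)+
  have "bilinear ?mm" unfolding bilinear_def using lin1 lin2 by blast
  \<comment> \<open>The constant K stands in for submultiplicativity of the norm and makes the
    exponential series comparable with a scalar one.\<close>
  then obtain K where K: "\<And>A B. norm (?mm A B) \<le> K * norm A * norm B"
    using bilinear_bounded by blast
  define t where "t = (\<lambda>k. (1 / fact k) *\<^sub>R (((**) M ^^ k) (mat 1)))"
  have comm: "L ** t k = t k ** L" for k
  proof -
    have "L ** ((**) M ^^ k) (mat 1) = ((**) M ^^ k) (mat 1) ** L"
    proof (induction k)
      case (Suc k)
      thus ?case using assms by (simp add: matrix_mul_assoc) (simp flip: matrix_mul_assoc)
    qed simp
    thus ?thesis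
      unfolding t_def by (simp only: linear_scale[OF lin1, of L] linear_scale[OF lin2, of _ _ L])
  qed
  have bound: "norm (((**) M ^^ k) (mat 1)) \<le> norm (mat 1 :: complex^'n^'n) * (\<bar>K\<bar> * norm M) ^ k" for k
  proof (induction k)
    case (Suc k)
    have "norm (((**) M ^^ Suc k) (mat 1)) \<le> K * norm M * norm (((**) M ^^ k) (mat 1))"
      using K by simp
    also have "\<dots> \<le> \<bar>K\<bar> * norm M * (norm (mat 1 :: complex^'n^'n) * (\<bar>K\<bar> * norm M) ^ k)"
      using Suc by (intro mult_mono) auto
    finally show ?case by (simp add: mult_ac)
  qed simp
  have "summable t"
  proof (rule summable_comparison_test')
    show "summable (\<lambda>k. norm (mat 1 :: complex^'n^'n) * (inverse (fact k) * (\<bar>K\<bar> * norm M) ^ k))"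
      by (intro summable_mult summable_exp)
    show "norm (t k) \<le> norm (mat 1 :: complex^'n^'n) * (inverse (fact k) * (\<bar>K\<bar> * norm M) ^ k)" for k
      using bound[of k] by (simp add: t_def field_simps)
  qed
  hence t: "t sums matrix_exp M" unfolding matrix_exp_def t_def by (rule summable_sums)
  have "(\<lambda>k. L ** t k) sums (L ** matrix_exp M)" "(\<lambda>k. t k ** L) sums (matrix_exp M ** L)"
    using bounded_linear.sums[OF linear_conv_bounded_linear[THEN iffD1, OF lin1] t]
          bounded_linear.sums[OF linear_conv_bounded_linear[THEN iffD1, OF lin2] t] by auto
  thus ?thesis unfolding comm by (rule sums_unique2)
qed

text \<open>A competing L commutes with a diagonal matrix whose entries are distinct, so it is
  diagonal. Each entry is then determined up to an integer, and the range [0,1) fixes it.\<close>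

lemma exponent_matrix_diag:
  fixes \<rho> :: "int^2^2 \<Rightarrow> complex^'n^'n" and l :: "'n \<Rightarrow> real"
  assumes T: "\<rho> T_mat = diag_mat (\<lambda>i. qe (of_real (l i)))"
    and l: "\<And>i. 0 \<le> l i" "\<And>i. l i < 1" and inj: "inj l"
  shows "exponent_matrix \<rho> = diag_mat (\<lambda>i. of_real (l i))"
  unfolding exponent_matrix_def
proof (rule the_equality, safe)
  let ?c = "2 * of_real pi * \<i> :: complex"
  show "matrix_exp (mat ?c ** diag_mat (\<lambda>i. of_real (l i))) = \<rho> T_mat"
    by (simp add: T mat_times_diag_mat matrix_exp_diag_mat qe_def)
  fix c assume "eigenvalue_of (diag_mat (\<lambda>i. complex_of_real (l i))) c"
  then obtain v where v: "v \<noteq> 0" "diag_mat (\<lambda>i. complex_of_real (l i)) *v v = c *s v"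
    by (auto simp: eigenvalue_of_def)
  obtain i where i: "v $ i \<noteq> 0" using v(1) by (auto simp: vec_eq_iff)
  have "of_real (l i) * v $ i = c * v $ i" using arg_cong[OF v(2), of "\<lambda>v. v $ i"] by (simp add: diag_mat_vector)
  hence "c = of_real (l i)" using i by simp
  thus "0 \<le> Re c" "Re c < 1" using l by auto
next
  fix L :: "complex^'n^'n"
  let ?c = "2 * of_real pi * \<i> :: complex"
  assume L: "matrix_exp (mat ?c ** L) = \<rho> T_mat" "\<forall>c. eigenvalue_of L c \<longrightarrow> 0 \<le> Re c \<and> Re c < 1"
  have "L ** (mat ?c ** L) = (mat ?c ** L) ** L"
    by (simp add: matrix_mul_assoc) (simp add: vec_eq_iff mat_eq_diag_mat matrix_matrix_mult_def
        diag_mat_def if_distrib[of "\<lambda>x. x * _"] if_distrib[of "\<lambda>x. _ * x"] mult_ac cong: if_cong)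
  from matrix_exp_commute[OF this]
  have comm: "L ** diag_mat (\<lambda>i. qe (of_real (l i))) = diag_mat (\<lambda>i. qe (of_real (l i))) ** L"
    by (simp add: L(1) T)
  have off: "L $ i $ j = 0" if "i \<noteq> j" for i j
  proof (rule ccontr)
    assume nz: "L $ i $ j \<noteq> 0"
    have "L $ i $ j * qe (of_real (l j)) = qe (of_real (l i)) * L $ i $ j"
      using arg_cong[OF comm, of "\<lambda>M. M $ i $ j"] by (simp add: diag_mat_mult_left diag_mat_mult_right)
    hence "qe (of_real (l j)) = qe (of_real (l i))" using nz by simp
    then obtain n :: int where n: "complex_of_real (l j) = of_real (l i) + of_int n"
      by (auto simp: qe_eq_iff)
    hence "l j = l i + of_int n" by (metis of_real_add of_real_eq_iff of_real_of_int_eq)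
    moreover from this have "real_of_int n < 1" "real_of_int n > -1" using l[of i] l[of j] by linarith+
    hence "n = 0" by linarith
    ultimately show False using inj that by (auto simp: inj_def)
  qed
  define d where "d = (\<lambda>i. L $ i $ i)"
  have Ld: "L = diag_mat d" using off by (auto simp: diag_mat_def vec_eq_iff d_def)
  have "d i = of_real (l i)" for i
  proof -
    have "diag_mat (\<lambda>i. exp (?c * d i)) = diag_mat (\<lambda>i. qe (of_real (l i)))"
      using L(1) unfolding Ld mat_times_diag_mat matrix_exp_diag_mat T .
    from arg_cong[OF this, of "\<lambda>M. M $ i $ i"] have "qe (d i) = qe (of_real (l i))"
      by (simp add: diag_mat_def qe_def)
    then obtain n :: int where n: "d i = of_real (l i) + of_int n" by (auto simp: qe_eq_iff)
    have "L *v axis i 1 = d i *s axis i 1"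
      by (simp add: Ld vec_eq_iff diag_mat_vector axis_def)
    hence "eigenvalue_of L (d i)" unfolding eigenvalue_of_def by (intro exI[of _ "axis i 1"]) (auto simp: axis_eq_0_iff)
    hence "0 \<le> Re (d i)" "Re (d i) < 1" using L(2) by auto
    hence "0 \<le> l i + real_of_int n" "l i + real_of_int n < 1" using n by auto
    hence "real_of_int n < 1" "real_of_int n > -1" using l[of i] by linarith+
    hence "n = 0" by linarith
    thus ?thesis using n by simp
  qed
  thus "L = diag_mat (\<lambda>i. of_real (l i))" using Ld by presburger
qed

text \<open>The expansions of the components already contain holomorphy and the law under T, because
  their exponents are those of \<rho>(T). So of the transformation laws only the one for S
  remains.\<close>

lemma modular_forms_iff:
  fixes \<rho> :: "int^2^2 \<Rightarrow> complex^'n^'n" and x :: "'n \<Rightarrow> int"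
  assumes rep: "SL2Z_rep \<rho>" and T: "\<rho> T_mat = diag_mat (\<lambda>i. qe (of_int (x i) / 6))"
    and x: "\<And>i. 0 \<le> x i" "\<And>i. x i < 6" "inj x"
  shows "F \<in> modular_forms k \<rho> \<longleftrightarrow>
    (\<forall>\<tau>. \<tau> \<notin> UH \<longrightarrow> F \<tau> = 0) \<and>
    (\<forall>\<tau>\<in>UH. F (- 1 / \<tau>) = \<tau> powi k *s (\<rho> S_mat *v F \<tau>)) \<and>
    (\<forall>i. \<exists>c. q_exp (x i) c (\<lambda>\<tau>. F \<tau> $ i))"
proof -
  have e: "exponent_matrix \<rho> = diag_mat (\<lambda>i. of_real (of_int (x i) / 6))"
  proof (rule exponent_matrix_diag)
    show "\<rho> T_mat = diag_mat (\<lambda>i. qe (of_real (of_int (x i) / 6)))" by (simp add: T)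
    show "0 \<le> real_of_int (x i) / 6" "real_of_int (x i) / 6 < 1" for i using x(1,2)[of i] by linarith+
    show "inj (\<lambda>i. real_of_int (x i) / 6)" using x(3) by (simp add: inj_def)
  qed
  have me: "matrix_exp (mat (- 2 * of_real pi * \<i> * \<tau>) ** exponent_matrix \<rho>) =
              diag_mat (\<lambda>i. qe (- (of_int (x i) * \<tau> / 6)))" for \<tau>
    unfolding e mat_times_diag_mat matrix_exp_diag_mat by (simp add: qe_def mult_ac)
  have cusp: "(\<exists>G. (\<forall>i. (\<lambda>q. G q $ i) holomorphic_on ball 0 1) \<and>
        (\<forall>\<tau>\<in>UH. matrix_exp (mat (- 2 * of_real pi * \<i> * \<tau>) ** exponent_matrix \<rho>) *v F \<tau> =
           G (exp (2 * of_real pi * \<i> * \<tau>)))) \<longleftrightarrow> (\<forall>i. \<exists>c. q_exp (x i) c (\<lambda>\<tau>. F \<tau> $ i))" (is "?L \<longleftrightarrow> ?R")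
  proof
    assume ?L
    then obtain G :: "complex \<Rightarrow> complex^'n" where G: "\<And>i. (\<lambda>q. G q $ i) holomorphic_on ball 0 1"
      "\<And>\<tau>. \<tau> \<in> UH \<Longrightarrow> diag_mat (\<lambda>i. qe (- (of_int (x i) * \<tau> / 6))) *v F \<tau> = G (qe \<tau>)"
      unfolding me qe_def[symmetric] by blast
    show ?R
    proof
      fix i
      have "F \<tau> $ i = qe (of_int (x i) * \<tau> / 6) * G (qe \<tau>) $ i" if "\<tau> \<in> UH" for \<tau>
        using arg_cong[OF G(2)[OF that, symmetric], of "\<lambda>v. v $ i"] by (simp add: diag_mat_vector qe_uminus)
      thus "\<exists>c. q_exp (x i) c (\<lambda>\<tau>. F \<tau> $ i)"
        using G(1)[of i] unfolding q_exp_def by (intro exI[of _ "G 0 $ i"] exI[of _ "\<lambda>q. G q $ i"]) auto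
    qed
  next
    assume ?R
    then obtain H where H: "\<And>i. H i holomorphic_on ball 0 1"
      "\<And>i \<tau>. \<tau> \<in> UH \<Longrightarrow> F \<tau> $ i = qe (of_int (x i) * \<tau> / 6) * H i (qe \<tau>)"
      unfolding q_exp_def by metis
    show ?L
      unfolding me qe_def[symmetric]
      by (intro exI[of _ "\<lambda>q. \<chi> i. H i q"]) (auto simp: H vec_eq_iff diag_mat_vector qe_uminus simp del: UH_iff)
  qed
  have trans: "(\<forall>\<gamma>\<in>SL2Z. \<forall>\<tau>\<in>UH. F (moebius \<gamma> \<tau>) =
      (of_int (\<gamma>$2$1) * \<tau> + of_int (\<gamma>$2$2)) powi k *s (\<rho> \<gamma> *v F \<tau>)) \<longleftrightarrow>
    (\<forall>\<tau>\<in>UH. F (- 1 / \<tau>) = \<tau> powi k *s (\<rho> S_mat *v F \<tau>))" (is "?L \<longleftrightarrow> ?R")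
    if q: "\<forall>i. \<exists>c. q_exp (x i) c (\<lambda>\<tau>. F \<tau> $ i)"
  proof
    assume ?L
    thus ?R using S_in_SL2Z moebius_simps unfolding automorphy_def[symmetric] by metis
  next
    assume ?R
    have "F (\<tau> + 1) = \<rho> T_mat *v F \<tau>" if "\<tau> \<in> UH" for \<tau>
      using q_exp_T[OF _ that] q by (metis (no_types, lifting) T diag_mat_vector vec_eq_iff)
    with \<open>?R\<close> show ?L
      unfolding automorphy_def[symmetric] using SL2Z_transformation[OF rep, of F k] by blast
  qed
  have hol: "\<forall>i. (\<lambda>\<tau>. F \<tau> $ i) holomorphic_on UH" if "\<forall>i. \<exists>c. q_exp (x i) c (\<lambda>\<tau>. F \<tau> $ i)"
    using that q_exp_holomorphic by blast
  show ?thesis unfolding modular_forms_def mem_Collect_eq cusp using trans hol by blast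
qed

section \<open>The sum over all weights and homogeneous bases\<close>

lemma all_modular_forms_E:
  assumes "F \<in> all_modular_forms \<rho>"
  obtains K f where "finite K" "\<And>k. k \<in> K \<Longrightarrow> f k \<in> modular_forms k \<rho>" "F = (\<lambda>\<tau>. \<Sum>k\<in>K. f k \<tau>)"
  using assms unfolding all_modular_forms_def by blast

lemma all_modular_forms_I:
  "finite K \<Longrightarrow> (\<And>k. k \<in> K \<Longrightarrow> f k \<in> modular_forms k \<rho>) \<Longrightarrow> (\<lambda>\<tau>. \<Sum>k\<in>K. f k \<tau>) \<in> all_modular_forms \<rho>"
  unfolding all_modular_forms_def mem_Collect_eq
  by (rule exI[of _ K], rule exI[of _ f]) simp

text \<open>Projection respects the weight, so surjectivity on the sum follows from lifting
  homogeneous forms one at a time.\<close>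

lemma M_splitI:
  assumes proj: "\<And>k F. F \<in> modular_forms k \<rho> \<Longrightarrow> (\<lambda>\<tau>. P *v F \<tau>) \<in> modular_forms k \<rho>1"
    and lift: "\<And>k G. G \<in> modular_forms k \<rho>1 \<Longrightarrow> \<exists>F\<in>modular_forms k \<rho>. (\<lambda>\<tau>. P *v F \<tau>) = G"
  shows "M_split \<rho> P \<rho>1"
  unfolding M_split_def
proof (intro equalityI subsetI)
  fix G assume "G \<in> (\<lambda>F \<tau>. P *v F \<tau>) ` all_modular_forms \<rho>"
  then obtain F where F: "F \<in> all_modular_forms \<rho>" "G = (\<lambda>\<tau>. P *v F \<tau>)" by blast
  obtain K f where K: "finite K" "\<And>k. k \<in> K \<Longrightarrow> f k \<in> modular_forms k \<rho>" "F = (\<lambda>\<tau>. \<Sum>k\<in>K. f k \<tau>)"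
    using all_modular_forms_E[OF F(1)] by metis
  have "G = (\<lambda>\<tau>. \<Sum>k\<in>K. P *v f k \<tau>)" using F(2) K(3) by (simp add: vec.sum)
  moreover have "(\<lambda>\<tau>. \<Sum>k\<in>K. P *v f k \<tau>) \<in> all_modular_forms \<rho>1"
    by (rule all_modular_forms_I[OF K(1)]) (rule proj[OF K(2)])
  ultimately show "G \<in> all_modular_forms \<rho>1" by simp
next
  fix G assume "G \<in> all_modular_forms \<rho>1"
  then obtain K g where K: "finite K" "\<And>k. k \<in> K \<Longrightarrow> g k \<in> modular_forms k \<rho>1" "G = (\<lambda>\<tau>. \<Sum>k\<in>K. g k \<tau>)"
    using all_modular_forms_E by metis
  define f where "f = (\<lambda>k. SOME F. F \<in> modular_forms k \<rho> \<and> (\<lambda>\<tau>. P *v F \<tau>) = g k)"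
  have f: "f k \<in> modular_forms k \<rho> \<and> (\<lambda>\<tau>. P *v f k \<tau>) = g k" if "k \<in> K" for k
  proof -
    have "\<exists>F. F \<in> modular_forms k \<rho> \<and> (\<lambda>\<tau>. P *v F \<tau>) = g k" using lift[OF K(2)[OF that]] by blast
    thus ?thesis unfolding f_def by (rule someI_ex)
  qed
  have "P *v f k \<tau> = g k \<tau>" if "k \<in> K" for k \<tau>
    using fun_cong[OF conjunct2[OF f[OF that]], of \<tau>] .
  hence "G = (\<lambda>\<tau>. P *v (\<Sum>k\<in>K. f k \<tau>))" using K(3) by (simp add: vec.sum)
  moreover have "(\<lambda>\<tau>. \<Sum>k\<in>K. f k \<tau>) \<in> all_modular_forms \<rho>"
    using K(1) f by (intro all_modular_forms_I) auto
  ultimately show "G \<in> (\<lambda>F \<tau>. P *v F \<tau>) ` all_modular_forms \<rho>" by (rule image_eqI)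
qed

text \<open>Independence is demanded at each point of UH, which is stronger than over R. It is
  available because the determinants of the bases below are nonzero multiples of powers of
  \<open>eta4\<close>.\<close>

lemma generating_weights_three:
  fixes \<rho> :: "int^2^2 \<Rightarrow> complex^'n^'n"
  assumes B: "B1 \<in> modular_forms w1 \<rho>" "B2 \<in> modular_forms w2 \<rho>" "B3 \<in> modular_forms w3 \<rho>"
    and span: "\<And>k F. F \<in> modular_forms k \<rho> \<Longrightarrow>
      \<exists>r1 r2 r3. scalar_form (k - w1) 0 r1 \<and> scalar_form (k - w2) 0 r2 \<and> scalar_form (k - w3) 0 r3 \<and>
        (\<forall>\<tau>\<in>UH. F \<tau> = r1 \<tau> *s B1 \<tau> + r2 \<tau> *s B2 \<tau> + r3 \<tau> *s B3 \<tau>)"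
    and indep: "\<And>\<tau> y1 y2 y3. \<tau> \<in> UH \<Longrightarrow> y1 *s B1 \<tau> + y2 *s B2 \<tau> + y3 *s B3 \<tau> = 0 \<Longrightarrow>
      y1 = 0 \<and> y2 = 0 \<and> y3 = 0"
  shows "generating_weights \<rho> {#w1, w2, w3#}"
proof -
  define B where "B = (\<lambda>i. [B1, B2, B3] ! i)"
  have sum3: "(\<Sum>i<length [w1, w2, w3]. f i) = f 0 + f 1 + f 2" for f :: "nat \<Rightarrow> complex^'n"
    by (simp add: eval_nat_numeral)
  have all3: "(\<forall>i<length [w1, w2, w3]. Q i) \<longleftrightarrow> Q 0 \<and> Q 1 \<and> Q 2" for Q
    by (auto simp: less_Suc_eq eval_nat_numeral)
  have span': "\<exists>r. (\<forall>i<length [w1, w2, w3]. r i \<in> E4E6_ring) \<and> F = (\<lambda>\<tau>. \<Sum>i<length [w1, w2, w3]. r i \<tau> *s B i \<tau>)"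
    if F: "F \<in> modular_forms k \<rho>" for k F
  proof -
    obtain r1 r2 r3 where r: "scalar_form (k - w1) 0 r1" "scalar_form (k - w2) 0 r2" "scalar_form (k - w3) 0 r3"
      "\<forall>\<tau>\<in>UH. F \<tau> = r1 \<tau> *s B1 \<tau> + r2 \<tau> *s B2 \<tau> + r3 \<tau> *s B3 \<tau>"
      using span[OF F] by (elim exE conjE)
    obtain s1 where s1: "s1 \<in> E4E6_ring" "\<And>\<tau>. \<tau> \<in> UH \<Longrightarrow> r1 \<tau> = s1 \<tau>"
      by (rule scalar_form_imp_E4E6_ring[OF r(1)]) blast
    obtain s2 where s2: "s2 \<in> E4E6_ring" "\<And>\<tau>. \<tau> \<in> UH \<Longrightarrow> r2 \<tau> = s2 \<tau>"
      by (rule scalar_form_imp_E4E6_ring[OF r(2)]) blast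
    obtain s3 where s3: "s3 \<in> E4E6_ring" "\<And>\<tau>. \<tau> \<in> UH \<Longrightarrow> r3 \<tau> = s3 \<tau>"
      by (rule scalar_form_imp_E4E6_ring[OF r(3)]) blast
    \<comment> \<open>All forms vanish off UH, so the identity holds there whatever values the ring
      elements take.\<close>
    have off: "F \<tau> = 0" "B1 \<tau> = 0" "B2 \<tau> = 0" "B3 \<tau> = 0" if "\<tau> \<notin> UH" for \<tau>
      using F B that by (auto simp: modular_forms_def simp del: UH_iff)
    have "F \<tau> = s1 \<tau> *s B1 \<tau> + s2 \<tau> *s B2 \<tau> + s3 \<tau> *s B3 \<tau>" for \<tau>
      using r(4) s1(2) s2(2) s3(2) off[of \<tau>] by (cases "\<tau> \<in> UH") (auto simp del: UH_iff)
    thus ?thesis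
      unfolding sum3 all3
      by (intro exI[of _ "\<lambda>i. [s1, s2, s3] ! i"]) (auto simp: B_def s1 s2 s3)
  qed
  have "homogeneous_basis \<rho> [w1, w2, w3] B"
    unfolding homogeneous_basis_def
  proof (intro conjI ballI allI impI)
    show "B i \<in> modular_forms ([w1, w2, w3] ! i) \<rho>" if "i < length [w1, w2, w3]" for i
      using that B by (auto simp: B_def less_Suc_eq)
  next
    fix F assume "F \<in> all_modular_forms \<rho>"
    then obtain K f where K: "finite K" "\<And>k. k \<in> K \<Longrightarrow> f k \<in> modular_forms k \<rho>" "F = (\<lambda>\<tau>. \<Sum>k\<in>K. f k \<tau>)"
      using all_modular_forms_E by metis
    define R where "R = (\<lambda>k r. (\<forall>i<length [w1, w2, w3]. r i \<in> E4E6_ring) \<and>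
      f k = (\<lambda>\<tau>. \<Sum>i<length [w1, w2, w3]. r i \<tau> *s B i \<tau>))"
    have "\<forall>k\<in>K. \<exists>r. R k r" unfolding R_def using span' K(2) by blast
    then obtain r where rR: "\<And>k. k \<in> K \<Longrightarrow> R k (r k)" using bchoice[of K R] by blast
    have r: "\<And>k i. k \<in> K \<Longrightarrow> i < length [w1, w2, w3] \<Longrightarrow> r k i \<in> E4E6_ring"
      "\<And>k. k \<in> K \<Longrightarrow> f k = (\<lambda>\<tau>. \<Sum>i<length [w1, w2, w3]. r k i \<tau> *s B i \<tau>)"
      using rR unfolding R_def by blast+
    have "F \<tau> = (\<Sum>i<length [w1, w2, w3]. (\<Sum>k\<in>K. r k i \<tau>) *s B i \<tau>)" for \<tau>
    proof -
      have "F \<tau> = (\<Sum>k\<in>K. \<Sum>i<length [w1, w2, w3]. r k i \<tau> *s B i \<tau>)"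
        unfolding K(3) using r(2) by (intro sum.cong refl) metis
      also have "\<dots> = (\<Sum>i<length [w1, w2, w3]. \<Sum>k\<in>K. r k i \<tau> *s B i \<tau>)" by (rule sum.swap)
      finally show ?thesis by (simp only: vec.scale_sum_left)
    qed
    moreover have "(\<lambda>\<tau>. \<Sum>k\<in>K. r k i \<tau>) \<in> E4E6_ring" if "i < length [w1, w2, w3]" for i
      using r(1) that by (intro E4E6_ring_sum) auto
    ultimately show "\<exists>r. (\<forall>i<length [w1, w2, w3]. r i \<in> E4E6_ring) \<and>
        F = (\<lambda>\<tau>. \<Sum>i<length [w1, w2, w3]. r i \<tau> *s B i \<tau>)"
      by (intro exI[of _ "\<lambda>i \<tau>. \<Sum>k\<in>K. r k i \<tau>"]) auto
  next
    fix r i \<tau>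
    assume r: "(\<forall>i<length [w1, w2, w3]. r i \<in> E4E6_ring) \<and>
      (\<forall>\<tau>\<in>UH. (\<Sum>i<length [w1, w2, w3]. r i \<tau> *s B i \<tau>) = 0)" and i: "i < length [w1, w2, w3]" and \<tau>: "\<tau> \<in> UH"
    have "r 0 \<tau> *s B1 \<tau> + r 1 \<tau> *s B2 \<tau> + r 2 \<tau> *s B3 \<tau> = 0"
      using r \<tau> unfolding sum3 by (auto simp: B_def)
    from indep[OF \<tau> this] show "r i \<tau> = 0" using i by (auto simp: less_Suc_eq eval_nat_numeral)
  qed
  thus ?thesis unfolding generating_weights_def by (intro exI[of _ "[w1, w2, w3]"] exI[of _ B]) simp
qed

section \<open>Triangular representations of dimension three\<close>

definition eich_c :: complex where
  "eich_c = (SOME c. c \<noteq> 0 \<and>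
    (\<exists>a. q_exp 5 a (\<lambda>\<tau>. E4 \<tau> * eich 1 \<tau> - c * (E6 \<tau> * inverse (eta4 \<tau>)))) \<and>
    (\<exists>a. q_exp 5 a (\<lambda>\<tau>. E6 \<tau> * eich 1 \<tau> - c * (E4 \<tau> ^ 2 * inverse (eta4 \<tau>)))))"

text \<open>The correction that cancels the pole of \<open>eich 1\<close> times \<open>E4\<close>,
  named after its weight. Its own order at the cusp is -1, while its law under S is that of the
  exponent 5, of the same parity.\<close>

definition pol4 :: "complex \<Rightarrow> complex" where
  "pol4 \<tau> = - eich_c * (E6 \<tau> * inverse (eta4 \<tau>))"

definition pol6 :: "complex \<Rightarrow> complex" where
  "pol6 \<tau> = - eich_c * (E4 \<tau> ^ 2 * inverse (eta4 \<tau>))"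

lemma eich_c_nonzero: "eich_c \<noteq> 0"
  and pol4_q_exp: "\<exists>a. q_exp 5 a (\<lambda>\<tau>. pol4 \<tau> + eich 1 \<tau> * E4 \<tau>)"
  and pol6_q_exp: "\<exists>a. q_exp 5 a (\<lambda>\<tau>. pol6 \<tau> + eich 1 \<tau> * E6 \<tau>)"
proof -
  have "\<exists>c. c \<noteq> 0 \<and>
    (\<exists>a. q_exp 5 a (\<lambda>\<tau>. E4 \<tau> * eich 1 \<tau> - c * (E6 \<tau> * inverse (eta4 \<tau>)))) \<and>
    (\<exists>a. q_exp 5 a (\<lambda>\<tau>. E6 \<tau> * eich 1 \<tau> - c * (E4 \<tau> ^ 2 * inverse (eta4 \<tau>))))"
    by (rule eich_pole_cancellation) blast
  from someI_ex[OF this, folded eich_c_def]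
  show "eich_c \<noteq> 0" "\<exists>a. q_exp 5 a (\<lambda>\<tau>. pol4 \<tau> + eich 1 \<tau> * E4 \<tau>)"
    "\<exists>a. q_exp 5 a (\<lambda>\<tau>. pol6 \<tau> + eich 1 \<tau> * E6 \<tau>)"
    by (simp_all add: pol4_def pol6_def mult.commute)
qed

lemma eta4_inverse_form: "scalar_form (- 2) (- 1) (\<lambda>\<tau>. inverse (eta4 \<tau>))"
  using eta4_powi[of "- 1"] by (simp add: power_int_minus)

lemma pol4_S: "S_law 4 5 pol4" and pol6_S: "S_law 6 5 pol6"
proof -
  have i: "S_law (- 2) (- 1) (\<lambda>\<tau>. inverse (eta4 \<tau>))" using eta4_inverse_form by (simp add: scalar_form_def)
  have "S_law 4 (- 1) pol4"
    unfolding pol4_def[abs_def] using S_law_cmult[OF S_law_mult[OF eisenstein_forms(3) i], of "- eich_c"] by simp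
  thus "S_law 4 5 pol4" by (rule S_law_parity) simp
  have "S_law 6 (- 1) pol6"
    unfolding pol6_def[abs_def]
    using S_law_cmult[OF S_law_mult[OF S_law_power[OF eisenstein_forms(1), of 2] i], of "- eich_c"] by simp
  thus "S_law 6 5 pol6" by (rule S_law_parity) simp
qed

text \<open>The determinant of the two pairs in \<open>eich_pair_decomposition\<close>. It accounts
  for the weights: 4 + 6 replaces 10 + 0, the weights of \<open>eta4\<close>^5 and 1.\<close>

lemma pol_determinant:
  assumes "\<tau> \<in> UH"
  shows "pol4 \<tau> * E6 \<tau> - pol6 \<tau> * E4 \<tau> = eich_c * eta4 \<tau> ^ 5"
proof -
  have "pol4 \<tau> * E6 \<tau> - pol6 \<tau> * E4 \<tau> = eich_c * (Delta \<tau> * inverse (eta4 \<tau>))"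
    by (simp add: pol4_def pol6_def Delta_def algebra_simps power2_eq_square power3_eq_cube)
  also have "Delta \<tau> * inverse (eta4 \<tau>) = eta4 \<tau> ^ 5"
    using eta4_power_6[OF assms, symmetric] eta4_nonzero[OF assms] by (simp add: eval_nat_numeral)
  finally show ?thesis .
qed

text \<open>The two-dimensional case with exponents \<open>(5, 0)\<close>: the pairs \<open>(pol4, E4)\<close> and
  \<open>(pol6, E6)\<close> generate.  In weight \<open>0\<close> a constant \<open>g\<close> would force \<open>\<eta>\<^sup>4 h\<close> to be a form of
  weight \<open>2\<close>, so the pole of \<open>g v\<close> could not be cancelled.\<close>

lemma eich_pair_decomposition:
  assumes h: "S_law k 5 h" and g: "scalar_form k 0 g" and hg: "\<exists>c. q_exp 5 c (\<lambda>\<tau>. h \<tau> + eich 1 \<tau> * g \<tau>)"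
  obtains A B where "scalar_form (k - 4) 0 A" "scalar_form (k - 6) 0 B"
    "\<And>\<tau>. \<tau> \<in> UH \<Longrightarrow> g \<tau> = E4 \<tau> * A \<tau> + E6 \<tau> * B \<tau>"
    "\<And>\<tau>. \<tau> \<in> UH \<Longrightarrow> h \<tau> = pol4 \<tau> * A \<tau> + pol6 \<tau> * B \<tau>"
proof -
  obtain A0 B0 where A0: "scalar_form (k - 4) 0 A0" and B0: "scalar_form (k - 6) 0 B0"
    and gAB: "\<And>\<tau>. \<tau> \<in> UH \<Longrightarrow> g \<tau> = E4 \<tau> * A0 \<tau> + E6 \<tau> * B0 \<tau>"
  proof (cases "k = 0")
    case False
    thus ?thesis using scalar_form_E4_E6_ideal[OF g] that by blast
  next
    case True
    obtain \<kappa> where \<kappa>: "\<And>\<tau>. \<tau> \<in> UH \<Longrightarrow> g \<tau> = \<kappa>"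
      using scalar_form_weight_zero[of g] g True by blast
    obtain d where d: "d \<noteq> 0" "q_exp (- 1) d (eich 1)" using eich_properties(1)[of 1] by auto
    have vg: "q_exp (- 1) (\<kappa> * d) (\<lambda>\<tau>. eich 1 \<tau> * g \<tau>)"
      using q_exp_cmult[OF d(2), of \<kappa>] q_exp_cong[of "\<lambda>\<tau>. eich 1 \<tau> * g \<tau>" "\<lambda>\<tau>. \<kappa> * eich 1 \<tau>"] \<kappa> by simp
    have hg0: "q_exp (- 1) 0 (\<lambda>\<tau>. h \<tau> + eich 1 \<tau> * g \<tau>)"
      using hg q_exp_drop[of "- 1"] by auto
    have "q_exp (- 1) (0 - \<kappa> * d) h" using q_exp_diff[OF hg0 vg] by simp
    moreover have "S_law 0 (- 1) h" using h True by (auto intro: S_law_parity)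
    ultimately have "scalar_form 0 (- 1) h" by (auto simp: scalar_form_def)
    then obtain r where r: "scalar_form 2 0 r" "\<And>\<tau>. \<tau> \<in> UH \<Longrightarrow> h \<tau> = eta4 \<tau> powi (- 1) * r \<tau>"
      using scalar_form_eta4_factor[of 0 "- 1" h] by auto
    hence "h \<tau> = 0" if "\<tau> \<in> UH" for \<tau> using scalar_form_weight_2[OF r(1) that] that by simp
    hence "q_exp (- 1) 0 (\<lambda>\<tau>. eich 1 \<tau> * g \<tau>)"
      using hg0 q_exp_cong[of "\<lambda>\<tau>. h \<tau> + eich 1 \<tau> * g \<tau>" "\<lambda>\<tau>. eich 1 \<tau> * g \<tau>"] by simp
    hence "\<kappa> * d = 0" using vg q_exp_coeff_unique by blast
    hence "\<kappa> = 0" using d(1) by simp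
    thus ?thesis using that[OF scalar_form_zero scalar_form_zero] \<kappa> by simp
  qed
  \<comment> \<open>Once the lift of g is subtracted, what remains in the first place has no pole,
    so it is \<open>eta4\<close>^5 times a level one form.\<close>
  define h' where "h' = (\<lambda>\<tau>. h \<tau> - (pol4 \<tau> * A0 \<tau> + pol6 \<tau> * B0 \<tau>))"
  have AB_S: "S_law (k - 4) 0 A0" "S_law (k - 6) 0 B0" using A0 B0 by (auto simp: scalar_form_def)
  have h'S: "S_law k 5 h'"
    unfolding h'_def using S_law_mult[OF pol4_S AB_S(1)] S_law_mult[OF pol6_S AB_S(2)] h
    by (intro S_law_diff S_law_add) auto
  obtain a4 a6 a0 b0 e where
    "q_exp 5 a4 (\<lambda>\<tau>. pol4 \<tau> + eich 1 \<tau> * E4 \<tau>)" "q_exp 5 a6 (\<lambda>\<tau>. pol6 \<tau> + eich 1 \<tau> * E6 \<tau>)"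
    "q_exp 0 a0 A0" "q_exp 0 b0 B0" "q_exp 5 e (\<lambda>\<tau>. h \<tau> + eich 1 \<tau> * g \<tau>)"
    using pol4_q_exp pol6_q_exp A0 B0 hg by (auto simp: scalar_form_def)
  hence "q_exp 5 (e - (a4 * a0 + a6 * b0)) (\<lambda>\<tau>. (h \<tau> + eich 1 \<tau> * g \<tau>) -
      ((pol4 \<tau> + eich 1 \<tau> * E4 \<tau>) * A0 \<tau> + (pol6 \<tau> + eich 1 \<tau> * E6 \<tau>) * B0 \<tau>))"
    using q_exp_mult[of 5 a4 _ 0 a0 A0] q_exp_mult[of 5 a6 _ 0 b0 B0] by (intro q_exp_diff q_exp_add) auto
  also have "?this \<longleftrightarrow> q_exp 5 (e - (a4 * a0 + a6 * b0)) h'"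
    by (rule q_exp_cong) (simp add: h'_def gAB algebra_simps)
  finally have "scalar_form k 5 h'" using h'S by (auto simp: scalar_form_def)
  then obtain r where r: "scalar_form (k - 10) 0 r" "\<And>\<tau>. \<tau> \<in> UH \<Longrightarrow> h' \<tau> = eta4 \<tau> powi 5 * r \<tau>"
    using scalar_form_eta4_factor[of k 5 h'] by auto
  \<comment> \<open>The combination \<open>E6\<close> (\<open>pol4\<close>, \<open>E4\<close>) -
    \<open>E4\<close> (\<open>pol6\<close>, \<open>E6\<close>) is (\<open>eich_c\<close>
    \<open>eta4\<close>^5, 0). Adding a multiple of it produces h' without changing g.\<close>
  define A B where "A = (\<lambda>\<tau>. A0 \<tau> + (1 / eich_c) * (E6 \<tau> * r \<tau>))"
    and "B = (\<lambda>\<tau>. B0 \<tau> - (1 / eich_c) * (E4 \<tau> * r \<tau>))"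
  show ?thesis
  proof (rule that[of A B])
    show "scalar_form (k - 4) 0 A"
      unfolding A_def using scalar_form_mult[OF scalar_form_eisenstein(2) r(1)]
      by (intro scalar_form_add A0 scalar_form_cmult) simp
    show "scalar_form (k - 6) 0 B"
      unfolding B_def using scalar_form_mult[OF scalar_form_eisenstein(1) r(1)]
      by (intro scalar_form_diff B0 scalar_form_cmult) simp
    fix \<tau> assume \<tau>: "\<tau> \<in> UH"
    show "g \<tau> = E4 \<tau> * A \<tau> + E6 \<tau> * B \<tau>"
      using gAB[OF \<tau>] by (simp add: A_def B_def algebra_simps)
    have "pol4 \<tau> * A \<tau> + pol6 \<tau> * B \<tau> =
        pol4 \<tau> * A0 \<tau> + pol6 \<tau> * B0 \<tau> + (pol4 \<tau> * E6 \<tau> - pol6 \<tau> * E4 \<tau>) * (r \<tau> / eich_c)"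
      by (simp add: A_def B_def algebra_simps)
    also have "\<dots> = pol4 \<tau> * A0 \<tau> + pol6 \<tau> * B0 \<tau> + h' \<tau>"
      unfolding pol_determinant[OF \<tau>] r(2)[OF \<tau>] using eich_c_nonzero by simp
    finally show "h \<tau> = pol4 \<tau> * A \<tau> + pol6 \<tau> * B \<tau>" by (simp add: h'_def)
  qed
qed

lemma pol_independent:
  assumes \<tau>: "\<tau> \<in> UH" and "y * E4 \<tau> + z * E6 \<tau> = 0" "y * pol4 \<tau> + z * pol6 \<tau> = 0"
  shows "y = 0" "z = 0"
proof -
  have D: "pol4 \<tau> * E6 \<tau> - pol6 \<tau> * E4 \<tau> \<noteq> 0"
    unfolding pol_determinant[OF \<tau>] using eich_c_nonzero eta4_nonzero[OF \<tau>] by simp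
  have "y * (pol4 \<tau> * E6 \<tau> - pol6 \<tau> * E4 \<tau>) =
      E6 \<tau> * (y * pol4 \<tau> + z * pol6 \<tau>) - pol6 \<tau> * (y * E4 \<tau> + z * E6 \<tau>)" by (simp add: algebra_simps)
  thus "y = 0" using D assms by simp
  have "z * (pol4 \<tau> * E6 \<tau> - pol6 \<tau> * E4 \<tau>) =
      pol4 \<tau> * (y * E4 \<tau> + z * E6 \<tau>) - E4 \<tau> * (y * pol4 \<tau> + z * pol6 \<tau>)" by (simp add: algebra_simps)
  thus "z = 0" using D assms by simp
qed

lemmas vec3_simps = vec_eq_iff forall_3 sum_3 vector_3

text \<open>Conjugating by the unipotent matrix with entries \<open>a, b, c\<close> above the diagonal turns the upper
  triangular action into the diagonal one.\<close>

locale triangular_data =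
  fixes x1 x2 x3 :: int and n12 n13 n23 :: complex and a b c :: "complex \<Rightarrow> complex"
  assumes x: "x1 \<in> {0..<6}" "x2 \<in> {0..<6}" "x3 \<in> {0..<6}" "x1 \<noteq> x2" "x1 \<noteq> x3" "x2 \<noteq> x3"
    and aS: "\<And>\<tau>. \<tau> \<in> UH \<Longrightarrow> (-1) powi x2 * a (- 1 / \<tau>) = n12 + (-1) powi x1 * a \<tau>"
    and bS: "\<And>\<tau>. \<tau> \<in> UH \<Longrightarrow> (-1) powi x3 * b (- 1 / \<tau>) = n13 + n12 * c \<tau> + (-1) powi x1 * b \<tau>"
    and cS: "\<And>\<tau>. \<tau> \<in> UH \<Longrightarrow> (-1) powi x3 * c (- 1 / \<tau>) = n23 + (-1) powi x2 * c \<tau>"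
    and aT: "\<And>\<tau>. \<tau> \<in> UH \<Longrightarrow> a (\<tau> + 1) * qe (of_int x2 / 6) = qe (of_int x1 / 6) * a \<tau>"
    and bT: "\<And>\<tau>. \<tau> \<in> UH \<Longrightarrow> b (\<tau> + 1) * qe (of_int x3 / 6) = qe (of_int x1 / 6) * b \<tau>"
    and cT: "\<And>\<tau>. \<tau> \<in> UH \<Longrightarrow> c (\<tau> + 1) * qe (of_int x3 / 6) = qe (of_int x2 / 6) * c \<tau>"
begin

definition S_tri :: "complex^3^3" where
  "S_tri = vector [vector [(-1) powi x1, n12, n13], vector [0, (-1) powi x2, n23], vector [0, 0, (-1) powi x3]]"

definition T_tri :: "complex^3^3" where
  "T_tri = vector [vector [qe (of_int x1 / 6), 0, 0], vector [0, qe (of_int x2 / 6), 0],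
                   vector [0, 0, qe (of_int x3 / 6)]]"

definition xs :: "3 \<Rightarrow> int" where
  "xs i = (if i = 1 then x1 else if i = 2 then x2 else x3)"

lemma xs_simps [simp]: "xs 1 = x1" "xs 2 = x2" "xs 3 = x3"
  by (simp_all add: xs_def)

lemma T_tri_diag: "T_tri = diag_mat (\<lambda>i. qe (of_int (xs i) / 6))"
  by (simp add: T_tri_def diag_mat_def vec3_simps)

lemma qe_sixth_inj:
  assumes "i \<in> {0..<6}" "j \<in> {0..<6}" "qe (of_int i / 6) = qe (of_int j / 6)"
  shows "i = j"
proof -
  obtain n :: int where "complex_of_int i / 6 = of_int j / 6 + of_int n"
    using assms(3) by (auto simp: qe_eq_iff)
  hence "complex_of_int i = of_int (j + 6 * n)" by (simp add: field_simps)
  hence "i = j + 6 * n" by (simp only: of_int_eq_iff)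
  thus ?thesis using assms by auto
qed

text \<open>The unipotent matrix applied to (h1, h2, h3), with the value 0 outside UH that
  \<open>modular_forms\<close> prescribes.\<close>

definition lift :: "(complex \<Rightarrow> complex) \<Rightarrow> (complex \<Rightarrow> complex) \<Rightarrow> (complex \<Rightarrow> complex) \<Rightarrow> complex \<Rightarrow> complex^3" where
  "lift h1 h2 h3 = (\<lambda>\<tau>. if \<tau> \<in> UH
     then vector [h1 \<tau> + a \<tau> * h2 \<tau> + b \<tau> * h3 \<tau>, h2 \<tau> + c \<tau> * h3 \<tau>, h3 \<tau>] else 0)"

lemma lift_simps:
  assumes "\<tau> \<in> UH"
  shows "lift h1 h2 h3 \<tau> $ 1 = h1 \<tau> + a \<tau> * h2 \<tau> + b \<tau> * h3 \<tau>"
    "lift h1 h2 h3 \<tau> $ 2 = h2 \<tau> + c \<tau> * h3 \<tau>" "lift h1 h2 h3 \<tau> $ 3 = h3 \<tau>"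
  using assms by (simp_all add: lift_def)

lemma S_tri_vector:
  "(S_tri *v v) $ 1 = (-1) powi x1 * v $ 1 + n12 * v $ 2 + n13 * v $ 3"
  "(S_tri *v v) $ 2 = (-1) powi x2 * v $ 2 + n23 * v $ 3"
  "(S_tri *v v) $ 3 = (-1) powi x3 * v $ 3"
  by (simp_all add: S_tri_def matrix_vector_mult_def sum_3)

lemma lift_S:
  assumes h: "S_law k x1 h1" "S_law k x2 h2" "S_law k x3 h3" and \<tau>: "\<tau> \<in> UH"
  shows "lift h1 h2 h3 (- 1 / \<tau>) = \<tau> powi k *s (S_tri *v lift h1 h2 h3 \<tau>)"
proof -
  define t where "t = \<tau> powi k"
  define s1 s2 s3 where "s1 = (-1 :: complex) powi x1" and "s2 = (-1 :: complex) powi x2" and "s3 = (-1 :: complex) powi x3"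
  have hS: "h1 (- 1 / \<tau>) = s1 * t * h1 \<tau>" "h2 (- 1 / \<tau>) = s2 * t * h2 \<tau>" "h3 (- 1 / \<tau>) = s3 * t * h3 \<tau>"
    using h \<tau> by (auto simp: S_law_def t_def s1_def s2_def s3_def)
  have abc: "s2 * a (- 1 / \<tau>) = n12 + s1 * a \<tau>" "s3 * b (- 1 / \<tau>) = n13 + n12 * c \<tau> + s1 * b \<tau>"
    "s3 * c (- 1 / \<tau>) = n23 + s2 * c \<tau>"
    using aS[OF \<tau>] bS[OF \<tau>] cS[OF \<tau>] by (simp_all add: s1_def s2_def s3_def)
  have "h1 (- 1 / \<tau>) + a (- 1 / \<tau>) * h2 (- 1 / \<tau>) + b (- 1 / \<tau>) * h3 (- 1 / \<tau>) =
      t * (s1 * h1 \<tau> + (s2 * a (- 1 / \<tau>)) * h2 \<tau> + (s3 * b (- 1 / \<tau>)) * h3 \<tau>)"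
    unfolding hS by (simp add: algebra_simps)
  hence 1: "h1 (- 1 / \<tau>) + a (- 1 / \<tau>) * h2 (- 1 / \<tau>) + b (- 1 / \<tau>) * h3 (- 1 / \<tau>) =
      t * (s1 * (h1 \<tau> + a \<tau> * h2 \<tau> + b \<tau> * h3 \<tau>) + n12 * (h2 \<tau> + c \<tau> * h3 \<tau>) + n13 * h3 \<tau>)"
    unfolding abc by (simp add: algebra_simps)
  have "h2 (- 1 / \<tau>) + c (- 1 / \<tau>) * h3 (- 1 / \<tau>) = t * (s2 * h2 \<tau> + (s3 * c (- 1 / \<tau>)) * h3 \<tau>)"
    unfolding hS by (simp add: algebra_simps)
  hence 2: "h2 (- 1 / \<tau>) + c (- 1 / \<tau>) * h3 (- 1 / \<tau>) = t * (s2 * (h2 \<tau> + c \<tau> * h3 \<tau>) + n23 * h3 \<tau>)"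
    unfolding abc by (simp add: algebra_simps)
  have 3: "h3 (- 1 / \<tau>) = t * (s3 * h3 \<tau>)" unfolding hS by simp
  show ?thesis
    using 1 2 3
    unfolding vec_eq_iff forall_3 vector_smult_component S_tri_vector lift_simps[OF \<tau>]
      lift_simps[OF S_in_UH[OF \<tau>]] t_def s1_def s2_def s3_def
    by blast
qed

text \<open>The unipotent matrix is inverted by back substitution, starting from the third
  component.\<close>

lemma lift_S_converse:
  assumes F: "\<And>\<tau>. \<tau> \<in> UH \<Longrightarrow> F (- 1 / \<tau>) = \<tau> powi k *s (S_tri *v F \<tau>)"
    and off: "\<And>\<tau>. \<tau> \<notin> UH \<Longrightarrow> F \<tau> = 0"
  obtains h1 h2 h3 where "F = lift h1 h2 h3" "S_law k x1 h1" "S_law k x2 h2" "S_law k x3 h3"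
proof -
  define h3 where "h3 = (\<lambda>\<tau>. F \<tau> $ 3)"
  define h2 where "h2 = (\<lambda>\<tau>. F \<tau> $ 2 - c \<tau> * h3 \<tau>)"
  define h1 where "h1 = (\<lambda>\<tau>. F \<tau> $ 1 - a \<tau> * h2 \<tau> - b \<tau> * h3 \<tau>)"
  have FS: "F (- 1 / \<tau>) $ 1 = \<tau> powi k * ((-1) powi x1 * F \<tau> $ 1 + n12 * F \<tau> $ 2 + n13 * F \<tau> $ 3)"
    "F (- 1 / \<tau>) $ 2 = \<tau> powi k * ((-1) powi x2 * F \<tau> $ 2 + n23 * F \<tau> $ 3)"
    "F (- 1 / \<tau>) $ 3 = \<tau> powi k * ((-1) powi x3 * F \<tau> $ 3)" if "\<tau> \<in> UH" for \<tau>
    unfolding F[OF that] vector_smult_component S_tri_vector by simp_all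
  have 3: "h3 (- 1 / \<tau>) = (-1) powi x3 * \<tau> powi k * h3 \<tau>" if "\<tau> \<in> UH" for \<tau>
    using FS(3)[OF that] by (simp add: h3_def mult_ac)
  have 2: "h2 (- 1 / \<tau>) = (-1) powi x2 * \<tau> powi k * h2 \<tau>" if "\<tau> \<in> UH" for \<tau>
  proof -
    have "h2 (- 1 / \<tau>) = F (- 1 / \<tau>) $ 2 - ((-1) powi x3 * c (- 1 / \<tau>)) * (\<tau> powi k * h3 \<tau>)"
      unfolding h2_def 3[OF that] by (simp add: mult_ac)
    thus ?thesis unfolding FS(2)[OF that] cS[OF that] by (simp add: h2_def h3_def algebra_simps)
  qed
  have 1: "h1 (- 1 / \<tau>) = (-1) powi x1 * \<tau> powi k * h1 \<tau>" if "\<tau> \<in> UH" for \<tau>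
  proof -
    have "h1 (- 1 / \<tau>) = F (- 1 / \<tau>) $ 1 - ((-1) powi x2 * a (- 1 / \<tau>)) * (\<tau> powi k * h2 \<tau>)
        - ((-1) powi x3 * b (- 1 / \<tau>)) * (\<tau> powi k * h3 \<tau>)"
      unfolding h1_def 2[OF that] 3[OF that] by (simp add: mult_ac)
    thus ?thesis unfolding FS(1)[OF that] aS[OF that] bS[OF that]
      by (simp add: h1_def h2_def h3_def algebra_simps)
  qed
  have "F = lift h1 h2 h3"
  proof
    show "F \<tau> = lift h1 h2 h3 \<tau>" for \<tau>
      using off[of \<tau>] by (cases "\<tau> \<in> UH") (auto simp: lift_def vec3_simps h1_def h2_def h3_def)
  qed
  thus ?thesis using that 1 2 3 unfolding S_law_def by blast
qed

text \<open>A single vector of functions suffices for \<open>rep_from_functions\<close>: its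
  components are eigenfunctions of T with distinct eigenvalues, so they are independent once none
  vanishes identically. Weight 16 is even and leaves the weights 6, 8, ..., 16 after division by
  \<open>eta4\<close>^y, all of the form 4n + 6l.\<close>

lemma representation_exists: "\<exists>\<rho>. PSL2Z_rep \<rho> \<and> \<rho> S_mat = S_tri \<and> \<rho> T_mat = T_tri"
proof -
  have base: "\<exists>m. S_law 16 y m \<and> (\<forall>\<tau>\<in>UH. m (\<tau> + 1) = qe (of_int y / 6) * m \<tau>) \<and> (\<exists>\<tau>\<in>UH. m \<tau> \<noteq> 0)"
    if y: "y \<in> {0..<6}" for y
  proof -
    have "\<exists>n l. 4 * int n + 6 * int l = 16 - 2 * y"
    proof -
      have "y = 0 \<or> y = 1 \<or> y = 2 \<or> y = 3 \<or> y = 4 \<or> y = 5" using y by auto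
      thus ?thesis
        by (elim disjE) (force intro: exI[of _ 4] exI[of _ 0] | force intro: exI[of _ 2] exI[of _ 1] |
          force intro: exI[of _ 3] exI[of _ 0] | force intro: exI[of _ 1] exI[of _ 1] | force intro: exI[of _ 2] exI[of _ 0]
          | force intro: exI[of _ 0] exI[of _ 1])+
    qed
    then obtain n l where nl: "4 * int n + 6 * int l = 16 - 2 * y" by blast
    obtain d where d: "d \<noteq> 0" "q_exp y d (\<lambda>\<tau>. eta4 \<tau> powi y)" using eta4_powi_coeff by blast
    define m where "m = (\<lambda>\<tau>. eta4 \<tau> powi y * (E4 \<tau> ^ n * E6 \<tau> ^ l))"
    have "scalar_form (2 * y + (16 - 2 * y)) (y + 0) m"
      unfolding m_def by (intro scalar_form_mult eta4_powi) (use scalar_form_E4_E6(1)[of n l] nl in simp)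
    moreover have q: "q_exp (y + 0) (d * 1) m"
      unfolding m_def by (intro q_exp_mult d scalar_form_E4_E6)
    ultimately show ?thesis
      using q_exp_nontrivial[OF q] q_exp_T[OF q] d(1) by (intro exI[of _ m]) (auto simp: scalar_form_def)
  qed
  \<comment> \<open>The lower components may already make this entry nonzero, and then h = 0 is
    taken; otherwise any nonzero h works. This avoids an accidental cancellation.\<close>
  have choose: "\<exists>h. S_law 16 y h \<and> (\<forall>\<tau>\<in>UH. h (\<tau> + 1) = qe (of_int y / 6) * h \<tau>) \<and> (\<exists>\<tau>\<in>UH. h \<tau> + \<psi> \<tau> \<noteq> 0)"
    if y: "y \<in> {0..<6}" for y \<psi>
  proof (cases "\<exists>\<tau>\<in>UH. \<psi> \<tau> \<noteq> 0")
    case True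
    thus ?thesis by (intro exI[of _ "\<lambda>\<tau>. 0"]) (auto simp: S_law_zero)
  next
    case False
    thus ?thesis using base[OF y] by auto
  qed
  obtain h3 where h3: "S_law 16 x3 h3" "\<And>\<tau>. \<tau> \<in> UH \<Longrightarrow> h3 (\<tau> + 1) = qe (of_int x3 / 6) * h3 \<tau>" "\<exists>\<tau>\<in>UH. h3 \<tau> \<noteq> 0"
    using base[OF x(3)] by blast
  obtain h2 where h2: "S_law 16 x2 h2" "\<And>\<tau>. \<tau> \<in> UH \<Longrightarrow> h2 (\<tau> + 1) = qe (of_int x2 / 6) * h2 \<tau>"
    "\<exists>\<tau>\<in>UH. h2 \<tau> + c \<tau> * h3 \<tau> \<noteq> 0"
    using choose[OF x(2), of "\<lambda>\<tau>. c \<tau> * h3 \<tau>"] by blast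
  obtain h1 where h1: "S_law 16 x1 h1" "\<And>\<tau>. \<tau> \<in> UH \<Longrightarrow> h1 (\<tau> + 1) = qe (of_int x1 / 6) * h1 \<tau>"
    "\<exists>\<tau>\<in>UH. h1 \<tau> + (a \<tau> * h2 \<tau> + b \<tau> * h3 \<tau>) \<noteq> 0"
    using choose[OF x(1), of "\<lambda>\<tau>. a \<tau> * h2 \<tau> + b \<tau> * h3 \<tau>"] by blast
  define \<Phi> where "\<Phi> = lift h1 h2 h3"
  have T: "\<Phi> (\<tau> + 1) = T_tri *v \<Phi> \<tau>" if \<tau>: "\<tau> \<in> UH" for \<tau>
  proof -
    have \<tau>1: "\<tau> + 1 \<in> UH" using \<tau> by simp
    have *: "c (\<tau> + 1) * h3 (\<tau> + 1) = qe (of_int x2 / 6) * (c \<tau> * h3 \<tau>)"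
      "b (\<tau> + 1) * h3 (\<tau> + 1) = qe (of_int x1 / 6) * (b \<tau> * h3 \<tau>)"
      "a (\<tau> + 1) * h2 (\<tau> + 1) = qe (of_int x1 / 6) * (a \<tau> * h2 \<tau>)"
      unfolding h3(2)[OF \<tau>] h2(2)[OF \<tau>] using aT[OF \<tau>] bT[OF \<tau>] cT[OF \<tau>] by (simp_all flip: mult.assoc)
    show ?thesis
      unfolding \<Phi>_def T_tri_diag vec_eq_iff forall_3 diag_mat_vector lift_simps[OF \<tau>] lift_simps[OF \<tau>1] *
      by (simp add: h1(2)[OF \<tau>] h2(2)[OF \<tau>] h3(2)[OF \<tau>] distrib_left)
  qed
  have nz: "\<exists>\<tau>\<in>UH. \<Phi> \<tau> $ i \<noteq> 0" for i
  proof -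
    have "\<forall>i. \<exists>\<tau>\<in>UH. \<Phi> \<tau> $ i \<noteq> 0"
      unfolding forall_3 \<Phi>_def using h1(3) h2(3) h3(3) lift_simps by (auto simp: add.assoc simp del: UH_iff)
    thus ?thesis by blast
  qed
  have indep: "M = N" if MN: "\<forall>\<tau>\<in>UH. M *v \<Phi> \<tau> = N *v \<Phi> \<tau>" for M N :: "complex^3^3"
  proof -
    have "M $ i $ j = N $ i $ j" for i j
    proof -
      define d where "d = (\<lambda>j. M $ i $ j - N $ i $ j)"
      define l where "l = (\<lambda>j. qe (of_int (xs j) / 6))"
      have sum0: "d 1 * \<Phi> \<tau> $ 1 + d 2 * \<Phi> \<tau> $ 2 + d 3 * \<Phi> \<tau> $ 3 = 0" if "\<tau> \<in> UH" for \<tau>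
        using arg_cong[OF MN[rule_format, OF that], of "\<lambda>v. v $ i"]
        by (simp add: matrix_vector_mult_def sum_3 d_def algebra_simps)
      have step: "\<Phi> (\<tau> + 1) $ j = l j * \<Phi> \<tau> $ j" if "\<tau> \<in> UH" for \<tau> j
        unfolding T[OF that] T_tri_diag diag_mat_vector l_def by simp
      have all: "d j * \<Phi> \<tau> $ j = 0" if \<tau>: "\<tau> \<in> UH" for \<tau> j
      proof -
        define y where "y = (\<lambda>j. d j * \<Phi> \<tau> $ j)"
        have \<tau>1: "\<tau> + 1 \<in> UH" "\<tau> + 1 + 1 \<in> UH" using \<tau> by auto
        have e0: "y 1 + y 2 + y 3 = 0" using sum0[OF \<tau>] by (simp add: y_def)
        have e1: "l 1 * y 1 + l 2 * y 2 + l 3 * y 3 = 0"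
          using sum0[OF \<tau>1(1)] unfolding step[OF \<tau>] by (simp add: y_def mult_ac)
        have e2: "l 1 * l 1 * y 1 + l 2 * l 2 * y 2 + l 3 * l 3 * y 3 = 0"
          using sum0[OF \<tau>1(2)] unfolding step[OF \<tau>1(1)] step[OF \<tau>] by (simp add: y_def mult_ac)
        have ne: "l 1 \<noteq> l 2" "l 1 \<noteq> l 3" "l 2 \<noteq> l 3"
          using qe_sixth_inj x by (force simp: l_def)+
        \<comment> \<open>Elimination in the Vandermonde system given by \<tau>, \<tau> + 1 and
          \<tau> + 2.\<close>
        have "(l 1 - l 2) * ((l 1 - l 3) * y 1) =
            (l 1 * l 1 * y 1 + l 2 * l 2 * y 2 + l 3 * l 3 * y 3) - (l 2 + l 3) * (l 1 * y 1 + l 2 * y 2 + l 3 * y 3)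
            + l 2 * l 3 * (y 1 + y 2 + y 3)" by (simp add: algebra_simps)
        hence y1: "y 1 = 0" using e0 e1 e2 ne by simp
        have "(l 2 - l 3) * y 2 = (l 1 * y 1 + l 2 * y 2 + l 3 * y 3) - l 3 * (y 1 + y 2 + y 3) - (l 1 - l 3) * y 1"
          by (simp add: algebra_simps)
        hence y2: "y 2 = 0" using e0 e1 y1 ne by simp
        hence "\<forall>j. y j = 0" unfolding forall_3 using e0 y1 by simp
        thus ?thesis by (simp add: y_def)
      qed
      obtain \<tau> where "\<tau> \<in> UH" "\<Phi> \<tau> $ j \<noteq> 0" using nz by blast
      thus ?thesis using all[of \<tau> j] by (simp add: d_def)
    qed
    thus ?thesis by (simp add: vec_eq_iff)
  qed
  have S: "\<Phi> (- 1 / \<tau>) = \<tau> powi 16 *s (S_tri *v \<Phi> \<tau>)" if "\<tau> \<in> UH" for \<tau>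
    unfolding \<Phi>_def by (rule lift_S[OF h1(1) h2(1) h3(1) that])
  show ?thesis using rep_from_functions[OF S T _ indep] by simp
qed

end

lemma q_exp_zero_ex: "\<exists>c. q_exp x c (\<lambda>\<tau>. 0)"
  using q_exp_zero by blast

locale triangular_rep = triangular_data +
  fixes \<rho> :: "int^2^2 \<Rightarrow> complex^3^3"
  assumes rep: "PSL2Z_rep \<rho>" and \<rho>S: "\<rho> S_mat = S_tri" and \<rho>T: "\<rho> T_mat = T_tri"
begin

lemma rep_SL2Z: "SL2Z_rep \<rho>"
  using rep by (simp add: PSL2Z_rep_def)

lemma forms_iff:
  "F \<in> modular_forms k \<rho> \<longleftrightarrow>
    (\<forall>\<tau>. \<tau> \<notin> UH \<longrightarrow> F \<tau> = 0) \<and>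
    (\<forall>\<tau>\<in>UH. F (- 1 / \<tau>) = \<tau> powi k *s (S_tri *v F \<tau>)) \<and>
    (\<forall>i. \<exists>c. q_exp (xs i) c (\<lambda>\<tau>. F \<tau> $ i))"
proof -
  have "0 \<le> xs i" "xs i < 6" for i using x by (auto simp: xs_def)
  moreover have "\<forall>i j. xs i = xs j \<longrightarrow> i = j" unfolding forall_3 xs_simps using x by auto
  hence "inj xs" by (auto simp: inj_def)
  ultimately show ?thesis
    using modular_forms_iff[OF rep_SL2Z, of xs F k] \<rho>T T_tri_diag \<rho>S by simp
qed

lemma lift_form:
  assumes "S_law k x1 h1" "S_law k x2 h2" "S_law k x3 h3"
    and "\<exists>e. q_exp x1 e (\<lambda>\<tau>. h1 \<tau> + a \<tau> * h2 \<tau> + b \<tau> * h3 \<tau>)"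
    and "\<exists>e. q_exp x2 e (\<lambda>\<tau>. h2 \<tau> + c \<tau> * h3 \<tau>)" and "\<exists>e. q_exp x3 e h3"
  shows "lift h1 h2 h3 \<in> modular_forms k \<rho>"
proof -
  have "\<exists>e. q_exp (xs i) e (\<lambda>\<tau>. lift h1 h2 h3 \<tau> $ i)" for i
  proof -
    have "\<forall>i. \<exists>e. q_exp (xs i) e (\<lambda>\<tau>. lift h1 h2 h3 \<tau> $ i)"
      unfolding forall_3 xs_simps using assms(4-6)
      using q_exp_cong[OF lift_simps(1)] q_exp_cong[OF lift_simps(2)] q_exp_cong[OF lift_simps(3)] by simp
    thus ?thesis by blast
  qed
  moreover have "lift h1 h2 h3 \<tau> = 0" if "\<tau> \<notin> UH" for \<tau> using that by (simp add: lift_def)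
  ultimately show ?thesis unfolding forms_iff using lift_S[OF assms(1-3)] by blast
qed

lemma form_cases:
  assumes "F \<in> modular_forms k \<rho>"
  obtains h1 h2 h3 where "F = lift h1 h2 h3" "S_law k x1 h1" "S_law k x2 h2" "S_law k x3 h3"
    "\<exists>e. q_exp x1 e (\<lambda>\<tau>. h1 \<tau> + a \<tau> * h2 \<tau> + b \<tau> * h3 \<tau>)"
    "\<exists>e. q_exp x2 e (\<lambda>\<tau>. h2 \<tau> + c \<tau> * h3 \<tau>)" "\<exists>e. q_exp x3 e h3"
proof -
  note F = assms[unfolded forms_iff]
  obtain h1 h2 h3 where h: "F = lift h1 h2 h3" "S_law k x1 h1" "S_law k x2 h2" "S_law k x3 h3"
    by (rule lift_S_converse[of F k]) (use F in blast)+
  have "\<forall>i. \<exists>e. q_exp (xs i) e (\<lambda>\<tau>. lift h1 h2 h3 \<tau> $ i)" using F h(1) by blast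
  thus ?thesis
    unfolding forall_3 xs_simps
    using that[OF h] q_exp_cong[OF lift_simps(1)] q_exp_cong[OF lift_simps(2)] q_exp_cong[OF lift_simps(3)] by simp
qed

section \<open>The exact sequence and the subrepresentation\<close>

lemma lower_zero:
  assumes "\<gamma> \<in> SL2Z"
  shows "\<rho> \<gamma> $ 2 $ 1 = 0 \<and> \<rho> \<gamma> $ 3 $ 1 = 0 \<and> \<rho> \<gamma> $ 3 $ 2 = 0"
  using assms
proof (induction rule: SL2Z_induct)
  case one
  thus ?case using SL2Z_rep_one[OF rep_SL2Z] by (simp add: mat_def)
next
  case (S A)
  thus ?case
    unfolding SL2Z_rep_mult[OF rep_SL2Z S_in_SL2Z S(1)] \<rho>S
    by (simp add: S_tri_def matrix_matrix_mult_def sum_3)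
next
  case (T A)
  thus ?case
    unfolding SL2Z_rep_mult[OF rep_SL2Z T_in_SL2Z T(1)] \<rho>T
    by (simp add: T_tri_def matrix_matrix_mult_def sum_3)
qed

lemma sub12_rep: "SL2Z_rep (sub12 \<rho>)"
  unfolding SL2Z_rep_def
proof (intro conjI ballI)
  show "sub12 \<rho> (mat 1) = mat 1"
    unfolding sub12_def SL2Z_rep_one[OF rep_SL2Z] by (simp add: mat_def vec_eq_iff forall_2 vector_2)
  fix A B :: "int^2^2" assume AB: "A \<in> SL2Z" "B \<in> SL2Z"
  show "sub12 \<rho> (A ** B) = sub12 \<rho> A ** sub12 \<rho> B"
    unfolding sub12_def SL2Z_rep_mult[OF rep_SL2Z AB] using lower_zero[OF AB(1)] lower_zero[OF AB(2)]
    by (simp add: matrix_matrix_mult_def vec_eq_iff forall_2 vector_2 sum_2 sum_3)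
qed

lemma quot3_rep: "SL2Z_rep (quot3 \<rho>)"
  unfolding SL2Z_rep_def
proof (intro conjI ballI)
  show "quot3 \<rho> (mat 1) = mat 1"
    unfolding quot3_def SL2Z_rep_one[OF rep_SL2Z] by (simp add: mat_def vec_eq_iff)
  fix A B :: "int^2^2" assume AB: "A \<in> SL2Z" "B \<in> SL2Z"
  show "quot3 \<rho> (A ** B) = quot3 \<rho> A ** quot3 \<rho> B"
    unfolding quot3_def SL2Z_rep_mult[OF rep_SL2Z AB] using lower_zero[OF AB(1)] lower_zero[OF AB(2)]
    by (simp add: matrix_matrix_mult_def vec_eq_iff sum_3 mat_def)
qed

lemma incl12_vector: "(incl12 *v v) $ 1 = v $ 1" "(incl12 *v v) $ 2 = v $ 2" "(incl12 *v v) $ 3 = 0"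
  by (simp_all add: incl12_def matrix_vector_mult_def sum_2 vector_2)

lemma proj3_vector: "(proj3 *v v) $ i = v $ 3"
proof -
  have "\<forall>i. (proj3 *v v) $ i = v $ 3"
    unfolding forall_1 by (simp add: proj3_def matrix_vector_mult_def sum_3)
  thus ?thesis by blast
qed

lemma exact: "exact_sequence (sub12 \<rho>) incl12 \<rho> proj3 (quot3 \<rho>)"
  unfolding exact_sequence_def
proof (intro conjI ballI sub12_rep rep_SL2Z quot3_rep)
  fix \<gamma> :: "int^2^2" assume \<gamma>: "\<gamma> \<in> SL2Z"
  show "incl12 ** sub12 \<rho> \<gamma> = \<rho> \<gamma> ** incl12"
    using lower_zero[OF \<gamma>]
    by (simp add: incl12_def sub12_def matrix_matrix_mult_def vec_eq_iff forall_2 forall_3 vector_2 sum_2 sum_3)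
  show "proj3 ** \<rho> \<gamma> = quot3 \<rho> \<gamma> ** proj3"
    using lower_zero[OF \<gamma>]
    by (simp add: proj3_def quot3_def matrix_matrix_mult_def vec_eq_iff forall_1 forall_3 sum_3 sum_1 mat_def)
next
  show "inj ((*v) incl12)"
  proof (rule injI)
    fix v w :: "complex^2" assume "incl12 *v v = incl12 *v w"
    thus "v = w" using incl12_vector[of v] incl12_vector[of w] by (simp add: vec_eq_iff forall_2)
  qed
  show "range ((*v) incl12) = {v. proj3 *v v = 0}"
  proof (intro equalityI subsetI)
    fix v assume "v \<in> {v. proj3 *v v = 0}"
    hence "v $ 3 = 0" using proj3_vector[of v 1] by simp
    hence "v = incl12 *v vector [v $ 1, v $ 2]"
      by (simp add: vec_eq_iff forall_3 incl12_vector vector_2)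
    thus "v \<in> range ((*v) incl12)" by blast
  qed (auto simp: vec_eq_iff proj3_vector incl12_vector)
  show "surj ((*v) proj3)"
  proof (rule surjI)
    show "proj3 *v vector [0, 0, w $ 1] = w" for w :: "complex^1"
      by (simp add: vec_eq_iff proj3_vector forall_1)
  qed
qed

lemma sub12_vector:
  "(sub12 \<rho> \<gamma> *v v) $ 1 = \<rho> \<gamma> $ 1 $ 1 * v $ 1 + \<rho> \<gamma> $ 1 $ 2 * v $ 2"
  "(sub12 \<rho> \<gamma> *v v) $ 2 = \<rho> \<gamma> $ 2 $ 1 * v $ 1 + \<rho> \<gamma> $ 2 $ 2 * v $ 2"
  by (simp_all add: sub12_def matrix_vector_mult_def sum_2 vector_2)

lemma reducible: "reducible_rep (sub12 \<rho>)"
proof -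
  define W where "W = {v :: complex^2. v $ 2 = 0}"
  have "invariant_subspace (sub12 \<rho>) W"
    unfolding invariant_subspace_def using lower_zero
    by (auto simp: W_def vec.subspace_def sub12_vector)
  moreover have "vector [1, 0] \<in> W" "vector [0, 1] \<notin> W" "vector [1, 0] \<noteq> (0 :: complex^2)"
    by (simp_all add: W_def vector_2 vec_eq_iff forall_2)
  ultimately show ?thesis unfolding reducible_rep_def by (intro exI[of _ W]) auto
qed

text \<open>An invariant subspace containing a vector outside the first axis contains the second basis
  vector, because \<open>T\<close> has distinct eigenvalues, and then, applying \<open>S\<close>, everything.\<close>

lemma indecomposable:
  assumes "n12 \<noteq> 0"
  shows "indecomposable_rep (sub12 \<rho>)"
proof -
  have axis: "v $ 2 = 0"
    if U: "invariant_subspace (sub12 \<rho>) U" "U \<noteq> UNIV" and v: "v \<in> U" for U and v :: "complex^2"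
  proof (rule ccontr)
    assume v2: "v $ 2 \<noteq> 0"
    have sub: "vec.subspace U" and inv: "\<And>\<gamma> v. \<gamma> \<in> SL2Z \<Longrightarrow> v \<in> U \<Longrightarrow> sub12 \<rho> \<gamma> *v v \<in> U"
      using U(1) by (auto simp: invariant_subspace_def)
    define l1 l2 where "l1 = qe (of_int x1 / 6)" and "l2 = qe (of_int x2 / 6)"
    have ne: "l1 \<noteq> l2" using qe_sixth_inj x by (auto simp: l1_def l2_def)
    define e2 :: "complex^2" where "e2 = vector [0, 1]"
    have "sub12 \<rho> T_mat *v v - l1 *s v = ((l2 - l1) * v $ 2) *s e2"
      by (simp add: vec_eq_iff forall_2 sub12_vector \<rho>T T_tri_def e2_def vector_2 l1_def l2_def algebra_simps)
    moreover have "sub12 \<rho> T_mat *v v - l1 *s v \<in> U"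
      using sub inv[OF T_in_SL2Z v] v by (intro vec.subspace_diff vec.subspace_scale)
    ultimately have "(1 / ((l2 - l1) * v $ 2)) *s (((l2 - l1) * v $ 2) *s e2) \<in> U"
      using sub vec.subspace_scale by metis
    hence e2: "e2 \<in> U" using ne v2 by simp
    define e1 :: "complex^2" where "e1 = vector [1, 0]"
    have "sub12 \<rho> S_mat *v e2 - (-1) powi x2 *s e2 = n12 *s e1"
      by (simp add: vec_eq_iff forall_2 sub12_vector \<rho>S S_tri_def e1_def e2_def vector_2)
    moreover have "sub12 \<rho> S_mat *v e2 - (-1) powi x2 *s e2 \<in> U"
      using sub inv[OF S_in_SL2Z e2] e2 by (intro vec.subspace_diff vec.subspace_scale)
    ultimately have "(1 / n12) *s (n12 *s e1) \<in> U" using sub vec.subspace_scale by metis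
    hence e1: "e1 \<in> U" using assms by simp
    have "w \<in> U" for w
    proof -
      have "w = (w $ 1) *s e1 + (w $ 2) *s e2"
        by (simp add: vec_eq_iff forall_2 e1_def e2_def vector_2)
      thus ?thesis using sub e1 e2 by (metis vec.subspace_add vec.subspace_scale)
    qed
    thus False using U(2) by blast
  qed
  show ?thesis
    unfolding indecomposable_rep_def
  proof (intro notI, elim exE conjE)
    fix U W assume U: "invariant_subspace (sub12 \<rho>) U" and W: "invariant_subspace (sub12 \<rho>) W"
      and nz: "U \<noteq> {0}" "W \<noteq> {0}" and int: "U \<inter> W = {0}" and sum: "\<forall>v. \<exists>u\<in>U. \<exists>w\<in>W. v = u + w"
    have "U \<noteq> UNIV" "W \<noteq> UNIV" using int nz by auto
    moreover obtain u w where "u \<in> U" "w \<in> W" "vector [0, 1] = u + w" using sum by blast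
    moreover from this(3) have "u $ 2 + w $ 2 = (1 :: complex)"
      by (metis vector_2(2) vector_add_component)
    ultimately show False using axis[OF U] axis[OF W] by simp
  qed
qed

lemma chi: "is_chi (2 * x3) (quot3 \<rho>)"
  unfolding is_chi_def
proof (intro conjI quot3_rep)
  have "2 * complex_of_real pi * \<i> * of_int (2 * x3) / 12 = 2 * of_real pi * \<i> * (of_int x3 / 6)" by simp
  thus "quot3 \<rho> T_mat = mat (exp (2 * of_real pi * \<i> * of_int (2 * x3) / 12))"
    by (simp add: quot3_def \<rho>T T_tri_def qe_def)
qed

section \<open>Forms for the quotient and criteria for splitting\<close>

lemma quot_forms_iff:
  "G \<in> modular_forms k (quot3 \<rho>) \<longleftrightarrow> (\<forall>\<tau>. \<tau> \<notin> UH \<longrightarrow> G \<tau> = 0) \<and> scalar_form k x3 (\<lambda>\<tau>. G \<tau> $ 1)"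
proof -
  have T: "quot3 \<rho> T_mat = diag_mat (\<lambda>i. qe (of_int x3 / 6))"
    by (simp add: quot3_def \<rho>T T_tri_def mat_eq_diag_mat)
  have "G \<in> modular_forms k (quot3 \<rho>) \<longleftrightarrow> (\<forall>\<tau>. \<tau> \<notin> UH \<longrightarrow> G \<tau> = 0) \<and>
      (\<forall>\<tau>\<in>UH. G (- 1 / \<tau>) = \<tau> powi k *s (quot3 \<rho> S_mat *v G \<tau>)) \<and> (\<forall>i. \<exists>c. q_exp x3 c (\<lambda>\<tau>. G \<tau> $ i))"
    by (rule modular_forms_iff[OF quot3_rep T]) (use x in \<open>auto simp: inj_def\<close>)
  moreover have "G (- 1 / \<tau>) = \<tau> powi k *s (quot3 \<rho> S_mat *v G \<tau>) \<longleftrightarrow>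
      G (- 1 / \<tau>) $ 1 = (-1) powi x3 * \<tau> powi k * G \<tau> $ 1" for \<tau>
    by (simp add: vec_eq_iff forall_1 quot3_def \<rho>S S_tri_def mat_eq_diag_mat diag_mat_vector mult_ac)
  ultimately show ?thesis by (simp add: scalar_form_def S_law_def forall_1)
qed

lemma proj3_lift: "\<tau> \<in> UH \<Longrightarrow> (proj3 *v lift h1 h2 h3 \<tau>) $ i = h3 \<tau>"
  by (simp add: proj3_vector lift_simps)

lemma proj3_form:
  assumes "F \<in> modular_forms k \<rho>"
  shows "(\<lambda>\<tau>. proj3 *v F \<tau>) \<in> modular_forms k (quot3 \<rho>)"
proof -
  obtain h1 h2 h3 where h: "F = lift h1 h2 h3" "S_law k x3 h3" "\<exists>e. q_exp x3 e h3"
    using form_cases[OF assms] by metis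
  have "scalar_form k x3 h3" using h by (simp add: scalar_form_def)
  moreover have "scalar_form k x3 (\<lambda>\<tau>. (proj3 *v F \<tau>) $ 1) \<longleftrightarrow> scalar_form k x3 h3"
    by (rule scalar_form_cong) (simp add: h(1) proj3_lift del: UH_iff)
  moreover have "proj3 *v F \<tau> = 0" if "\<tau> \<notin> UH" for \<tau> using that by (simp add: h(1) lift_def)
  ultimately show ?thesis unfolding quot_forms_iff by blast
qed

text \<open>The forms for the quotient are R times \<open>eta4\<close>^\<open>x3\<close>, so a lift
  of this generator, multiplied by r, reaches them all.\<close>

lemma M_split_if_generator_lifts:
  assumes mult: "\<And>k r. scalar_form (k - 2 * x3) 0 r \<Longrightarrow>
      lift (\<lambda>\<tau>. h1 \<tau> * r \<tau>) (\<lambda>\<tau>. h2 \<tau> * r \<tau>) (\<lambda>\<tau>. eta4 \<tau> powi x3 * r \<tau>) \<in> modular_forms k \<rho>"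
  shows "M_split \<rho> proj3 (quot3 \<rho>)"
proof (rule M_splitI)
  fix k G assume "G \<in> modular_forms k (quot3 \<rho>)"
  hence G: "\<And>\<tau>. \<tau> \<notin> UH \<Longrightarrow> G \<tau> = 0" "scalar_form k x3 (\<lambda>\<tau>. G \<tau> $ 1)"
    unfolding quot_forms_iff by auto
  obtain r where r: "scalar_form (k - 2 * x3) 0 r" "\<And>\<tau>. \<tau> \<in> UH \<Longrightarrow> G \<tau> $ 1 = eta4 \<tau> powi x3 * r \<tau>"
    using scalar_form_eta4_factor[OF G(2)] by blast
  let ?F = "lift (\<lambda>\<tau>. h1 \<tau> * r \<tau>) (\<lambda>\<tau>. h2 \<tau> * r \<tau>) (\<lambda>\<tau>. eta4 \<tau> powi x3 * r \<tau>)"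
  have "proj3 *v ?F \<tau> = G \<tau>" for \<tau>
  proof (cases "\<tau> \<in> UH")
    case True
    thus ?thesis using r(2) by (simp add: vec_eq_iff forall_1 proj3_lift del: UH_iff)
  next
    case False
    thus ?thesis using G(1) by (simp add: lift_def del: UH_iff)
  qed
  thus "\<exists>F\<in>modular_forms k \<rho>. (\<lambda>\<tau>. proj3 *v F \<tau>) = G" using mult[OF r(1)] by blast
qed (rule proj3_form)

text \<open>The constant 1 is a form of weight 0 for the quotient. A preimage need not be
  homogeneous, but directness of the sum over weights shows that its part of weight 0 would already
  map to 1.\<close>

lemma not_M_split:
  assumes x3: "x3 = 0" and zero: "\<And>F \<tau>. F \<in> modular_forms 0 \<rho> \<Longrightarrow> \<tau> \<in> UH \<Longrightarrow> F \<tau> $ 3 = 0"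
  shows "\<not> M_split \<rho> proj3 (quot3 \<rho>)"
proof
  assume "M_split \<rho> proj3 (quot3 \<rho>)"
  hence split: "(\<lambda>F \<tau>. proj3 *v F \<tau>) ` all_modular_forms \<rho> = all_modular_forms (quot3 \<rho>)"
    by (simp add: M_split_def)
  define G0 :: "complex \<Rightarrow> complex^1" where "G0 = (\<lambda>\<tau>. if \<tau> \<in> UH then vec 1 else 0)"
  have "scalar_form 0 0 (\<lambda>\<tau>. G0 \<tau> $ 1) \<longleftrightarrow> scalar_form 0 0 (\<lambda>\<tau>. 1)"
    by (rule scalar_form_cong) (simp add: G0_def)
  hence G0: "G0 \<in> modular_forms 0 (quot3 \<rho>)"
    unfolding quot_forms_iff x3 using scalar_form_const by (simp add: G0_def)
  have "G0 = (\<lambda>\<tau>. \<Sum>k\<in>{0}. G0 \<tau>)" by simp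
  hence "G0 \<in> all_modular_forms (quot3 \<rho>)" using all_modular_forms_I[of "{0}" "\<lambda>k. G0"] G0 by simp
  then obtain F where F: "F \<in> all_modular_forms \<rho>" "G0 = (\<lambda>\<tau>. proj3 *v F \<tau>)" using split by blast
  obtain K f where K: "finite K" "\<And>k. k \<in> K \<Longrightarrow> f k \<in> modular_forms k \<rho>" "F = (\<lambda>\<tau>. \<Sum>k\<in>K. f k \<tau>)"
    using all_modular_forms_E[OF F(1)] by metis
  \<comment> \<open>The homogeneous parts of the image minus the target. They sum to 0, so the one
    of weight 0 vanishes by \<open>modular_forms_sum_direct\<close>.\<close>
  define D where "D = (\<lambda>k \<tau>. (if k \<in> K then proj3 *v f k \<tau> else 0) - (if k = 0 then G0 \<tau> else 0))"
  have D: "D k \<in> modular_forms k (quot3 \<rho>)" if "k \<in> insert 0 K" for k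
  proof -
    have P: "(\<forall>\<tau>. \<tau> \<notin> UH \<longrightarrow> (if k \<in> K then proj3 *v f k \<tau> else 0) = 0) \<and>
        scalar_form k x3 (\<lambda>\<tau>. (if k \<in> K then proj3 *v f k \<tau> else 0) $ 1)"
      using proj3_form[OF K(2), unfolded quot_forms_iff] scalar_form_zero[of k x3] by (cases "k \<in> K") simp_all
    have Q: "(\<forall>\<tau>. \<tau> \<notin> UH \<longrightarrow> (if k = 0 then G0 \<tau> else 0) = 0) \<and>
        scalar_form k x3 (\<lambda>\<tau>. (if k = 0 then G0 \<tau> else 0) $ 1)"
      using G0[unfolded quot_forms_iff] scalar_form_zero[of k x3] by (cases "k = 0") simp_all
    have "scalar_form k x3 (\<lambda>\<tau>. (if k \<in> K then proj3 *v f k \<tau> else 0) $ 1 - (if k = 0 then G0 \<tau> else 0) $ 1)"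
      using P Q by (intro scalar_form_diff) auto
    thus ?thesis unfolding quot_forms_iff D_def using P Q by (simp del: UH_iff)
  qed
  have "D 0 = (\<lambda>\<tau>. 0)"
  proof (rule modular_forms_sum_direct[OF quot3_rep _ D])
    fix \<tau>
    have "(\<Sum>k\<in>insert 0 K. D k \<tau>) = (\<Sum>k\<in>insert 0 K. if k \<in> K then proj3 *v f k \<tau> else 0) - (\<Sum>k\<in>insert 0 K. if k = 0 then G0 \<tau> else 0)"
      unfolding D_def by (rule sum_subtractf)
    also have "(\<Sum>k\<in>insert 0 K. if k = 0 then G0 \<tau> else 0) = G0 \<tau>" using K(1) by simp
    also have "(\<Sum>k\<in>insert 0 K. if k \<in> K then proj3 *v f k \<tau> else 0) = (\<Sum>k\<in>K. proj3 *v f k \<tau>)"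
      using K(1) by (intro sum.mono_neutral_cong_right) auto
    also have "\<dots> = G0 \<tau>" by (simp add: F(2) K(3) vec.sum)
    finally show "(\<Sum>k\<in>insert 0 K. D k \<tau>) = 0" by simp
  qed (use K(1) in auto)
  hence "D 0 \<i> $ 1 = 0" by simp
  moreover have "(if 0 \<in> K then proj3 *v f 0 \<i> else 0) $ (1::1) = 0"
    using zero[OF K(2), of \<i>] by (simp add: proj3_vector)
  ultimately show False by (simp add: D_def G0_def)
qed

text \<open>The hypotheses are the cusp conditions for the columns of the unipotent matrix. The
  coefficients of a form are peeled off from the third component upwards: each entry times a known
  component has the right order, so the next component does too.\<close>

lemma split_case:
  assumes a: "\<exists>e. q_exp x1 e (\<lambda>\<tau>. a \<tau> * eta4 \<tau> powi x2)" and b: "\<exists>e. q_exp x1 e (\<lambda>\<tau>. b \<tau> * eta4 \<tau> powi x3)"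
    and c: "\<exists>e. q_exp x2 e (\<lambda>\<tau>. c \<tau> * eta4 \<tau> powi x3)"
  shows "M_split \<rho> proj3 (quot3 \<rho>)" "generating_weights \<rho> {#2 * x1, 2 * x2, 2 * x3#}"
proof -
  define e where "e = (\<lambda>x \<tau>. eta4 \<tau> powi x)"
  have eS: "S_law (2 * x) x (e x)" and eq: "\<exists>d. q_exp x d (e x)" and e0: "\<tau> \<in> UH \<Longrightarrow> e x \<tau> \<noteq> 0" for x \<tau>
    using eta4_powi[of x] eta4_nonzero by (auto simp: e_def scalar_form_def)
  have mult: "lift (\<lambda>\<tau>. 0 * r \<tau>) (\<lambda>\<tau>. 0 * r \<tau>) (\<lambda>\<tau>. e x3 \<tau> * r \<tau>) \<in> modular_forms k \<rho>"
    if r: "scalar_form (k - 2 * x3) 0 r" for k r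
  proof (rule lift_form)
    obtain d0 where r': "S_law (k - 2 * x3) 0 r" "q_exp 0 d0 r" using r by (auto simp: scalar_form_def)
    show "S_law k x1 (\<lambda>\<tau>. 0 * r \<tau>)" "S_law k x2 (\<lambda>\<tau>. 0 * r \<tau>)" by (simp_all add: S_law_zero)
    show "S_law k x3 (\<lambda>\<tau>. e x3 \<tau> * r \<tau>)" using S_law_mult[OF eS[of x3] r'(1)] by simp
    show "\<exists>d. q_exp x1 d (\<lambda>\<tau>. 0 * r \<tau> + a \<tau> * (0 * r \<tau>) + b \<tau> * (e x3 \<tau> * r \<tau>))"
      using b q_exp_mult[OF _ r'(2), of x1] by (force simp: e_def mult.assoc)
    show "\<exists>d. q_exp x2 d (\<lambda>\<tau>. 0 * r \<tau> + c \<tau> * (e x3 \<tau> * r \<tau>))"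
      using c q_exp_mult[OF _ r'(2), of x2] by (force simp: e_def mult.assoc)
    show "\<exists>d. q_exp x3 d (\<lambda>\<tau>. e x3 \<tau> * r \<tau>)"
      using eq q_exp_mult[OF _ r'(2), of x3] by (force simp: e_def)
  qed
  have B3: "lift (\<lambda>\<tau>. 0) (\<lambda>\<tau>. 0) (e x3) \<in> modular_forms (2 * x3) \<rho>"
    using mult[of "2 * x3" "\<lambda>\<tau>. 1"] scalar_form_const by simp
  show "M_split \<rho> proj3 (quot3 \<rho>)"
    by (rule M_split_if_generator_lifts[of "\<lambda>\<tau>. 0" "\<lambda>\<tau>. 0"]) (use mult in \<open>simp add: e_def\<close>)
  have B2: "lift (\<lambda>\<tau>. 0) (e x2) (\<lambda>\<tau>. 0) \<in> modular_forms (2 * x2) \<rho>"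
    by (rule lift_form) (use a eS[of x2] eq[of x2] in \<open>simp_all add: e_def S_law_zero q_exp_zero_ex\<close>)
  have B1: "lift (e x1) (\<lambda>\<tau>. 0) (\<lambda>\<tau>. 0) \<in> modular_forms (2 * x1) \<rho>"
    by (rule lift_form) (use eS[of x1] eq[of x1] in \<open>simp_all add: S_law_zero q_exp_zero_ex\<close>)
  show "generating_weights \<rho> {#2 * x1, 2 * x2, 2 * x3#}"
  proof (rule generating_weights_three[OF B1 B2 B3])
    fix k F assume "F \<in> modular_forms k \<rho>"
    then obtain h1 h2 h3 where h: "F = lift h1 h2 h3" "S_law k x1 h1" "S_law k x2 h2" "S_law k x3 h3"
      and q: "\<exists>e. q_exp x1 e (\<lambda>\<tau>. h1 \<tau> + a \<tau> * h2 \<tau> + b \<tau> * h3 \<tau>)"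
      "\<exists>e. q_exp x2 e (\<lambda>\<tau>. h2 \<tau> + c \<tau> * h3 \<tau>)" "\<exists>e. q_exp x3 e h3"
      by (rule form_cases)
    have factor: "\<exists>r. scalar_form (k - 2 * x) 0 r \<and> (\<forall>\<tau>\<in>UH. h \<tau> = e x \<tau> * r \<tau>)"
      if "S_law k x h" "\<exists>d. q_exp x d h" for x h
    proof -
      have "scalar_form k x h" using that by (simp add: scalar_form_def)
      then obtain r where "scalar_form (k - 2 * x) 0 r" "\<And>\<tau>. \<tau> \<in> UH \<Longrightarrow> h \<tau> = eta4 \<tau> powi x * r \<tau>"
        by (rule scalar_form_eta4_factor) blast
      thus ?thesis unfolding e_def by blast
    qed
    have absorb: "\<exists>d. q_exp y d (\<lambda>\<tau>. m \<tau> * h \<tau>)"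
      if m: "\<exists>d. q_exp y d (\<lambda>\<tau>. m \<tau> * e x \<tau>)" and r: "scalar_form l 0 r" "\<forall>\<tau>\<in>UH. h \<tau> = e x \<tau> * r \<tau>" for y m h x l r
    proof -
      obtain d d' where "q_exp y d (\<lambda>\<tau>. m \<tau> * e x \<tau>)" "q_exp 0 d' r" using m r(1) by (auto simp: scalar_form_def)
      from q_exp_mult[OF this] have "q_exp y (d * d') (\<lambda>\<tau>. m \<tau> * e x \<tau> * r \<tau>)" by simp
      also have "?this \<longleftrightarrow> q_exp y (d * d') (\<lambda>\<tau>. m \<tau> * h \<tau>)"
        by (rule q_exp_cong) (use r(2) in \<open>simp add: mult.assoc del: UH_iff\<close>)
      finally show ?thesis by blast
    qed
    obtain r3 where r3: "scalar_form (k - 2 * x3) 0 r3" "\<forall>\<tau>\<in>UH. h3 \<tau> = e x3 \<tau> * r3 \<tau>"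
      using factor[OF h(4) q(3)] by blast
    have bc: "\<exists>d. q_exp x1 d (\<lambda>\<tau>. b \<tau> * h3 \<tau>)" "\<exists>d. q_exp x2 d (\<lambda>\<tau>. c \<tau> * h3 \<tau>)"
      using absorb[OF _ r3] b c by (auto simp: e_def)
    have "\<exists>d. q_exp x2 d h2"
      using q(2) bc(2) q_exp_diff[of x2 _ "\<lambda>\<tau>. h2 \<tau> + c \<tau> * h3 \<tau>" _ "\<lambda>\<tau>. c \<tau> * h3 \<tau>"] by auto
    then obtain r2 where r2: "scalar_form (k - 2 * x2) 0 r2" "\<forall>\<tau>\<in>UH. h2 \<tau> = e x2 \<tau> * r2 \<tau>"
      using factor[OF h(3)] by blast
    have a': "\<exists>d. q_exp x1 d (\<lambda>\<tau>. a \<tau> * h2 \<tau>)" using absorb[OF _ r2] a by (auto simp: e_def)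
    obtain d1 d2 d3 where "q_exp x1 d1 (\<lambda>\<tau>. h1 \<tau> + a \<tau> * h2 \<tau> + b \<tau> * h3 \<tau>)"
      "q_exp x1 d2 (\<lambda>\<tau>. a \<tau> * h2 \<tau>)" "q_exp x1 d3 (\<lambda>\<tau>. b \<tau> * h3 \<tau>)" using q(1) a' bc(1) by blast
    from q_exp_diff[OF q_exp_diff[OF this(1,3)] this(2)] have "q_exp x1 (d1 - d3 - d2) h1" by simp
    then obtain r1 where r1: "scalar_form (k - 2 * x1) 0 r1" "\<forall>\<tau>\<in>UH. h1 \<tau> = e x1 \<tau> * r1 \<tau>"
      using factor[OF h(2)] by blast
    have "\<forall>\<tau>\<in>UH. F \<tau> = r1 \<tau> *s lift (e x1) (\<lambda>\<tau>. 0) (\<lambda>\<tau>. 0) \<tau> + r2 \<tau> *s lift (\<lambda>\<tau>. 0) (e x2) (\<lambda>\<tau>. 0) \<tau>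
        + r3 \<tau> *s lift (\<lambda>\<tau>. 0) (\<lambda>\<tau>. 0) (e x3) \<tau>"
    proof
      fix \<tau> assume \<tau>: "\<tau> \<in> UH"
      thus "F \<tau> = r1 \<tau> *s lift (e x1) (\<lambda>\<tau>. 0) (\<lambda>\<tau>. 0) \<tau> + r2 \<tau> *s lift (\<lambda>\<tau>. 0) (e x2) (\<lambda>\<tau>. 0) \<tau>
        + r3 \<tau> *s lift (\<lambda>\<tau>. 0) (\<lambda>\<tau>. 0) (e x3) \<tau>"
        using r1(2) r2(2) r3(2) unfolding h(1)
        by (simp add: vec_eq_iff forall_3 lift_simps algebra_simps del: UH_iff)
    qed
    thus "\<exists>r1 r2 r3. scalar_form (k - 2 * x1) 0 r1 \<and> scalar_form (k - 2 * x2) 0 r2 \<and> scalar_form (k - 2 * x3) 0 r3 \<and>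
        (\<forall>\<tau>\<in>UH. F \<tau> = r1 \<tau> *s lift (e x1) (\<lambda>\<tau>. 0) (\<lambda>\<tau>. 0) \<tau> + r2 \<tau> *s lift (\<lambda>\<tau>. 0) (e x2) (\<lambda>\<tau>. 0) \<tau>
          + r3 \<tau> *s lift (\<lambda>\<tau>. 0) (\<lambda>\<tau>. 0) (e x3) \<tau>)" using r1(1) r2(1) r3(1) by blast
  next
    fix \<tau> y1 y2 y3 assume \<tau>: "\<tau> \<in> UH"
      and "y1 *s lift (e x1) (\<lambda>\<tau>. 0) (\<lambda>\<tau>. 0) \<tau> + y2 *s lift (\<lambda>\<tau>. 0) (e x2) (\<lambda>\<tau>. 0) \<tau>
        + y3 *s lift (\<lambda>\<tau>. 0) (\<lambda>\<tau>. 0) (e x3) \<tau> = 0"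
    thus "y1 = 0 \<and> y2 = 0 \<and> y3 = 0"
      using e0[OF \<tau>] by (auto simp: vec_eq_iff forall_3 lift_simps simp del: UH_iff)
  qed
qed

end

section \<open>The exceptional cases\<close>

text \<open>Between -2 and the required exponent 4 lies exactly one power of q, so cancelling a
  single coefficient is enough.\<close>

lemma pole_of_order_2_cancellation:
  assumes "\<exists>m. q_exp (- 2) m \<psi>" and N: "S_law k 4 N" "q_exp (- 2) e N" "e \<noteq> 0"
  shows "\<exists>s. S_law k 4 s \<and> (\<exists>d. q_exp 4 d (\<lambda>\<tau>. s \<tau> + \<psi> \<tau>))"
proof -
  obtain m where m: "q_exp (- 2) m \<psi>" using assms(1) by blast
  have "q_exp (- 2) (- m / e * e + m) (\<lambda>\<tau>. - m / e * N \<tau> + \<psi> \<tau>)"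
    by (intro q_exp_add q_exp_cmult N m)
  hence "q_exp (- 2) 0 (\<lambda>\<tau>. - m / e * N \<tau> + \<psi> \<tau>)" using N(3) by simp
  from q_exp_raise[OF this] have "\<exists>d. q_exp 4 d (\<lambda>\<tau>. - m / e * N \<tau> + \<psi> \<tau>)" by simp
  moreover have "S_law k 4 (\<lambda>\<tau>. - m / e * N \<tau>)" by (intro S_law_cmult N)
  ultimately show ?thesis by (intro exI[of _ "\<lambda>\<tau>. - m / e * N \<tau>"]) simp
qed

text \<open>Supplies the first components of the lifts for (4,5,0), whose first row contains 2v and
  v^2. The poles are removed by multiples of \<open>E4\<close>^2 / \<open>eta4\<close>^2 and
  \<open>E4\<close> \<open>E6\<close> / \<open>eta4\<close>^2, of weights 4 and 6.\<close>

lemma eich_square_pole_cancellation: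
  obtains s4 s6 where "S_law 4 4 s4" "S_law 6 4 s6"
    "\<exists>d. q_exp 4 d (\<lambda>\<tau>. s4 \<tau> + (2 * eich 1 \<tau> * pol4 \<tau> + eich 1 \<tau> ^ 2 * E4 \<tau>))"
    "\<exists>d. q_exp 4 d (\<lambda>\<tau>. s6 \<tau> + (2 * eich 1 \<tau> * pol6 \<tau> + eich 1 \<tau> ^ 2 * E6 \<tau>))"
proof -
  obtain d where d: "q_exp (- 1) d (eich 1)" using eich_properties(1)[of 1] by auto
  have d2: "q_exp (- 2) (d ^ 2) (\<lambda>\<tau>. eich 1 \<tau> ^ 2)" using q_exp_power[OF d, of 2] by simp
  obtain e where e: "e \<noteq> 0" "q_exp (- 1) (inverse e) (\<lambda>\<tau>. inverse (eta4 \<tau>))" using eta4_properties by metis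
  have i2: "q_exp (- 2) (inverse e ^ 2) (\<lambda>\<tau>. inverse (eta4 \<tau>) ^ 2)" using q_exp_power[OF e(2), of 2] by simp
  have iS: "S_law (- 4) (- 2) (\<lambda>\<tau>. inverse (eta4 \<tau>) ^ 2)"
    using S_law_power[of "- 2" "- 1" _ 2] eta4_inverse_form by (simp add: scalar_form_def)
  note E2 = q_exp_power[OF eisenstein_forms(2), of 2] S_law_power[OF eisenstein_forms(1), of 2]
  have p4: "\<exists>m. q_exp (- 1) m pol4" and p6: "\<exists>m. q_exp (- 1) m pol6"
    unfolding pol4_def[abs_def] pol6_def[abs_def]
    using q_exp_cmult[OF q_exp_mult[OF eisenstein_forms(4) e(2)], of "- eich_c"]
          q_exp_cmult[OF q_exp_mult[OF E2(1) e(2)], of "- eich_c"] by auto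
  have psi: "\<exists>m. q_exp (- 2) m (\<lambda>\<tau>. 2 * eich 1 \<tau> * p \<tau> + eich 1 \<tau> ^ 2 * E \<tau>)"
    if p: "\<exists>m. q_exp (- 1) m p" and E: "q_exp 0 1 E" for p E
  proof -
    obtain m where m: "q_exp (- 1) m p" using p by blast
    from q_exp_add[OF _ q_exp_mult[OF d2 E], of "2 * d * m" "\<lambda>\<tau>. 2 * eich 1 \<tau> * p \<tau>"]
      q_exp_mult[OF q_exp_cmult[OF d, of 2] m]
    show ?thesis by auto
  qed
  have "S_law 4 (- 2) (\<lambda>\<tau>. E4 \<tau> ^ 2 * inverse (eta4 \<tau>) ^ 2)" using S_law_mult[OF E2(2) iS] by simp
  hence N4: "S_law 4 4 (\<lambda>\<tau>. E4 \<tau> ^ 2 * inverse (eta4 \<tau>) ^ 2)" by (rule S_law_parity) simp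
  have N4': "q_exp (- 2) (inverse e ^ 2) (\<lambda>\<tau>. E4 \<tau> ^ 2 * inverse (eta4 \<tau>) ^ 2)" using q_exp_mult[OF E2(1) i2] by simp
  have "S_law 6 (- 2) (\<lambda>\<tau>. E4 \<tau> * E6 \<tau> * inverse (eta4 \<tau>) ^ 2)"
    using S_law_mult[OF S_law_mult[OF eisenstein_forms(1,3)] iS] by simp
  hence N6: "S_law 6 4 (\<lambda>\<tau>. E4 \<tau> * E6 \<tau> * inverse (eta4 \<tau>) ^ 2)" by (rule S_law_parity) simp
  have N6': "q_exp (- 2) (inverse e ^ 2) (\<lambda>\<tau>. E4 \<tau> * E6 \<tau> * inverse (eta4 \<tau>) ^ 2)"
    using q_exp_mult[OF q_exp_mult[OF eisenstein_forms(2,4)] i2] by simp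
  have e2: "inverse e ^ 2 \<noteq> 0" using e(1) by simp
  show ?thesis
    using pole_of_order_2_cancellation[OF psi[OF p4 eisenstein_forms(2)] N4 N4' e2]
      pole_of_order_2_cancellation[OF psi[OF p6 eisenstein_forms(4)] N6 N6' e2] that by blast
qed

lemma scalar_formI: "S_law k x f \<Longrightarrow> \<exists>c. q_exp x c f \<Longrightarrow> scalar_form k x f"
  by (simp add: scalar_form_def)

lemma scalar_formD: "scalar_form k x f \<Longrightarrow> S_law k x f" "scalar_form k x f \<Longrightarrow> \<exists>c. q_exp x c f"
  by (simp_all add: scalar_form_def)

lemma q_exp_ex_diff: "\<exists>c. q_exp x c f \<Longrightarrow> \<exists>c. q_exp x c g \<Longrightarrow> \<exists>c. q_exp x c (\<lambda>\<tau>. f \<tau> - g \<tau>)"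
  using q_exp_diff by blast

lemma q_exp_ex_mult: "\<exists>c. q_exp x c f \<Longrightarrow> \<exists>c. q_exp y c g \<Longrightarrow> \<exists>c. q_exp (x + y) c (\<lambda>\<tau>. f \<tau> * g \<tau>)"
  using q_exp_mult by blast

lemma q_exp_ex_cong: "\<exists>c. q_exp x c f \<Longrightarrow> (\<And>\<tau>. \<tau> \<in> UH \<Longrightarrow> f \<tau> = g \<tau>) \<Longrightarrow> \<exists>c. q_exp x c g"
  using q_exp_cong by blast

lemma eich_q_exp: "d \<in> {1, - 1} \<Longrightarrow> \<exists>c. q_exp (- d) c (eich d)"
  using eich_properties(1) by blast

context triangular_rep
begin

text \<open>The middle exponent is harmless: u times a function of order 4 has order 5. So
  \<open>eta4\<close>^4 splits off with weight 8, and components 1 and 3 form the pair treated in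
  \<open>eich_pair_decomposition\<close>.\<close>

lemma exceptional_540:
  assumes x: "x1 = 5" "x2 = 4" "x3 = 0" and abc: "a = eich (- 1)" "b = eich 1" "c = (\<lambda>\<tau>. 0)"
  shows "\<not> M_split \<rho> proj3 (quot3 \<rho>)" "generating_weights \<rho> {#4, 6, 8#}"
proof -
  define e where "e = (\<lambda>\<tau>. eta4 \<tau> powi 4)"
  have e: "scalar_form 8 4 e" "\<And>\<tau>. \<tau> \<in> UH \<Longrightarrow> e \<tau> \<noteq> 0"
    using eta4_powi[of 4] eta4_nonzero by (auto simp: e_def)
  have c0: "c \<tau> = 0" for \<tau> by (simp add: abc)
  have a4: "\<exists>d. q_exp 5 d (\<lambda>\<tau>. a \<tau> * h \<tau>)" if "\<exists>d. q_exp 4 d h" for h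
    using q_exp_ex_mult[OF eich_q_exp[of "- 1"] that] by (simp add: abc)
  have decomp: "\<exists>A B r. scalar_form (k - 4) 0 A \<and> scalar_form (k - 6) 0 B \<and> scalar_form (k - 8) 0 r \<and>
      (\<forall>\<tau>\<in>UH. F \<tau> = A \<tau> *s lift pol4 (\<lambda>\<tau>. 0) E4 \<tau> + B \<tau> *s lift pol6 (\<lambda>\<tau>. 0) E6 \<tau>
          + r \<tau> *s lift (\<lambda>\<tau>. 0) e (\<lambda>\<tau>. 0) \<tau>)"
    if F: "F \<in> modular_forms k \<rho>" for F k
  proof -
    obtain h1 h2 h3 where h: "F = lift h1 h2 h3" "S_law k x1 h1" "S_law k x2 h2" "S_law k x3 h3"
      and q: "\<exists>e. q_exp x1 e (\<lambda>\<tau>. h1 \<tau> + a \<tau> * h2 \<tau> + b \<tau> * h3 \<tau>)"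
      "\<exists>e. q_exp x2 e (\<lambda>\<tau>. h2 \<tau> + c \<tau> * h3 \<tau>)" "\<exists>e. q_exp x3 e h3"
      by (rule form_cases[OF F])
    have h2: "scalar_form k 4 h2" using h(3) q(2) by (intro scalar_formI) (simp_all add: x abc)
    then obtain r where r: "scalar_form (k - 8) 0 r" "\<And>\<tau>. \<tau> \<in> UH \<Longrightarrow> h2 \<tau> = e \<tau> * r \<tau>"
      using scalar_form_eta4_factor[OF h2] by (auto simp: e_def)
    have h3: "scalar_form k 0 h3" using h(4) q(3) by (intro scalar_formI) (simp_all add: x)
    have "\<exists>d. q_exp 5 d (\<lambda>\<tau>. h1 \<tau> + eich 1 \<tau> * h3 \<tau>)"
      by (rule q_exp_ex_cong[OF q_exp_ex_diff[OF q(1)[unfolded x] a4[OF scalar_formD(2)[OF h2]]]]) (simp add: abc)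
    moreover have "S_law k 5 h1" using h(2) by (simp add: x)
    ultimately obtain A B where AB: "scalar_form (k - 4) 0 A" "scalar_form (k - 6) 0 B"
      and h3AB: "\<And>\<tau>. \<tau> \<in> UH \<Longrightarrow> h3 \<tau> = E4 \<tau> * A \<tau> + E6 \<tau> * B \<tau>"
      and h1AB: "\<And>\<tau>. \<tau> \<in> UH \<Longrightarrow> h1 \<tau> = pol4 \<tau> * A \<tau> + pol6 \<tau> * B \<tau>"
      using eich_pair_decomposition[OF _ h3, of h1] by blast
    show ?thesis
      using AB r(1) by (rule_tac exI[of _ A], rule_tac exI[of _ B], rule_tac exI[of _ r])
        (auto simp: h(1) vec_eq_iff forall_3 lift_simps h1AB r(2) h3AB c0 algebra_simps simp del: UH_iff)
  qed
  have B4: "lift pol4 (\<lambda>\<tau>. 0) E4 \<in> modular_forms 4 \<rho>" and B6: "lift pol6 (\<lambda>\<tau>. 0) E6 \<in> modular_forms 6 \<rho>"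
    by (rule lift_form; use pol4_S pol6_S pol4_q_exp pol6_q_exp eisenstein_forms in
        \<open>auto simp: x abc S_law_zero q_exp_zero_ex\<close>)+
  have B8: "lift (\<lambda>\<tau>. 0) e (\<lambda>\<tau>. 0) \<in> modular_forms 8 \<rho>"
    by (rule lift_form; use scalar_formD[OF e(1)] a4[of e] in \<open>auto simp: x abc S_law_zero q_exp_zero_ex\<close>)
  show "\<not> M_split \<rho> proj3 (quot3 \<rho>)"
  proof (rule not_M_split[OF x(3)])
    fix F \<tau> assume F: "F \<in> modular_forms 0 \<rho>" and \<tau>: "\<tau> \<in> UH"
    obtain A B r where AB: "scalar_form (0 - 4) 0 A" "scalar_form (0 - 6) 0 B"
      "\<forall>\<tau>\<in>UH. F \<tau> = A \<tau> *s lift pol4 (\<lambda>\<tau>. 0) E4 \<tau> + B \<tau> *s lift pol6 (\<lambda>\<tau>. 0) E6 \<tau>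
        + r \<tau> *s lift (\<lambda>\<tau>. 0) e (\<lambda>\<tau>. 0) \<tau>"
      using decomp[OF F] by blast
    have "A \<tau> = 0" "B \<tau> = 0"
      using scalar_form_negative_weight[OF AB(1) _ \<tau>] scalar_form_negative_weight[OF AB(2) _ \<tau>] by simp_all
    thus "F \<tau> $ 3 = 0" using AB(3) \<tau> by (simp add: lift_simps del: UH_iff)
  qed
  show "generating_weights \<rho> {#4, 6, 8#}"
  proof (rule generating_weights_three[OF B4 B6 B8])
    fix \<tau> y1 y2 y3 assume \<tau>: "\<tau> \<in> UH"
      and 0: "y1 *s lift pol4 (\<lambda>\<tau>. 0) E4 \<tau> + y2 *s lift pol6 (\<lambda>\<tau>. 0) E6 \<tau> + y3 *s lift (\<lambda>\<tau>. 0) e (\<lambda>\<tau>. 0) \<tau> = 0"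
    have c3: "y1 * E4 \<tau> + y2 * E6 \<tau> = 0" and c2: "y3 = 0"
      using 0 e(2)[OF \<tau>] by (auto simp: vec_eq_iff forall_3 lift_simps[OF \<tau>] c0)
    have "y1 * (pol4 \<tau> + b \<tau> * E4 \<tau>) + y2 * (pol6 \<tau> + b \<tau> * E6 \<tau>) = 0"
      using 0 c2 by (simp add: vec_eq_iff forall_3 lift_simps[OF \<tau>] c0)
    moreover have "y1 * (pol4 \<tau> + b \<tau> * E4 \<tau>) + y2 * (pol6 \<tau> + b \<tau> * E6 \<tau>) =
        y1 * pol4 \<tau> + y2 * pol6 \<tau> + b \<tau> * (y1 * E4 \<tau> + y2 * E6 \<tau>)" by (simp add: algebra_simps)
    ultimately have "y1 * pol4 \<tau> + y2 * pol6 \<tau> = 0" using c3 by simp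
    thus "y1 = 0 \<and> y2 = 0 \<and> y3 = 0" using pol_independent[OF \<tau> c3] c2 by blast
  qed (rule decomp)
qed

text \<open>Here components 2 and 3 form the pair. Subtracting the lifts completed by
  \<open>s4\<close> and \<open>s6\<close> leaves a form in the first component only, a multiple of
  \<open>eta4\<close>^4.\<close>

lemma exceptional_450:
  assumes x: "x1 = 4" "x2 = 5" "x3 = 0"
    and abc: "a = (\<lambda>\<tau>. 2 * eich 1 \<tau>)" "b = (\<lambda>\<tau>. eich 1 \<tau> ^ 2)" "c = eich 1"
  shows "\<not> M_split \<rho> proj3 (quot3 \<rho>)" "generating_weights \<rho> {#4, 6, 8#}"
proof -
  define e where "e = (\<lambda>\<tau>. eta4 \<tau> powi 4)"
  have e: "scalar_form 8 4 e" "\<And>\<tau>. \<tau> \<in> UH \<Longrightarrow> e \<tau> \<noteq> 0"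
    using eta4_powi[of 4] eta4_nonzero by (auto simp: e_def)
  obtain s4 s6 where sS: "S_law 4 4 s4" "S_law 6 4 s6"
    and s4: "\<exists>d. q_exp 4 d (\<lambda>\<tau>. s4 \<tau> + (2 * eich 1 \<tau> * pol4 \<tau> + eich 1 \<tau> ^ 2 * E4 \<tau>))"
    and s6: "\<exists>d. q_exp 4 d (\<lambda>\<tau>. s6 \<tau> + (2 * eich 1 \<tau> * pol6 \<tau> + eich 1 \<tau> ^ 2 * E6 \<tau>))"
    by (rule eich_square_pole_cancellation)
  have decomp: "\<exists>A B r. scalar_form (k - 4) 0 A \<and> scalar_form (k - 6) 0 B \<and> scalar_form (k - 8) 0 r \<and>
      (\<forall>\<tau>\<in>UH. F \<tau> = A \<tau> *s lift s4 pol4 E4 \<tau> + B \<tau> *s lift s6 pol6 E6 \<tau>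
          + r \<tau> *s lift e (\<lambda>\<tau>. 0) (\<lambda>\<tau>. 0) \<tau>)"
    if F: "F \<in> modular_forms k \<rho>" for F k
  proof -
    obtain h1 h2 h3 where h: "F = lift h1 h2 h3" "S_law k x1 h1" "S_law k x2 h2" "S_law k x3 h3"
      and q: "\<exists>e. q_exp x1 e (\<lambda>\<tau>. h1 \<tau> + a \<tau> * h2 \<tau> + b \<tau> * h3 \<tau>)"
      "\<exists>e. q_exp x2 e (\<lambda>\<tau>. h2 \<tau> + c \<tau> * h3 \<tau>)" "\<exists>e. q_exp x3 e h3"
      by (rule form_cases[OF F])
    have h3: "scalar_form k 0 h3" using h(4) q(3) by (intro scalar_formI) (simp_all add: x)
    have h2: "S_law k 5 h2" "\<exists>d. q_exp 5 d (\<lambda>\<tau>. h2 \<tau> + eich 1 \<tau> * h3 \<tau>)"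
      using h(3) q(2) by (simp_all add: x abc)
    obtain A B where AB: "scalar_form (k - 4) 0 A" "scalar_form (k - 6) 0 B"
      and h3AB: "\<And>\<tau>. \<tau> \<in> UH \<Longrightarrow> h3 \<tau> = E4 \<tau> * A \<tau> + E6 \<tau> * B \<tau>"
      and h2AB: "\<And>\<tau>. \<tau> \<in> UH \<Longrightarrow> h2 \<tau> = pol4 \<tau> * A \<tau> + pol6 \<tau> * B \<tau>"
      by (rule eich_pair_decomposition[OF h2(1) h3 h2(2)]) blast
    define h' where "h' = (\<lambda>\<tau>. h1 \<tau> - s4 \<tau> * A \<tau> - s6 \<tau> * B \<tau>)"
    have "S_law k 4 h1" using h(2) by (simp add: x)
    hence "S_law k 4 h'"
      unfolding h'_def
      using S_law_mult[OF sS(1) scalar_formD(1)[OF AB(1)]] S_law_mult[OF sS(2) scalar_formD(1)[OF AB(2)]]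
      by (intro S_law_diff) auto
    moreover have "\<exists>d. q_exp 4 d h'"
      by (rule q_exp_ex_cong[OF q_exp_ex_diff[OF q_exp_ex_diff[OF q(1)[unfolded x]
              q_exp_ex_mult[OF s4 scalar_formD(2)[OF AB(1)], simplified]]
              q_exp_ex_mult[OF s6 scalar_formD(2)[OF AB(2)], simplified]]])
         (simp add: h'_def h2AB h3AB abc algebra_simps)
    ultimately have h': "scalar_form k 4 h'" by (rule scalar_formI)
    obtain r where r: "scalar_form (k - 8) 0 r" "\<And>\<tau>. \<tau> \<in> UH \<Longrightarrow> h' \<tau> = e \<tau> * r \<tau>"
      using scalar_form_eta4_factor[OF h'] by (auto simp: e_def)
    have h1: "h1 \<tau> = s4 \<tau> * A \<tau> + s6 \<tau> * B \<tau> + e \<tau> * r \<tau>" if "\<tau> \<in> UH" for \<tau>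
      using r(2)[OF that] by (simp add: h'_def algebra_simps)
    show ?thesis
      using AB r(1) by (rule_tac exI[of _ A], rule_tac exI[of _ B], rule_tac exI[of _ r])
        (auto simp: h(1) vec_eq_iff forall_3 lift_simps h1 h2AB h3AB algebra_simps simp del: UH_iff)
  qed
  have B4: "lift s4 pol4 E4 \<in> modular_forms 4 \<rho>" and B6: "lift s6 pol6 E6 \<in> modular_forms 6 \<rho>"
    by (rule lift_form; use sS s4 s6 pol4_S pol6_S pol4_q_exp pol6_q_exp eisenstein_forms in
        \<open>auto simp: x abc add.assoc\<close>)+
  have B8: "lift e (\<lambda>\<tau>. 0) (\<lambda>\<tau>. 0) \<in> modular_forms 8 \<rho>"
    by (rule lift_form; use scalar_formD[OF e(1)] in \<open>auto simp: x abc S_law_zero q_exp_zero_ex\<close>)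
  show "\<not> M_split \<rho> proj3 (quot3 \<rho>)"
  proof (rule not_M_split[OF x(3)])
    fix F \<tau> assume F: "F \<in> modular_forms 0 \<rho>" and \<tau>: "\<tau> \<in> UH"
    obtain A B r where AB: "scalar_form (0 - 4) 0 A" "scalar_form (0 - 6) 0 B"
      "\<forall>\<tau>\<in>UH. F \<tau> = A \<tau> *s lift s4 pol4 E4 \<tau> + B \<tau> *s lift s6 pol6 E6 \<tau> + r \<tau> *s lift e (\<lambda>\<tau>. 0) (\<lambda>\<tau>. 0) \<tau>"
      using decomp[OF F] by blast
    have "A \<tau> = 0" "B \<tau> = 0"
      using scalar_form_negative_weight[OF AB(1) _ \<tau>] scalar_form_negative_weight[OF AB(2) _ \<tau>] by simp_all
    thus "F \<tau> $ 3 = 0" using AB(3) \<tau> by (simp add: lift_simps del: UH_iff)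
  qed
  show "generating_weights \<rho> {#4, 6, 8#}"
  proof (rule generating_weights_three[OF B4 B6 B8])
    fix \<tau> y1 y2 y3 assume \<tau>: "\<tau> \<in> UH"
      and 0: "y1 *s lift s4 pol4 E4 \<tau> + y2 *s lift s6 pol6 E6 \<tau> + y3 *s lift e (\<lambda>\<tau>. 0) (\<lambda>\<tau>. 0) \<tau> = 0"
    have c3: "y1 * E4 \<tau> + y2 * E6 \<tau> = 0"
      using 0 by (simp add: vec_eq_iff forall_3 lift_simps[OF \<tau>])
    have "y1 * (pol4 \<tau> + c \<tau> * E4 \<tau>) + y2 * (pol6 \<tau> + c \<tau> * E6 \<tau>) = 0"
      using 0 by (simp add: vec_eq_iff forall_3 lift_simps[OF \<tau>])
    moreover have "y1 * (pol4 \<tau> + c \<tau> * E4 \<tau>) + y2 * (pol6 \<tau> + c \<tau> * E6 \<tau>) =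
        y1 * pol4 \<tau> + y2 * pol6 \<tau> + c \<tau> * (y1 * E4 \<tau> + y2 * E6 \<tau>)" by (simp add: algebra_simps)
    ultimately have "y1 * pol4 \<tau> + y2 * pol6 \<tau> = 0" using c3 by simp
    hence y: "y1 = 0" "y2 = 0" using pol_independent[OF \<tau> c3] by auto
    thus "y1 = 0 \<and> y2 = 0 \<and> y3 = 0"
      using 0 e(2)[OF \<tau>] by (simp add: vec_eq_iff forall_3 lift_simps[OF \<tau>])
  qed (rule decomp)
qed

text \<open>The quotient generator \<open>eta4\<close> lifts because v \<open>eta4\<close> has order
  0, and the term of order -1 in v^2 \<open>eta4\<close> is cancelled by s. After this lift is
  removed, components 1 and 2 form the pair with exponents (5, 0).\<close>

lemma exceptional_501:
  assumes x: "x1 = 5" "x2 = 0" "x3 = 1"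
    and abc: "a = (\<lambda>\<tau>. 2 * eich 1 \<tau>)" "b = (\<lambda>\<tau>. - (eich 1 \<tau> ^ 2))" "c = (\<lambda>\<tau>. - eich 1 \<tau>)"
  shows "M_split \<rho> proj3 (quot3 \<rho>)" "generating_weights \<rho> {#2, 4, 6#}"
proof -
  obtain e where e: "S_law 2 1 eta4" "e \<noteq> 0" "q_exp 1 e eta4" "q_exp (- 1) (inverse e) (\<lambda>\<tau>. inverse (eta4 \<tau>))"
    using eta4_properties by metis
  obtain d where d: "q_exp (- 1) d (eich 1)" using eich_properties(1)[of 1] by auto
  \<comment> \<open>The leading coefficients of v^2 \<open>eta4\<close> and of \<open>E4\<close> /
    \<open>eta4\<close> are d^2 e and 1/e, hence the factor d^2 e^2.\<close>
  define s where "s = (\<lambda>\<tau>. d\<^sup>2 * e\<^sup>2 * (E4 \<tau> * inverse (eta4 \<tau>)))"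
  have "S_law 2 (- 1) s"
    unfolding s_def using S_law_mult[OF eisenstein_forms(1) S_law_inverse[OF e(1)]] by (intro S_law_cmult) simp
  hence sS: "S_law 2 5 s" by (rule S_law_parity) simp
  have "q_exp (- 1) (d\<^sup>2 * e\<^sup>2 * (1 * inverse e)) s"
    unfolding s_def using q_exp_mult[OF eisenstein_forms(2) e(4)] by (intro q_exp_cmult) simp
  hence "q_exp (- 1) (d\<^sup>2 * e) s" using e(2) by (simp add: power2_eq_square mult_ac)
  moreover have "q_exp (- 1) (d\<^sup>2 * e) (\<lambda>\<tau>. eich 1 \<tau> ^ 2 * eta4 \<tau>)"
    using q_exp_mult[OF q_exp_power[OF d, of 2] e(3)] by simp
  ultimately have "q_exp (- 1) (d\<^sup>2 * e - d\<^sup>2 * e) (\<lambda>\<tau>. s \<tau> - eich 1 \<tau> ^ 2 * eta4 \<tau>)"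
    by (rule q_exp_diff)
  hence s: "\<exists>d. q_exp 5 d (\<lambda>\<tau>. s \<tau> - eich 1 \<tau> ^ 2 * eta4 \<tau>)"
    using q_exp_raise[of "- 1"] by simp
  have e3: "\<exists>d. q_exp 1 d eta4" using e(3) by blast
  have ve: "\<exists>d. q_exp 0 d (\<lambda>\<tau>. eich 1 \<tau> * eta4 \<tau>)" using q_exp_mult[OF d e(3)] by auto
  have mult: "lift (\<lambda>\<tau>. s \<tau> * r \<tau>) (\<lambda>\<tau>. 0 * r \<tau>) (\<lambda>\<tau>. eta4 \<tau> powi x3 * r \<tau>) \<in> modular_forms k \<rho>"
    if r: "scalar_form (k - 2 * x3) 0 r" for k r
  proof (rule lift_form)
    have r': "S_law (k - 2) 0 r" "\<exists>c. q_exp 0 c r" using r scalar_formD by (auto simp: x)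
    show "S_law k x1 (\<lambda>\<tau>. s \<tau> * r \<tau>)" using S_law_mult[OF sS r'(1)] by (simp add: x)
    show "S_law k x2 (\<lambda>\<tau>. 0 * r \<tau>)" by (simp add: S_law_zero)
    show "S_law k x3 (\<lambda>\<tau>. eta4 \<tau> powi x3 * r \<tau>)" using S_law_mult[OF e(1) r'(1)] by (simp add: x)
    show "\<exists>d. q_exp x1 d (\<lambda>\<tau>. s \<tau> * r \<tau> + a \<tau> * (0 * r \<tau>) + b \<tau> * (eta4 \<tau> powi x3 * r \<tau>))"
      using q_exp_ex_mult[OF s r'(2)] by (simp add: x abc algebra_simps)
    show "\<exists>d. q_exp x2 d (\<lambda>\<tau>. 0 * r \<tau> + c \<tau> * (eta4 \<tau> powi x3 * r \<tau>))"
      using q_exp_ex_diff[OF q_exp_zero_ex[of 0] q_exp_ex_mult[OF ve r'(2), simplified]] by (simp add: x abc mult.assoc)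
    show "\<exists>d. q_exp x3 d (\<lambda>\<tau>. eta4 \<tau> powi x3 * r \<tau>)"
      using q_exp_ex_mult[OF e3 r'(2)] by (simp add: x)
  qed
  show "M_split \<rho> proj3 (quot3 \<rho>)" using mult by (rule M_split_if_generator_lifts)
  have B2: "lift s (\<lambda>\<tau>. 0) eta4 \<in> modular_forms 2 \<rho>"
    using mult[of 2 "\<lambda>\<tau>. 1"] scalar_form_const by (simp add: x)
  have double: "\<exists>d. q_exp 5 d (\<lambda>\<tau>. 2 * f \<tau>)" if "\<exists>d. q_exp 5 d f" for f
    using that q_exp_cmult by blast
  have B4: "lift (\<lambda>\<tau>. 2 * pol4 \<tau>) E4 (\<lambda>\<tau>. 0) \<in> modular_forms 4 \<rho>"
    by (rule lift_form; use S_law_cmult[OF pol4_S, of 2] double[OF pol4_q_exp] eisenstein_forms in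
        \<open>auto simp: x abc S_law_zero q_exp_zero_ex distrib_left mult.assoc\<close>)
  have B6: "lift (\<lambda>\<tau>. 2 * pol6 \<tau>) E6 (\<lambda>\<tau>. 0) \<in> modular_forms 6 \<rho>"
    by (rule lift_form; use S_law_cmult[OF pol6_S, of 2] double[OF pol6_q_exp] eisenstein_forms in
        \<open>auto simp: x abc S_law_zero q_exp_zero_ex distrib_left mult.assoc\<close>)
  show "generating_weights \<rho> {#2, 4, 6#}"
  proof (rule generating_weights_three[OF B2 B4 B6])
    fix k F assume F: "F \<in> modular_forms k \<rho>"
    obtain h1 h2 h3 where h: "F = lift h1 h2 h3" "S_law k x1 h1" "S_law k x2 h2" "S_law k x3 h3"
      and q: "\<exists>e. q_exp x1 e (\<lambda>\<tau>. h1 \<tau> + a \<tau> * h2 \<tau> + b \<tau> * h3 \<tau>)"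
      "\<exists>e. q_exp x2 e (\<lambda>\<tau>. h2 \<tau> + c \<tau> * h3 \<tau>)" "\<exists>e. q_exp x3 e h3"
      by (rule form_cases[OF F])
    have h3: "scalar_form k 1 h3" using h(4) q(3) by (intro scalar_formI) (simp_all add: x)
    obtain r where r: "scalar_form (k - 2) 0 r" and h3r: "\<And>\<tau>. \<tau> \<in> UH \<Longrightarrow> h3 \<tau> = eta4 \<tau> * r \<tau>"
      using scalar_form_eta4_factor[OF h3] by auto
    have "\<exists>d. q_exp 0 d h2"
      by (rule q_exp_ex_cong[OF q_exp_ex_diff[OF q(2)[unfolded x] q_exp_ex_diff[OF q_exp_zero_ex
              q_exp_ex_mult[OF ve scalar_formD(2)[OF r], simplified]]]]) (simp add: abc h3r mult.assoc)
    hence h2: "scalar_form k 0 h2" using h(3) by (intro scalar_formI) (simp_all add: x)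
    \<comment> \<open>The entry \<open>a\<close> is 2v, so halving brings the pair into the form
      required by \<open>eich_pair_decomposition\<close>.\<close>
    define h' where "h' = (\<lambda>\<tau>. (1/2) * (h1 \<tau> - s \<tau> * r \<tau>))"
    have "S_law k 5 h1" using h(2) by (simp add: x)
    hence h'S: "S_law k 5 h'"
      unfolding h'_def using S_law_mult[OF sS scalar_formD(1)[OF r]] by (intro S_law_cmult S_law_diff) auto
    have "\<exists>d. q_exp 5 d (\<lambda>\<tau>. 2 * (h' \<tau> + eich 1 \<tau> * h2 \<tau>))"
      by (rule q_exp_ex_cong[OF q_exp_ex_diff[OF q(1)[unfolded x]
              q_exp_ex_mult[OF s scalar_formD(2)[OF r], simplified]]]) (simp add: h'_def abc h3r algebra_simps)
    then obtain d' where "q_exp 5 d' (\<lambda>\<tau>. 2 * (h' \<tau> + eich 1 \<tau> * h2 \<tau>))" by blast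
    hence "\<exists>d. q_exp 5 d (\<lambda>\<tau>. 1/2 * (2 * (h' \<tau> + eich 1 \<tau> * h2 \<tau>)))" using q_exp_cmult by blast
    hence h'q: "\<exists>d. q_exp 5 d (\<lambda>\<tau>. h' \<tau> + eich 1 \<tau> * h2 \<tau>)" by (rule q_exp_ex_cong) simp
    obtain A B where AB: "scalar_form (k - 4) 0 A" "scalar_form (k - 6) 0 B"
      and h2AB: "\<And>\<tau>. \<tau> \<in> UH \<Longrightarrow> h2 \<tau> = E4 \<tau> * A \<tau> + E6 \<tau> * B \<tau>"
      and h'AB: "\<And>\<tau>. \<tau> \<in> UH \<Longrightarrow> h' \<tau> = pol4 \<tau> * A \<tau> + pol6 \<tau> * B \<tau>"
      by (rule eich_pair_decomposition[OF h'S h2 h'q]) blast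
    have h1AB: "h1 \<tau> = s \<tau> * r \<tau> + 2 * (pol4 \<tau> * A \<tau> + pol6 \<tau> * B \<tau>)" if "\<tau> \<in> UH" for \<tau>
      using h'AB[OF that] by (simp add: h'_def field_simps)
    show "\<exists>r1 r2 r3. scalar_form (k - 2) 0 r1 \<and> scalar_form (k - 4) 0 r2 \<and> scalar_form (k - 6) 0 r3 \<and>
        (\<forall>\<tau>\<in>UH. F \<tau> = r1 \<tau> *s lift s (\<lambda>\<tau>. 0) eta4 \<tau> + r2 \<tau> *s lift (\<lambda>\<tau>. 2 * pol4 \<tau>) E4 (\<lambda>\<tau>. 0) \<tau>
          + r3 \<tau> *s lift (\<lambda>\<tau>. 2 * pol6 \<tau>) E6 (\<lambda>\<tau>. 0) \<tau>)"
      using AB r by (rule_tac exI[of _ r], rule_tac exI[of _ A], rule_tac exI[of _ B])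
        (auto simp: h(1) vec_eq_iff forall_3 lift_simps h1AB h2AB h3r algebra_simps simp del: UH_iff)
  next
    fix \<tau> y1 y2 y3 assume \<tau>: "\<tau> \<in> UH"
      and 0: "y1 *s lift s (\<lambda>\<tau>. 0) eta4 \<tau> + y2 *s lift (\<lambda>\<tau>. 2 * pol4 \<tau>) E4 (\<lambda>\<tau>. 0) \<tau>
        + y3 *s lift (\<lambda>\<tau>. 2 * pol6 \<tau>) E6 (\<lambda>\<tau>. 0) \<tau> = 0"
    have y1: "y1 = 0"
      using 0 eta4_nonzero[OF \<tau>] by (simp add: vec_eq_iff forall_3 lift_simps[OF \<tau>])
    have c2: "y2 * E4 \<tau> + y3 * E6 \<tau> = 0"
      using 0 y1 by (simp add: vec_eq_iff forall_3 lift_simps[OF \<tau>])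
    have "y2 * (2 * pol4 \<tau> + a \<tau> * E4 \<tau>) + y3 * (2 * pol6 \<tau> + a \<tau> * E6 \<tau>) = 0"
      using 0 y1 by (simp add: vec_eq_iff forall_3 lift_simps[OF \<tau>])
    moreover have "y2 * (2 * pol4 \<tau> + a \<tau> * E4 \<tau>) + y3 * (2 * pol6 \<tau> + a \<tau> * E6 \<tau>) =
        2 * (y2 * pol4 \<tau> + y3 * pol6 \<tau>) + a \<tau> * (y2 * E4 \<tau> + y3 * E6 \<tau>)" by (simp add: algebra_simps)
    ultimately have "2 * (y2 * pol4 \<tau> + y3 * pol6 \<tau>) = 0" unfolding c2 by simp
    hence "y2 * pol4 \<tau> + y3 * pol6 \<tau> = 0" by (simp only: mult_eq_0_iff zero_neq_numeral[symmetric] simp_thms)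
    thus "y1 = 0 \<and> y2 = 0 \<and> y3 = 0" using pol_independent[OF \<tau> c2] y1 by blast
  qed
qed

end

section \<open>The list\<close>

lemma eich_T: "d \<in> {1, - 1} \<Longrightarrow> \<tau> \<in> UH \<Longrightarrow> eich d (\<tau> + 1) = qe (of_int (- d) / 6) * eich d \<tau>"
  using eich_q_exp q_exp_T by blast

lemma qe_sixth_cong:
  assumes "6 dvd i - j"
  shows "qe (of_int i / 6) = qe (of_int j / 6)"
proof -
  obtain n where "i - j = 6 * n" using assms by (auto elim: dvdE)
  hence "i = j + 6 * n" by simp
  hence "complex_of_int i / 6 = of_int j / 6 + of_int n" by simp
  thus ?thesis by (simp only: qe_add qe_of_int mult_1_right)
qed

lemma minus_one_powi_cong: "even (i - j) \<Longrightarrow> (- 1 :: complex) powi i = (- 1) powi j"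
  by (auto simp: power_int_minus_left)

lemma minus_one_powi_square: "(- 1 :: complex) powi i * (- 1) powi i = 1"
  by (simp add: power_int_minus_left)

text \<open>The two entries lie in the first row and shift the exponent in opposite directions,
  hence \<open>eich d\<close> and \<open>eich (- d)\<close>. The factor \<sigma> turns their period
  1 into the entry 1 of S.\<close>

lemma type_A_data:
  fixes x1 x2 x3 d :: int
  assumes d: "d \<in> {1, - 1}" and x: "x1 \<in> {0..<6}" "x2 \<in> {0..<6}" "x3 \<in> {0..<6}" "x1 \<noteq> x2" "x1 \<noteq> x3" "x2 \<noteq> x3"
    and dvd: "6 dvd x2 - d - x1" "6 dvd x3 + d - x1"
  defines "\<sigma> \<equiv> (- 1 :: complex) powi x2"
  shows "triangular_data x1 x2 x3 1 1 0 (\<lambda>\<tau>. \<sigma> * eich d \<tau>) (\<lambda>\<tau>. \<sigma> * eich (- d) \<tau>) (\<lambda>\<tau>. 0)"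
    and "(- 1) powi x1 = - \<sigma>" "(- 1) powi x3 = \<sigma>"
proof -
  have "even (x1 - (x2 + 1))" "even (x3 - x2)" using d dvd by auto presburger+
  hence "(- 1 :: complex) powi x1 = (- 1) powi (x2 + 1)" "(- 1 :: complex) powi x3 = \<sigma>"
    unfolding \<sigma>_def by (intro minus_one_powi_cong; simp)+
  thus s1: "(- 1) powi x1 = - \<sigma>" and s3: "(- 1) powi x3 = \<sigma>"
    by (simp_all add: \<sigma>_def power_int_add)
  have ss: "\<sigma> * (\<sigma> * z) = z" for z using minus_one_powi_square[of x2] by (simp add: \<sigma>_def flip: mult.assoc)
  have ss1: "\<sigma> * \<sigma> = 1" using ss[of 1] by simp
  have md: "- d \<in> {1, - 1}" using d by auto
  have T: "eich d' (\<tau> + 1) * qe (of_int y / 6) = qe (of_int x1 / 6) * eich d' \<tau>"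
    if "d' \<in> {1, - 1}" "6 dvd y - d' - x1" "\<tau> \<in> UH" for d' y \<tau>
  proof -
    have "of_int (- d') / 6 + of_int y / 6 = (of_int (y - d') :: complex) / 6" by (simp add: field_simps)
    hence "qe (of_int (- d') / 6) * qe (of_int y / 6) = qe (of_int x1 / 6)"
      using qe_sixth_cong[OF that(2)] by (simp only: qe_add[symmetric])
    thus ?thesis unfolding eich_T[OF that(1,3)] by (metis mult.assoc mult.commute)
  qed
  show "triangular_data x1 x2 x3 1 1 0 (\<lambda>\<tau>. \<sigma> * eich d \<tau>) (\<lambda>\<tau>. \<sigma> * eich (- d) \<tau>) (\<lambda>\<tau>. 0)"
  proof
    fix \<tau> assume \<tau>: "\<tau> \<in> UH"
    show "(- 1) powi x2 * (\<sigma> * eich d (- 1 / \<tau>)) = 1 + (- 1) powi x1 * (\<sigma> * eich d \<tau>)"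
      unfolding eich_properties(2)[OF d \<tau>] s1 \<sigma>_def[symmetric] by (simp add: ss ss1 right_diff_distrib)
    show "(- 1) powi x3 * (\<sigma> * eich (- d) (- 1 / \<tau>)) = 1 + 1 * 0 + (- 1) powi x1 * (\<sigma> * eich (- d) \<tau>)"
      unfolding eich_properties(2)[OF md \<tau>] s1 s3 by (simp add: ss ss1 right_diff_distrib)
    show "\<sigma> * eich d (\<tau> + 1) * qe (of_int x2 / 6) = qe (of_int x1 / 6) * (\<sigma> * eich d \<tau>)"
      using T[OF d dvd(1) \<tau>] by (simp add: mult_ac)
    show "\<sigma> * eich (- d) (\<tau> + 1) * qe (of_int x3 / 6) = qe (of_int x1 / 6) * (\<sigma> * eich (- d) \<tau>)"
      using T[OF md _ \<tau>, of x3] dvd(2) by (simp add: mult_ac)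
  qed (use x in simp_all)
qed

text \<open>Up to the signs \<sigma> this is a symmetric square: both steps shift by the same d, and
  the entries are 2u, u^2 and u for u = \<open>eich d\<close>. The entry -2\<sigma> of S is the
  period of the first and also accounts for the cross term of (1 - u)^2.\<close>

lemma type_B_data:
  fixes x1 x2 x3 d :: int
  assumes d: "d \<in> {1, - 1}" and x: "x1 \<in> {0..<6}" "x2 \<in> {0..<6}" "x3 \<in> {0..<6}" "x1 \<noteq> x2" "x1 \<noteq> x3" "x2 \<noteq> x3"
    and dvd: "6 dvd x2 - d - x1" "6 dvd x3 - d - x2"
  defines "\<sigma> \<equiv> (- 1 :: complex) powi x1"
  shows "triangular_data x1 x2 x3 (- 2 * \<sigma>) 1 1 (\<lambda>\<tau>. 2 * eich d \<tau>) (\<lambda>\<tau>. \<sigma> * eich d \<tau> ^ 2) (\<lambda>\<tau>. \<sigma> * eich d \<tau>)"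
    and "(- 1) powi x2 = - \<sigma>" "(- 1) powi x3 = \<sigma>"
proof -
  have "even (x2 - (x1 + 1))" "even (x3 - x1)" using d dvd by auto presburger+
  hence "(- 1 :: complex) powi x2 = (- 1) powi (x1 + 1)" "(- 1 :: complex) powi x3 = \<sigma>"
    unfolding \<sigma>_def by (intro minus_one_powi_cong; simp)+
  thus s2: "(- 1) powi x2 = - \<sigma>" and s3: "(- 1) powi x3 = \<sigma>"
    by (simp_all add: \<sigma>_def power_int_add)
  have ss: "\<sigma> * (\<sigma> * z) = z" for z using minus_one_powi_square[of x1] by (simp add: \<sigma>_def flip: mult.assoc)
  have ss1: "\<sigma> * \<sigma> = 1" using ss[of 1] by simp
  have T: "eich d (\<tau> + 1) * qe (of_int y / 6) = qe (of_int y' / 6) * eich d \<tau>"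
    if "6 dvd y - d - y'" "\<tau> \<in> UH" for y y' \<tau>
  proof -
    have "of_int (- d) / 6 + of_int y / 6 = (of_int (y - d) :: complex) / 6" by (simp add: field_simps)
    hence "qe (of_int (- d) / 6) * qe (of_int y / 6) = qe (of_int y' / 6)"
      using qe_sixth_cong[OF that(1)] by (simp only: qe_add[symmetric])
    thus ?thesis unfolding eich_T[OF d that(2)] by (metis mult.assoc mult.commute)
  qed
  show "triangular_data x1 x2 x3 (- 2 * \<sigma>) 1 1 (\<lambda>\<tau>. 2 * eich d \<tau>) (\<lambda>\<tau>. \<sigma> * eich d \<tau> ^ 2) (\<lambda>\<tau>. \<sigma> * eich d \<tau>)"
  proof
    fix \<tau> assume \<tau>: "\<tau> \<in> UH"
    show "(- 1) powi x2 * (2 * eich d (- 1 / \<tau>)) = - 2 * \<sigma> + (- 1) powi x1 * (2 * eich d \<tau>)"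
      unfolding eich_properties(2)[OF d \<tau>] s2 \<sigma>_def[symmetric] by (simp add: algebra_simps)
    have "\<sigma> * (\<sigma> * (1 - eich d \<tau>)\<^sup>2) = 1 + - 2 * (\<sigma> * (\<sigma> * eich d \<tau>)) + \<sigma> * (\<sigma> * eich d \<tau> ^ 2)"
      unfolding ss by (simp add: power2_eq_square algebra_simps)
    thus "(- 1) powi x3 * (\<sigma> * eich d (- 1 / \<tau>) ^ 2) =
        1 + - 2 * \<sigma> * (\<sigma> * eich d \<tau>) + (- 1) powi x1 * (\<sigma> * eich d \<tau> ^ 2)"
      unfolding eich_properties(2)[OF d \<tau>] s3 \<sigma>_def[symmetric] by (simp only: mult.assoc)
    show "(- 1) powi x3 * (\<sigma> * eich d (- 1 / \<tau>)) = 1 + (- 1) powi x2 * (\<sigma> * eich d \<tau>)"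
      unfolding eich_properties(2)[OF d \<tau>] s2 s3 by (simp add: ss ss1 right_diff_distrib)
    show "2 * eich d (\<tau> + 1) * qe (of_int x2 / 6) = qe (of_int x1 / 6) * (2 * eich d \<tau>)"
      using T[OF dvd(1) \<tau>] by (simp add: mult_ac)
    show "\<sigma> * eich d (\<tau> + 1) * qe (of_int x3 / 6) = qe (of_int x2 / 6) * (\<sigma> * eich d \<tau>)"
      using T[OF dvd(2) \<tau>] by (simp add: mult_ac)
    have "eich d (\<tau> + 1) ^ 2 * qe (of_int x3 / 6) = eich d (\<tau> + 1) * (eich d (\<tau> + 1) * qe (of_int x3 / 6))"
      by (simp add: power2_eq_square mult_ac)
    also have "\<dots> = (eich d (\<tau> + 1) * qe (of_int x2 / 6)) * eich d \<tau>" unfolding T[OF dvd(2) \<tau>] by (simp add: mult_ac)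
    also have "\<dots> = qe (of_int x1 / 6) * eich d \<tau> ^ 2"
      unfolding T[OF dvd(1) \<tau>] by (simp add: power2_eq_square mult_ac)
    finally show "\<sigma> * eich d (\<tau> + 1) ^ 2 * qe (of_int x3 / 6) = qe (of_int x1 / 6) * (\<sigma> * eich d \<tau> ^ 2)"
      by (simp add: mult_ac)
  qed (use x in simp_all)
qed

lemma q_exp_ex_drop:
  assumes "\<exists>c. q_exp y c f" "y - x \<in> {0, 6}"
  shows "\<exists>c. q_exp x c f"
proof (cases "y = x")
  case False
  hence "y = x + 6" using assms(2) by auto
  thus ?thesis using assms(1) q_exp_drop by blast
qed (use assms in simp)

lemma eich_times_eta4:
  assumes "d \<in> {1, - 1}" "x - d - y \<in> {0, 6}"
  shows "\<exists>c. q_exp y c (\<lambda>\<tau>. s * eich d \<tau> * eta4 \<tau> powi x)"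
proof -
  obtain c1 c2 where "q_exp (- d) c1 (eich d)" "q_exp x c2 (\<lambda>\<tau>. eta4 \<tau> powi x)"
    using eich_q_exp[OF assms(1)] eta4_powi_coeff[of x] by blast
  from q_exp_mult[OF q_exp_cmult[OF this(1), of s] this(2)]
  show ?thesis by (rule q_exp_ex_drop[OF exI]) (use assms(2) in simp)
qed

lemma eich_square_times_eta4:
  assumes "d \<in> {1, - 1}" "x - 2 * d - y \<in> {0, 6}"
  shows "\<exists>c. q_exp y c (\<lambda>\<tau>. s * eich d \<tau> ^ 2 * eta4 \<tau> powi x)"
proof -
  obtain c1 c2 where "q_exp (- d) c1 (eich d)" "q_exp x c2 (\<lambda>\<tau>. eta4 \<tau> powi x)"
    using eich_q_exp[OF assms(1)] eta4_powi_coeff[of x] by blast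
  from q_exp_mult[OF q_exp_cmult[OF q_exp_power[OF this(1), of 2], of s] this(2)]
  show ?thesis by (rule q_exp_ex_drop[OF exI]) (use assms(2) in simp)
qed

section \<open>Arithmetic of the listed exponents\<close>

lemma lam_eq: "lam x = qe (of_int (int x) / 6)"
  by (simp add: lam_def qe_def)

lemma lam_cubed: "lam x ^ 3 = (- 1) powi int x"
proof -
  have "lam x ^ 3 = exp (of_nat x * (of_real pi * \<i>))"
    by (simp add: lam_def mult_ac flip: exp_of_nat_mult)
  also have "\<dots> = (- 1) ^ x" by (simp add: exp_of_nat_mult)
  finally show ?thesis by (simp add: power_int_of_nat)
qed

text \<open>The differences are the order of an entry times its power of \<open>eta4\<close>, minus
  the required order, in sixths.\<close>

lemma type_A_exponents:
  assumes "(x1, x2, x3) \<in> type_A"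
  obtains d where "d \<in> {1, - 1}" "6 dvd int x2 - d - int x1" "6 dvd int x3 + d - int x1"
    "(x1, x2, x3) \<noteq> (5, 4, 0) \<Longrightarrow> int x2 - d - int x1 \<in> {0, 6} \<and> int x3 + d - int x1 \<in> {0, 6}"
    "(x1, x2, x3) = (5, 4, 0) \<Longrightarrow> d = - 1"
proof -
  have "\<exists>d\<in>{1, - 1}. 6 dvd int x2 - d - int x1 \<and> 6 dvd int x3 + d - int x1 \<and>
    ((x1, x2, x3) \<noteq> (5, 4, 0) \<longrightarrow> int x2 - d - int x1 \<in> {0, 6} \<and> int x3 + d - int x1 \<in> {0, 6}) \<and>
    ((x1, x2, x3) = (5, 4, 0) \<longrightarrow> d = - 1)"
    using assms unfolding type_A_def by (elim insertE emptyE Pair_inject; simp)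
  thus ?thesis using that by blast
qed

lemma type_B_exponents:
  assumes "(x1, x2, x3) \<in> type_B"
  obtains d where "d \<in> {1, - 1}" "6 dvd int x2 - d - int x1" "6 dvd int x3 - d - int x2"
    "(x1, x2, x3) \<notin> {(5, 0, 1), (4, 5, 0)} \<Longrightarrow> int x2 - d - int x1 \<in> {0, 6} \<and>
       int x3 - d - int x2 \<in> {0, 6} \<and> int x3 - 2 * d - int x1 \<in> {0, 6}"
    "(x1, x2, x3) \<in> {(5, 0, 1), (4, 5, 0)} \<Longrightarrow> d = 1"
proof -
  have "\<exists>d\<in>{1, - 1}. 6 dvd int x2 - d - int x1 \<and> 6 dvd int x3 - d - int x2 \<and>
    ((x1, x2, x3) \<notin> {(5, 0, 1), (4, 5, 0)} \<longrightarrow> int x2 - d - int x1 \<in> {0, 6} \<and>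
       int x3 - d - int x2 \<in> {0, 6} \<and> int x3 - 2 * d - int x1 \<in> {0, 6}) \<and>
    ((x1, x2, x3) \<in> {(5, 0, 1), (4, 5, 0)} \<longrightarrow> d = 1)"
    using assms unfolding type_B_def by (elim insertE emptyE Pair_inject; simp)
  thus ?thesis using that by blast
qed

text \<open>Disjointness of the two types decides which of the two matrices for S
  \<open>is_rho\<close> prescribes.\<close>

lemma type_A_exclusions:
  assumes "(x1, x2, x3) \<in> type_A"
  shows "(x1, x2, x3) \<notin> type_B" "(x1, x2, x3) \<noteq> (5, 0, 1)" "(x1, x2, x3) \<noteq> (4, 5, 0)"
  using assms unfolding type_A_def by (elim insertE emptyE Pair_inject; simp add: type_B_def)+

lemma type_B_exclusion:
  assumes "(x1, x2, x3) \<in> type_B"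
  shows "(x1, x2, x3) \<noteq> (5, 4, 0)"
  using assms unfolding type_B_def by (elim insertE emptyE Pair_inject; simp)

lemma exponent_range:
  assumes "(x1, x2, x3) \<in> type_A \<union> type_B"
  shows "int x1 \<in> {0..<6}" "int x2 \<in> {0..<6}" "int x3 \<in> {0..<6}" "int x1 \<noteq> int x2" "int x1 \<noteq> int x3" "int x2 \<noteq> int x3"
  using assms unfolding Un_iff type_A_def type_B_def
  by (elim disjE insertE emptyE Pair_inject; simp)+

theorem theorem4p3:
  fixes x1 x2 x3 :: nat
  assumes "(x1, x2, x3) \<in> type_A \<union> type_B"
  shows "(\<exists>\<rho>. is_rho (x1, x2, x3) \<rho>) \<and>
    (\<forall>\<rho>. is_rho (x1, x2, x3) \<rho> \<longrightarrow>
       exact_sequence (sub12 \<rho>) incl12 \<rho> proj3 (quot3 \<rho>) \<and>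
       reducible_rep (sub12 \<rho>) \<and> indecomposable_rep (sub12 \<rho>) \<and>
       is_chi (2 * int x3) (quot3 \<rho>) \<and>
       ((x1, x2, x3) \<notin> {(5,4,0), (5,0,1), (4,5,0)} \<longrightarrow>
          M_split \<rho> proj3 (quot3 \<rho>) \<and>
          generating_weights \<rho> {#2 * int x1, 2 * int x2, 2 * int x3#}) \<and>
       ((x1, x2, x3) = (5,0,1) \<longrightarrow>
          M_split \<rho> proj3 (quot3 \<rho>) \<and> generating_weights \<rho> {#2, 4, 6#}) \<and>
       ((x1, x2, x3) \<in> {(5,4,0), (4,5,0)} \<longrightarrow>
          \<not> M_split \<rho> proj3 (quot3 \<rho>) \<and> generating_weights \<rho> {#4, 6, 8#}))"
proof (cases "(x1, x2, x3) \<in> type_A")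
  case True
  note notB = type_A_exclusions(1)[OF True] and ne = type_A_exclusions(2,3)[OF True]
  obtain d where d: "d \<in> {1, - 1}" "6 dvd int x2 - d - int x1" "6 dvd int x3 + d - int x1"
    "(x1, x2, x3) \<noteq> (5, 4, 0) \<Longrightarrow> int x2 - d - int x1 \<in> {0, 6} \<and> int x3 + d - int x1 \<in> {0, 6}"
    "(x1, x2, x3) = (5, 4, 0) \<Longrightarrow> d = - 1"
    by (rule type_A_exponents[OF True]) blast
  define \<sigma> where "\<sigma> = (- 1 :: complex) powi int x2"
  note data = type_A_data[OF d(1) exponent_range[OF assms] d(2,3), folded \<sigma>_def]
  interpret D: triangular_data "int x1" "int x2" "int x3" 1 1 0 "\<lambda>\<tau>. \<sigma> * eich d \<tau>" "\<lambda>\<tau>. \<sigma> * eich (- d) \<tau>" "\<lambda>\<tau>. 0"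
    by (rule data(1))
  have S: "D.S_tri = rho_S_A (x1, x2, x3)"
    unfolding D.S_tri_def rho_S_A_def prod.case Let_def lam_cubed data(2,3) \<sigma>_def[symmetric]
    by (rule refl)
  have T: "D.T_tri = rho_T (x1, x2, x3)"
    unfolding D.T_tri_def rho_T_def by (simp add: lam_eq)
  have "\<exists>\<rho>. is_rho (x1, x2, x3) \<rho>"
    using D.representation_exists True unfolding is_rho_def S T by blast
  moreover {
    fix \<rho> assume \<rho>: "is_rho (x1, x2, x3) \<rho>"
    have \<rho>': "PSL2Z_rep \<rho>" "\<rho> S_mat = D.S_tri" "\<rho> T_mat = D.T_tri"
      unfolding S T using \<rho> notB by (auto simp: is_rho_def)
    interpret R: triangular_rep "int x1" "int x2" "int x3" 1 1 0 "\<lambda>\<tau>. \<sigma> * eich d \<tau>" "\<lambda>\<tau>. \<sigma> * eich (- d) \<tau>" "\<lambda>\<tau>. 0" \<rho>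
      by unfold_locales (fact \<rho>')+
    have "M_split \<rho> proj3 (quot3 \<rho>) \<and> generating_weights \<rho> {#2 * int x1, 2 * int x2, 2 * int x3#}"
      if "(x1, x2, x3) \<noteq> (5, 4, 0)"
    proof -
      have md: "- d \<in> {1, - 1}" using d(1) by auto
      have "\<exists>e. q_exp (int x1) e (\<lambda>\<tau>. \<sigma> * eich d \<tau> * eta4 \<tau> powi int x2)"
        "\<exists>e. q_exp (int x1) e (\<lambda>\<tau>. \<sigma> * eich (- d) \<tau> * eta4 \<tau> powi int x3)"
        using d(4)[OF that] by (intro eich_times_eta4 d(1) md; simp)+
      moreover have "\<exists>e. q_exp (int x2) e (\<lambda>\<tau>. 0 * eta4 \<tau> powi int x3)" by (simp add: q_exp_zero_ex)
      ultimately show ?thesis using R.split_case by blast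
    qed
    moreover have "\<not> M_split \<rho> proj3 (quot3 \<rho>) \<and> generating_weights \<rho> {#4, 6, 8#}" if "(x1, x2, x3) = (5, 4, 0)"
      using R.exceptional_540 that d(5)[OF that] by (simp add: \<sigma>_def)
    ultimately have "exact_sequence (sub12 \<rho>) incl12 \<rho> proj3 (quot3 \<rho>) \<and>
       reducible_rep (sub12 \<rho>) \<and> indecomposable_rep (sub12 \<rho>) \<and>
       is_chi (2 * int x3) (quot3 \<rho>) \<and>
       ((x1, x2, x3) \<notin> {(5,4,0), (5,0,1), (4,5,0)} \<longrightarrow>
          M_split \<rho> proj3 (quot3 \<rho>) \<and>
          generating_weights \<rho> {#2 * int x1, 2 * int x2, 2 * int x3#}) \<and>
       ((x1, x2, x3) = (5,0,1) \<longrightarrow>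
          M_split \<rho> proj3 (quot3 \<rho>) \<and> generating_weights \<rho> {#2, 4, 6#}) \<and>
       ((x1, x2, x3) \<in> {(5,4,0), (4,5,0)} \<longrightarrow>
          \<not> M_split \<rho> proj3 (quot3 \<rho>) \<and> generating_weights \<rho> {#4, 6, 8#})"
      using R.exact R.reducible R.indecomposable[OF one_neq_zero] R.chi ne
      unfolding insert_iff empty_iff by blast
  }
  ultimately show ?thesis by blast
next
  case False
  hence True: "(x1, x2, x3) \<in> type_B" using assms by blast
  note ne = type_B_exclusion[OF True]
  obtain d where d: "d \<in> {1, - 1}" "6 dvd int x2 - d - int x1" "6 dvd int x3 - d - int x2"
    "(x1, x2, x3) \<notin> {(5, 0, 1), (4, 5, 0)} \<Longrightarrow> int x2 - d - int x1 \<in> {0, 6} \<and>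
       int x3 - d - int x2 \<in> {0, 6} \<and> int x3 - 2 * d - int x1 \<in> {0, 6}"
    "(x1, x2, x3) \<in> {(5, 0, 1), (4, 5, 0)} \<Longrightarrow> d = 1"
    by (rule type_B_exponents[OF True]) blast
  define \<sigma> where "\<sigma> = (- 1 :: complex) powi int x1"
  note data = type_B_data[OF d(1) exponent_range[OF assms] d(2,3), folded \<sigma>_def]
  have n12: "- 2 * \<sigma> \<noteq> 0" by (simp add: \<sigma>_def)
  interpret D: triangular_data "int x1" "int x2" "int x3" "- 2 * \<sigma>" 1 1
      "\<lambda>\<tau>. 2 * eich d \<tau>" "\<lambda>\<tau>. \<sigma> * eich d \<tau> ^ 2" "\<lambda>\<tau>. \<sigma> * eich d \<tau>"
    by (rule data(1))
  have S: "D.S_tri = rho_S_B (x1, x2, x3)"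
    unfolding D.S_tri_def rho_S_B_def prod.case Let_def lam_cubed data(2,3) \<sigma>_def[symmetric]
    by (rule refl)
  have T: "D.T_tri = rho_T (x1, x2, x3)"
    unfolding D.T_tri_def rho_T_def by (simp add: lam_eq)
  have "\<exists>\<rho>. is_rho (x1, x2, x3) \<rho>"
    using D.representation_exists True unfolding is_rho_def S T by blast
  moreover {
    fix \<rho> assume \<rho>: "is_rho (x1, x2, x3) \<rho>"
    have \<rho>': "PSL2Z_rep \<rho>" "\<rho> S_mat = D.S_tri" "\<rho> T_mat = D.T_tri"
      unfolding S T using \<rho> False by (auto simp: is_rho_def)
    interpret R: triangular_rep "int x1" "int x2" "int x3" "- 2 * \<sigma>" 1 1
        "\<lambda>\<tau>. 2 * eich d \<tau>" "\<lambda>\<tau>. \<sigma> * eich d \<tau> ^ 2" "\<lambda>\<tau>. \<sigma> * eich d \<tau>" \<rho>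
      by unfold_locales (fact \<rho>')+
    have "M_split \<rho> proj3 (quot3 \<rho>) \<and> generating_weights \<rho> {#2 * int x1, 2 * int x2, 2 * int x3#}"
      if "(x1, x2, x3) \<notin> {(5, 0, 1), (4, 5, 0)}"
    proof -
      have "\<exists>e. q_exp (int x1) e (\<lambda>\<tau>. 2 * eich d \<tau> * eta4 \<tau> powi int x2)"
        "\<exists>e. q_exp (int x2) e (\<lambda>\<tau>. \<sigma> * eich d \<tau> * eta4 \<tau> powi int x3)"
        "\<exists>e. q_exp (int x1) e (\<lambda>\<tau>. \<sigma> * eich d \<tau> ^ 2 * eta4 \<tau> powi int x3)"
        using d(4)[OF that] by (intro eich_times_eta4 eich_square_times_eta4 d(1); simp)+
      thus ?thesis using R.split_case by blast
    qed
    moreover have "M_split \<rho> proj3 (quot3 \<rho>) \<and> generating_weights \<rho> {#2, 4, 6#}" if "(x1, x2, x3) = (5, 0, 1)"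
      using R.exceptional_501 that d(5) by (simp add: \<sigma>_def)
    moreover have "\<not> M_split \<rho> proj3 (quot3 \<rho>) \<and> generating_weights \<rho> {#4, 6, 8#}" if "(x1, x2, x3) = (4, 5, 0)"
      using R.exceptional_450 that d(5) by (simp add: \<sigma>_def)
    ultimately have "exact_sequence (sub12 \<rho>) incl12 \<rho> proj3 (quot3 \<rho>) \<and>
       reducible_rep (sub12 \<rho>) \<and> indecomposable_rep (sub12 \<rho>) \<and>
       is_chi (2 * int x3) (quot3 \<rho>) \<and>
       ((x1, x2, x3) \<notin> {(5,4,0), (5,0,1), (4,5,0)} \<longrightarrow>
          M_split \<rho> proj3 (quot3 \<rho>) \<and>
          generating_weights \<rho> {#2 * int x1, 2 * int x2, 2 * int x3#}) \<and>
       ((x1, x2, x3) = (5,0,1) \<longrightarrow>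
          M_split \<rho> proj3 (quot3 \<rho>) \<and> generating_weights \<rho> {#2, 4, 6#}) \<and>
       ((x1, x2, x3) \<in> {(5,4,0), (4,5,0)} \<longrightarrow>
          \<not> M_split \<rho> proj3 (quot3 \<rho>) \<and> generating_weights \<rho> {#4, 6, 8#})"
      using R.exact R.reducible R.indecomposable[OF n12] R.chi ne
      unfolding insert_iff empty_iff by blast
  }
  ultimately show ?thesis by blast
qed

end
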